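(* For any partitions $\alpha$ and $\beta$ the following identities hold between linear operators on $\mathrm{Sym}$, all sums being over partitions: \begin{align*} D_{\beta}U_{\alpha}&=\sum_{\mu,\nu}\left(\sum_{\lambda} c^{\alpha}_{\lambda,\mu}\, c^{\beta}_{\lambda,\nu}\right) U_{\mu}D_{\nu},\\ U_{\alpha}D_{\beta}&=\sum_{\mu,\nu}\left(\sum_{\lambda} (-1)^{|\lambda|} c^{\alpha}_{\lambda,\mu}\, c^{\beta}_{\lambda',\nu}\right) D_{\nu}U_{\mu},\\ K_{\beta} U_{\alpha} &=\sum_{\mu,\nu}\left(\sum_{\lambda} g_{\alpha,\lambda,\mu}\, c^{\beta}_{\lambda,\nu} \right) U_{\mu}K_{\nu},\\ D_{\alpha}K_{\beta} &=\sum_{\mu,\nu}\left(\sum_{\lambda} g_{\alpha,\lambda,\mu}\, c^{\beta}_{\lambda,\nu} \right) K_{\nu}D_{\mu},\\ \overline{K}_{\beta} U_{\alpha}&=\sum_{\mu,\nu}\left( \sum_{\lambda, \sigma, \tau, \theta} g_{\lambda,\tau,\theta}\, c^{\beta}_{\lambda,\nu}\, c^{\alpha}_{\tau,\sigma}\, c_{\theta,\sigma}^{\mu} \right) U_{\mu} \overline{K}_{\nu},\\ D_{\alpha} \overline{K}_{\beta} &=\sum_{\mu,\nu}\left( \sum_{\lambda, \sigma, \tau, \theta} g_{\lambda,\tau,\theta}\, c^{\beta}_{\lambda,\nu}\, c^{\alpha}_{\tau,\sigma}\, c_{\theta,\sigma}^{\mu} \right) \overline{K}_{\nu} D_{\mu}.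 \end{align*}
   Context: $\mathrm{Sym}$ is the algebra of symmetric functions over $\mathbb{Q}$, with Schur basis $(s_\lambda)$, power sums $p_\lambda$, complete homogeneous functions $h_n$ ($h_0=1$, $h_n=0$ for $n<0$), and the Hall inner product (Schur functions orthonormal). $\lambda'$ is the conjugate partition of $\lambda$ and $|\lambda|$ its size. The Kronecker product $\ast$ is the bilinear product on $\mathrm{Sym}$ with $p_\lambda\ast p_\mu=\delta_{\lambda\mu}z_\lambda p_\lambda$, where $z_\lambda=\prod_i i^{m_i}m_i!$ and $m_i$ is the number of parts of $\lambda$ equal to $i$. The Littlewood--Richardson coefficients $c^{\nu}_{\lambda,\mu}$ and the Kronecker coefficients $g_{\lambda,\mu,\nu}$ are defined by $s_\lambda s_\mu=\sum_\nu c^{\nu}_{\lambda,\mu}s_\nu$ and $s_\lambda\ast s_\mu=\sum_\nu g_{\lambda,\mu,\nu}s_\nu$ (in particular $g_{\lambda,\mu,\nu}=0$ unless $|\lambda|=|\mu|=|\nu|$). For $f\in\mathrm{Sym}$: $U_f(g)=fg$; $D_f$ is the adjoint of $U_f$ for the Hall inner product; $K_f(g)=f\ast g$; and $U_\lambda=U_{s_\lambda}$, $D_\lambda=D_{s_\lambda}$, $K_\lambda=K_{s_\lambda}$. For a partition $\lambda$ and $g$ homogeneous of degree $n$, $\overline{K}_\lambda(g)=s_{(n-|\lambda|,\lambda_1,\lambda_2,\ldots)}\ast g$, extended linearly in $g$, where for any integer sequence $s_{(\alpha_1,\ldots,\alpha_N)}=\det(h_{\alpha_i+j-i})_{i,j=1,\ldots,N}$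 (Jacobi--Trudi). Products of operators are compositions. *)

theory Defs
  imports
    "HOL-Library.Multiset"
    "HOL-Library.Groups_Big_Fun"
    "Jordan_Normal_Form.Determinant"
begin

section \<open>Partitions\<close>

typedef partition = "{xs :: nat list. sorted_wrt (\<ge>) xs \<and> 0 \<notin> set xs}"
  morphisms parts Abs_partition
  by (rule exI[of _ "[]"]) simp

setup_lifting type_definition_partition

definition psize :: "partition \<Rightarrow> nat" where
  "psize la = sum_list (parts la)"

text \<open>The \<open>i\<close>-th part of the conjugate (counting from \<open>0\<close>) is the number of parts exceeding \<open>i\<close>.\<close>

lift_definition conj_partition :: "partition \<Rightarrow> partition" is
  "\<lambda>xs. map (\<lambda>i. length (filter (\<lambda>x. i < x) xs)) [0..<Max (set (0 # xs))]"
proof -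
  fix xs :: "nat list"
  let ?n = "Max (set (0 # xs))"
  let ?f = "\<lambda>i. length (filter (\<lambda>x. i < x) xs)"
  have anti: "?f j \<le> ?f i" if "i \<le> j" for i j
    using that by (induction xs) auto
  have pos: "?f i \<noteq> 0" if "i < ?n" for i
  proof -
    have "?n \<in> set (0 # xs)" by (intro Max_in) auto
    with that have "?n \<in> set xs" by auto
    with that have "?n \<in> set (filter (\<lambda>x. i < x) xs)" by simp
    thus ?thesis by fastforce
  qed
  show "sorted_wrt (\<ge>) (map ?f [0..<?n]) \<and> 0 \<notin> set (map ?f [0..<?n])"
  proof
    show "sorted_wrt (\<ge>) (map ?f [0..<?n])"
      unfolding sorted_wrt_iff_nth_less using anti by simp
    show "0 \<notin> set (map ?f [0..<?n])"
      using pos by (auto simp del: set_simps length_0_conv)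
  qed
qed

definition zee :: "partition \<Rightarrow> rat" where
  "zee la = (\<Prod>i\<in>set (parts la).
     of_nat (i ^ count_list (parts la) i * fact (count_list (parts la) i)))"


section \<open>The algebra of symmetric functions over the rationals\<close>

text \<open>
  A monomial in the variables \<open>x\<^sub>0, x\<^sub>1, x\<^sub>2, \<dots>\<close> is a finite multiset of
  indices, e.g. \<open>{#i, i, j#}\<close> for \<open>x\<^sub>i\<^sup>2 x\<^sub>j\<close>, and a formal power series is its
  coefficient function. A symmetric function is a power series of bounded degree
  that is invariant under all permutations of the variables.
\<close>

definition series_times ::
    "(nat multiset \<Rightarrow> rat) \<Rightarrow> (nat multiset \<Rightarrow> rat) \<Rightarrow> nat multiset \<Rightarrow> rat" where
  "series_times f g m = (\<Sum>a | a \<subseteq># m. f a * g (m - a))"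

definition bounded_degree :: "(nat multiset \<Rightarrow> rat) \<Rightarrow> bool" where
  "bounded_degree f \<longleftrightarrow> (\<exists>d. \<forall>m. size m > d \<longrightarrow> f m = 0)"

definition symmetric_series :: "(nat multiset \<Rightarrow> rat) \<Rightarrow> bool" where
  "symmetric_series f \<longleftrightarrow> (\<forall>\<pi>. bij \<pi> \<longrightarrow> (\<forall>m. f (image_mset \<pi> m) = f m))"

lemma finite_submultisets: "finite {a. a \<subseteq># (m :: 'a multiset)}"
proof (induction m)
  case (add x m)
  have "{a. a \<subseteq># add_mset x m} \<subseteq> {a. a \<subseteq># m} \<union> add_mset x ` {a. a \<subseteq># m}"
  proof
    fix a assume "a \<in> {a. a \<subseteq># add_mset x m}"
    hence a: "a \<subseteq># add_mset x m" by simp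
    show "a \<in> {a. a \<subseteq># m} \<union> add_mset x ` {a. a \<subseteq># m}"
    proof (cases "x \<in># a")
      case True
      then obtain b where "a = add_mset x b" by (metis multi_member_split)
      with a show ?thesis by auto
    next
      case False
      hence "a \<subseteq># m"
        using a by (metis diff_single_trivial subset_eq_diff_conv add_mset_add_single)
      thus ?thesis by simp
    qed
  qed
  thus ?case using add.IH finite_subset by blast
qed simp

lemma series_times_commute: "series_times f g = series_times g f"
proof
  fix m
  show "series_times f g m = series_times g f m"
    unfolding series_times_def
    by (rule sum.reindex_bij_witness[of _ "\<lambda>a. m - a" "\<lambda>a. m - a"])
       (auto simp: mult.commute subset_mset.diff_diff_right)
qed

lemma series_times_assoc:
  "series_times (series_times f g) h = series_times f (series_times g h)"
proof
  fix m
  have "series_times (series_times f g) h m =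
      (\<Sum>c | c \<subseteq># m. \<Sum>a | a \<subseteq># c. f a * g (c - a) * h (m - c))"
    by (simp add: series_times_def sum_distrib_right)
  also have "\<dots> = (\<Sum>(c, a)\<in>(SIGMA c:{c. c \<subseteq># m}. {a. a \<subseteq># c}). f a * g (c - a) * h (m - c))"
    by (rule sum.Sigma) (auto simp: finite_submultisets)
  also have "\<dots> = (\<Sum>(a, b)\<in>(SIGMA a:{a. a \<subseteq># m}. {b. b \<subseteq># m - a}). f a * g b * h (m - a - b))"
    by (rule sum.reindex_bij_witness[of _ "\<lambda>(a, b). (a + b, a)" "\<lambda>(c, a). (a, c - a)"])
       (auto simp: subset_eq_diff_conv union_commute
          intro: subset_mset.order_trans dest: mset_subset_eq_exists_conv[THEN iffD1])
  also have "\<dots> = (\<Sum>a | a \<subseteq># m. \<Sum>b | b \<subseteq># m - a. f a * g b * h (m - a - b))"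
    by (rule sum.Sigma[symmetric]) (auto simp: finite_submultisets)
  also have "\<dots> = series_times f (series_times g h) m"
    by (simp add: series_times_def sum_distrib_left mult.assoc)
  finally show "series_times (series_times f g) h m = series_times f (series_times g h) m" .
qed

lemma bounded_degree_add:
  assumes "bounded_degree f" "bounded_degree g"
  shows "bounded_degree (\<lambda>m. f m + g m)"
proof -
  obtain d e where "\<forall>m. size m > d \<longrightarrow> f m = 0" "\<forall>m. size m > e \<longrightarrow> g m = 0"
    using assms unfolding bounded_degree_def by blast
  hence "\<forall>m. size m > max d e \<longrightarrow> f m + g m = 0" by simp
  thus ?thesis unfolding bounded_degree_def by blast
qed

lemma bounded_degree_times:
  assumes "bounded_degree f" "bounded_degree g"
  shows "bounded_degree (series_times f g)"
proof -
  obtain d e where d: "\<And>m. size m > d \<Longrightarrow> f m = 0" and e: "\<And>m. size m > e \<Longrightarrow> g m = 0"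
    using assms unfolding bounded_degree_def by blast
  have "series_times f g m = 0" if "size m > d + e" for m
    unfolding series_times_def
  proof (rule sum.neutral, clarify)
    fix a assume "a \<subseteq># m"
    hence "size m = size a + size (m - a)"
      by (metis size_union subset_mset.add_diff_inverse)
    with that have "size a > d \<or> size (m - a) > e" by linarith
    thus "f a * g (m - a) = 0" using d e by auto
  qed
  thus ?thesis unfolding bounded_degree_def by blast
qed

lemma symmetric_series_times:
  assumes "symmetric_series f" "symmetric_series g"
  shows "symmetric_series (series_times f g)"
  unfolding symmetric_series_def
proof (intro allI impI)
  fix \<pi> :: "nat \<Rightarrow> nat" and m
  assume \<pi>: "bij \<pi>"
  have inv: "image_mset (inv_into UNIV \<pi>) (image_mset \<pi> a) = a"
            "image_mset \<pi> (image_mset (inv_into UNIV \<pi>) a) = a" for a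
    using \<pi> by (simp_all add: multiset.map_comp bij_is_inj surj_iff[THEN iffD1, OF bij_is_surj])
  show "series_times f g (image_mset \<pi> m) = series_times f g m"
    unfolding series_times_def
  proof (rule sum.reindex_bij_witness[of _ "image_mset \<pi>" "image_mset (inv_into UNIV \<pi>)"])
    fix a assume "a \<in> {a. a \<subseteq># image_mset \<pi> m}"
    hence a: "a \<subseteq># image_mset \<pi> m" by simp
    show sub: "image_mset (inv_into UNIV \<pi>) a \<in> {a. a \<subseteq># m}"
      using image_mset_subseteq_mono[OF a, of "inv_into UNIV \<pi>"] by (simp add: inv)
    have "m - image_mset (inv_into UNIV \<pi>) a = image_mset (inv_into UNIV \<pi>) (image_mset \<pi> m - a)"
      using a by (simp add: image_mset_Diff inv)
    moreover have "f (image_mset (inv_into UNIV \<pi>) a) = f a"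
      and "g (image_mset (inv_into UNIV \<pi>) (image_mset \<pi> m - a)) = g (image_mset \<pi> m - a)"
      using assms bij_imp_bij_inv[OF \<pi>] unfolding symmetric_series_def by blast+
    ultimately show "f (image_mset (inv_into UNIV \<pi>) a) * g (m - image_mset (inv_into UNIV \<pi>) a) =
        f a * g (image_mset \<pi> m - a)" by simp
  qed (auto simp: inv image_mset_subseteq_mono)
qed

typedef sym = "{f. bounded_degree f \<and> symmetric_series f}"
  morphisms coeff_mono Abs_sym
  by (rule exI[of _ "\<lambda>_. 0"]) (simp add: bounded_degree_def symmetric_series_def)

setup_lifting type_definition_sym

instantiation sym :: comm_ring_1
begin

lift_definition zero_sym :: sym is "\<lambda>_. 0"
  by (simp add: bounded_degree_def symmetric_series_def)

lift_definition one_sym :: sym is "\<lambda>m. if m = {#} then 1 else 0"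
  by (auto simp: bounded_degree_def symmetric_series_def intro!: exI[of _ 0])

lift_definition plus_sym :: "sym \<Rightarrow> sym \<Rightarrow> sym" is "\<lambda>f g m. f m + g m"
  by (auto simp: bounded_degree_add symmetric_series_def)

lift_definition uminus_sym :: "sym \<Rightarrow> sym" is "\<lambda>f m. - f m"
  by (auto simp: bounded_degree_def symmetric_series_def)

definition minus_sym :: "sym \<Rightarrow> sym \<Rightarrow> sym" where
  "minus_sym f g = f + - g"

lift_definition times_sym :: "sym \<Rightarrow> sym \<Rightarrow> sym" is series_times
  by (simp add: bounded_degree_times symmetric_series_times)

instance
proof
  fix a b c :: sym
  show "a + b + c = a + (b + c)" "a + b = b + a" "0 + a = a" "- a + a = 0"
    by (transfer; simp add: fun_eq_iff)+
  show "a - b = a + - b" by (simp add: minus_sym_def)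
  show "a * b * c = a * (b * c)" by transfer (rule series_times_assoc)
  show "a * b = b * a" by transfer (rule series_times_commute)
  show "1 * a = a"
  proof transfer
    fix f :: "nat multiset \<Rightarrow> rat"
    show "series_times (\<lambda>m. if m = {#} then 1 else 0) f = f"
    proof
      fix m
      have "series_times (\<lambda>m. if m = {#} then 1 else 0) f m =
          (\<Sum>a | a \<subseteq># m. if a = {#} then f m else 0)"
        unfolding series_times_def by (intro sum.cong) auto
      thus "series_times (\<lambda>m. if m = {#} then 1 else 0) f m = f m"
        by (simp add: sum.delta finite_submultisets)
    qed
  qed
  show "(a + b) * c = a * c + b * c"
    by transfer (simp add: series_times_def fun_eq_iff distrib_right sum.distrib)
  show "(0 :: sym) \<noteq> 1"
    by transfer (auto simp: fun_eq_iff)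
qed

end

lift_definition sym_scale :: "rat \<Rightarrow> sym \<Rightarrow> sym" (infixr \<open>*\<^sub>Q\<close> 75) is "\<lambda>c f m. c * f m"
  by (auto simp: bounded_degree_def symmetric_series_def)

interpretation sym: vector_space sym_scale
  by unfold_locales (transfer; simp add: fun_eq_iff algebra_simps)+


section \<open>Distinguished symmetric functions\<close>

lift_definition hom_component :: "nat \<Rightarrow> sym \<Rightarrow> sym" is
  "\<lambda>n f m. if size m = n then f m else 0"
  by (auto simp: bounded_degree_def symmetric_series_def)

text \<open>Complete homogeneous functions, indexed by the integers.\<close>

lift_definition hsym :: "int \<Rightarrow> sym" is
  "\<lambda>n m. if int (size m) = n then 1 else 0"
proof -
  fix n :: int
  show "bounded_degree (\<lambda>m. if int (size m) = n then 1 else 0) \<and>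
        symmetric_series (\<lambda>m. if int (size m) = n then 1 else 0)"
    by (auto simp: bounded_degree_def symmetric_series_def intro!: exI[of _ "nat n"])
qed

text \<open>The power sum \<open>x\<^sub>0\<^sup>n + x\<^sub>1\<^sup>n + \<dots>\<close>; only used for \<open>n \<ge> 1\<close>.\<close>

lift_definition power_sum :: "nat \<Rightarrow> sym" is
  "\<lambda>n m. if \<exists>i. m = replicate_mset n i then 1 else 0"
proof -
  fix n :: nat
  let ?f = "\<lambda>m :: nat multiset. if \<exists>i. m = replicate_mset n i then 1 else 0 :: rat"
  have "bounded_degree ?f"
    unfolding bounded_degree_def by (intro exI[of _ n]) auto
  moreover have "symmetric_series ?f"
    unfolding symmetric_series_def
  proof (intro allI impI)
    fix \<pi> :: "nat \<Rightarrow> nat" and m :: "nat multiset"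
    assume \<pi>: "bij \<pi>"
    have "(\<exists>i. image_mset \<pi> m = replicate_mset n i) \<longleftrightarrow> (\<exists>i. m = replicate_mset n i)"
    proof
      assume "\<exists>i. image_mset \<pi> m = replicate_mset n i"
      then obtain i where "image_mset \<pi> m = replicate_mset n i" ..
      hence "image_mset (inv_into UNIV \<pi>) (image_mset \<pi> m) = replicate_mset n (inv_into UNIV \<pi> i)" by simp
      moreover have "image_mset (inv_into UNIV \<pi>) (image_mset \<pi> m) = m"
        using \<pi> by (simp add: multiset.map_comp bij_is_inj)
      ultimately show "\<exists>i. m = replicate_mset n i" by auto
    qed auto
    thus "?f (image_mset \<pi> m) = ?f m" by simp
  qed
  ultimately show "bounded_degree ?f \<and> symmetric_series ?f" by blast
qed

definition psym :: "partition \<Rightarrow> sym" where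
  "psym la = prod_list (map power_sum (parts la))"

text \<open>Schur functions of arbitrary integer sequences, by the Jacobi--Trudi determinant.\<close>

definition schur_seq :: "int list \<Rightarrow> sym" where
  "schur_seq \<alpha> = det (mat (length \<alpha>) (length \<alpha>) (\<lambda>(i, j). hsym (\<alpha> ! i + int j - int i)))"

definition schur :: "partition \<Rightarrow> sym" where
  "schur la = schur_seq (map int (parts la))"

text \<open>Coordinates with respect to the Schur basis and the power sum basis.\<close>

definition schur_coeff :: "sym \<Rightarrow> partition \<Rightarrow> rat" where
  "schur_coeff f la = sym.representation (range schur) f (schur la)"

definition psym_coeff :: "sym \<Rightarrow> partition \<Rightarrow> rat" where
  "psym_coeff f la = sym.representation (range psym) f (psym la)"


section \<open>Hall inner product, Kronecker product, structure constants\<close>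

text \<open>
  All sums over partitions are taken with \<^const>\<open>Sum_any\<close>, the sum of a function
  of finite support over its whole domain type.
\<close>

text \<open>The bilinear form for which the Schur functions are orthonormal.\<close>

definition hall :: "sym \<Rightarrow> sym \<Rightarrow> rat" where
  "hall f g = Sum_any (\<lambda>la. schur_coeff f la * schur_coeff g la)"

text \<open>The bilinear product with \<open>p\<^sub>\<lambda> * p\<^sub>\<mu> = \<delta>\<^sub>\<lambda>\<^sub>\<mu> z\<^sub>\<lambda> p\<^sub>\<lambda>\<close>.\<close>

definition kronecker :: "sym \<Rightarrow> sym \<Rightarrow> sym" where
  "kronecker f g = Sum_any (\<lambda>la. (psym_coeff f la * psym_coeff g la * zee la) *\<^sub>Q psym la)"

text \<open>\<open>LR \<nu> \<lambda> \<mu>\<close> is the Littlewood--Richardson coefficient with upper index \<open>\<nu>\<close>.\<close>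

definition LR :: "partition \<Rightarrow> partition \<Rightarrow> partition \<Rightarrow> rat" where
  "LR \<nu> la \<mu> = schur_coeff (schur la * schur \<mu>) \<nu>"

definition kron_coeff :: "partition \<Rightarrow> partition \<Rightarrow> partition \<Rightarrow> rat" where
  "kron_coeff la \<mu> \<nu> = schur_coeff (kronecker (schur la) (schur \<mu>)) \<nu>"


section \<open>Operators\<close>

definition U_op :: "sym \<Rightarrow> sym \<Rightarrow> sym" where
  "U_op f = (\<lambda>g. f * g)"

definition D_op :: "sym \<Rightarrow> sym \<Rightarrow> sym" where
  "D_op f = (THE T. \<forall>g h. hall (T g) h = hall g (U_op f h))"

definition K_op :: "sym \<Rightarrow> sym \<Rightarrow> sym" where
  "K_op f = (\<lambda>g. kronecker f g)"

abbreviation U :: "partition \<Rightarrow> sym \<Rightarrow> sym" where "U la \<equiv> U_op (schur la)"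
abbreviation D :: "partition \<Rightarrow> sym \<Rightarrow> sym" where "D la \<equiv> D_op (schur la)"
abbreviation K :: "partition \<Rightarrow> sym \<Rightarrow> sym" where "K la \<equiv> K_op (schur la)"

text \<open>
  On the homogeneous component of degree \<open>n\<close>, \<open>Kbar \<lambda>\<close> is the Kronecker product
  with \<open>s\<close> of the integer sequence \<open>(n - |\<lambda>|, \<lambda>\<^sub>1, \<lambda>\<^sub>2, \<dots>)\<close>, whose first
  entry may be negative or smaller than \<open>\<lambda>\<^sub>1\<close>.
\<close>

definition Kbar :: "partition \<Rightarrow> sym \<Rightarrow> sym" where
  "Kbar la g = Sum_any (\<lambda>n.
     kronecker (schur_seq ((int n - int (psize la)) # map int (parts la))) (hom_component n g))"

text \<open>
  The operator \<open>\<Sum>\<^sub>\<mu>\<^sub>,\<^sub>\<nu> c(\<mu>, \<nu>) A\<^sub>\<mu>\<^sub>,\<^sub>\<nu>\<close>, for coefficients \<open>c\<close> of finite support.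
\<close>

definition op_sum ::
    "(partition \<Rightarrow> partition \<Rightarrow> rat) \<Rightarrow> (partition \<Rightarrow> partition \<Rightarrow> sym \<Rightarrow> sym) \<Rightarrow> sym \<Rightarrow> sym" where
  "op_sum c A = (\<lambda>g. Sum_any (\<lambda>(\<mu>, \<nu>). c \<mu> \<nu> *\<^sub>Q A \<mu> \<nu> g))"

end

theory Submission
  imports Defs "HOL-Combinatorics.Permutations"
begin

text \<open>
  Write \<open>\<langle>f, g\<rangle>\<close> for the Hall inner product, \<open>D\<^sub>f\<close> for the adjoint of multiplication by \<open>f\<close>, and
  let \<open>\<Delta> f = \<Sum> \<langle>f, s\<^sub>l s\<^sub>n\<rangle> s\<^sub>l \<otimes> s\<^sub>n\<close> be the coproduct of \<open>f\<close>, so that \<open>\<Delta> s\<^sub>\<beta>\<close> has the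
  Littlewood--Richardson coefficients as its coordinates. Each identity about a product says that
  an operator attached to \<open>f\<close> acts on a product through \<open>\<Delta> f\<close>:
  \<open>D\<^sub>f (a g) = \<Sum> D\<^sub>x a D\<^sub>y g\<close> (\<open>D_product\<close>) and \<open>f * (a g) = \<Sum> (x * a) (y * g)\<close>
  (\<open>kronecker_product\<close>), summed over the terms \<open>x \<otimes> y\<close> of \<open>\<Delta> f\<close>. The first and the third
  identity are these rules in Schur coordinates. The second one inverts the first one by means of
  the antipode \<open>S\<close>, that is, by \<open>\<Sum> x S(y) = \<langle>f, 1\<rangle>\<close> (\<open>antipode_convolution\<close>) and
  \<open>S(s\<^sub>\<lambda>) = (-1)\<^bsup>|\<lambda>|\<^esup> s\<^sub>\<lambda>\<^sub>'\<close> (\<open>antipode_schur\<close>). The fourth and the sixth identity are the adjoints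
  of the third and the fifth, because \<open>K\<close> and \<open>Kbar\<close> are self-adjoint.

  All of this becomes easy once the Hall product is known to be the form with
  \<open>\<langle>p\<^sub>\<lambda>, p\<^sub>\<mu>\<rangle> = z\<^sub>\<lambda>\<close> if \<open>\<lambda> = \<mu>\<close> and \<open>0\<close> otherwise, here called \<open>power_form\<close>. For that form the adjoint
  of multiplication by \<open>p\<^sub>n\<close> is the derivation \<open>n \<partial>/\<partial>p\<^sub>n\<close>, the Kronecker product satisfies
  \<open>f * p\<^sub>\<lambda> = \<langle>f, p\<^sub>\<lambda>\<rangle> p\<^sub>\<lambda>\<close>, and statements that are linear in an argument can be tested on
  products of power sums. So the main work is to show that the Schur functions, defined by
  Jacobi--Trudi determinants, are orthonormal for \<open>power_form\<close> (\<open>schur_orthonormal\<close>).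

  Two inverse algebra automorphisms make this possible. Put \<open>\<phi>(p\<^sub>n) = p\<^sub>n + 1\<close> (\<open>adjoin_one\<close>) and
  \<open>\<psi>(p\<^sub>n) = p\<^sub>n - 1\<close> (\<open>remove_one\<close>). The first is adjoint to multiplication by
  \<open>h\<^sub>0 + h\<^sub>1 + h\<^sub>2 + \<dots>\<close>, and \<open>\<psi>(h\<^sub>m) = h\<^sub>m - h\<^sub>m\<^sub>-\<^sub>1\<close>. On Jacobi--Trudi determinants both can
  be evaluated by column operations. This gives \<open>s\<^sub>(\<^sub>a\<^sub>,\<^sub>\<lambda>\<^sub>) = \<Sum>\<^sub>j h\<^sub>a\<^sub>+\<^sub>j C\<^sub>j\<close>, where \<open>C\<^sub>j\<close> is the homogeneous
  component of \<open>\<psi>(s\<^sub>\<lambda>)\<close> of degree \<open>|\<lambda>| - j\<close>, and it shows that the adjoint of multiplication by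
  \<open>h\<^sub>k\<close> kills \<open>s\<^sub>\<mu>\<close> for \<open>k > \<mu>\<^sub>1\<close> and removes the first row of \<open>\<mu>\<close> for \<open>k = \<mu>\<^sub>1\<close>. Orthonormality follows by
  induction on the number of rows. The Schur functions then form a basis, since in each degree there
  are as many of them as products of power sums.

  The same expansion governs \<open>Kbar\<close>: it yields
  \<open>Kbar\<^sub>\<lambda> p\<^sub>\<mu> = \<langle>\<psi>(s\<^sub>\<lambda>), \<phi>(p\<^sub>\<mu>)\<rangle> p\<^sub>\<mu>\<close> (\<open>Kbar_p_mon\<close>), and the fifth identity follows because \<open>\<phi>\<close> is
  multiplicative and \<open>\<psi>\<close> commutes with every \<open>D\<^sub>a\<close>.
\<close>

section \<open>Grading\<close>

text \<open>
  Degrees are integers because the entries of Jacobi--Trudi matrices are \<open>h\<^sub>n\<close> with \<open>n\<close> possibly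
  negative; only the zero function is homogeneous of negative degree.
\<close>

definition homog :: "int \<Rightarrow> sym \<Rightarrow> bool" where
  "homog d f \<longleftrightarrow> (\<forall>m. coeff_mono f m \<noteq> 0 \<longrightarrow> int (size m) = d)"

definition degree_le :: "nat \<Rightarrow> sym \<Rightarrow> bool" where
  "degree_le N f \<longleftrightarrow> (\<forall>m. coeff_mono f m \<noteq> 0 \<longrightarrow> size m \<le> N)"

lemmas coeff_simps = zero_sym.rep_eq one_sym.rep_eq plus_sym.rep_eq uminus_sym.rep_eq
  sym_scale.rep_eq hom_component.rep_eq hsym.rep_eq power_sum.rep_eq

lemma coeff_sum: "coeff_mono (sum f A) m = (\<Sum>a\<in>A. coeff_mono (f a) m)"
  by (induction A rule: infinite_finite_induct) (auto simp: coeff_simps)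

lemma coeff_times: "coeff_mono (f * g) m = (\<Sum>a | a \<subseteq># m. coeff_mono f a * coeff_mono g (m - a))"
  by (simp add: times_sym.rep_eq series_times_def)

lemma coeff_minus: "coeff_mono (f - g) m = coeff_mono f m - coeff_mono g m"
  unfolding minus_sym_def plus_sym.rep_eq uminus_sym.rep_eq by (rule diff_conv_add_uminus[symmetric])

lemma sym_eqI: "(\<And>m. coeff_mono f m = coeff_mono g m) \<Longrightarrow> f = g"
  by (metis coeff_mono_inject ext)

lemma coeff_times_nonzeroE:
  assumes "coeff_mono (f * g) m \<noteq> 0"
  obtains a b where "m = a + b" "coeff_mono f a \<noteq> 0" "coeff_mono g b \<noteq> 0"
proof -
  from assms obtain a where "a \<subseteq># m" "coeff_mono f a * coeff_mono g (m - a) \<noteq> 0"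
    unfolding coeff_times by (metis (mono_tags, lifting) mem_Collect_eq sum.neutral)
  thus ?thesis using that[of a "m - a"] by auto
qed

lemma scale_mult_left: "(c *\<^sub>Q f) * g = c *\<^sub>Q (f * g)"
  by (rule sym_eqI) (simp add: coeff_times coeff_simps sum_distrib_left mult.assoc)

lemma scale_mult_right: "f * (c *\<^sub>Q g) = c *\<^sub>Q (f * g)"
  by (metis scale_mult_left mult.commute)

lemma homog_0 [simp]: "homog d 0"
  by (simp add: homog_def coeff_simps)

lemma homog_1 [simp]: "homog 0 1"
  by (simp add: homog_def coeff_simps)

lemma homog_add: "homog d f \<Longrightarrow> homog d g \<Longrightarrow> homog d (f + g)"
  unfolding homog_def by (auto simp: coeff_simps) (metis add.right_neutral)

lemma homog_scale: "homog d f \<Longrightarrow> homog d (c *\<^sub>Q f)"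
  unfolding homog_def by (auto simp: coeff_simps)

lemma homog_uminus: "homog d f \<Longrightarrow> homog d (- f)"
  unfolding homog_def by (auto simp: coeff_simps)

lemma homog_sum: "(\<And>i. i \<in> A \<Longrightarrow> homog d (f i)) \<Longrightarrow> homog d (sum f A)"
  by (induction A rule: infinite_finite_induct) (auto intro: homog_add)

lemma homog_mult: "homog d f \<Longrightarrow> homog e g \<Longrightarrow> homog (d + e) (f * g)"
  unfolding homog_def by (auto elim!: coeff_times_nonzeroE) 

lemma homog_prod: "(\<And>i. i \<in> A \<Longrightarrow> homog (d i) (f i)) \<Longrightarrow> homog (\<Sum>i\<in>A. d i) (\<Prod>i\<in>A. f i)"
  by (induction A rule: infinite_finite_induct) (auto intro: homog_mult)

lemma homog_hsym [simp]: "homog n (hsym n)"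
  by (simp add: homog_def coeff_simps)

lemma homog_power_sum: "homog (int n) (power_sum n)"
  unfolding homog_def by (auto simp: coeff_simps)

lemma homog_neg: "homog d f \<Longrightarrow> d < 0 \<Longrightarrow> f = 0"
  by (rule sym_eqI) (force simp: homog_def coeff_simps)

lemma hsym_neg: "n < 0 \<Longrightarrow> hsym n = 0"
  using homog_neg homog_hsym by blast

lemma hsym_0: "hsym 0 = 1"
  by (rule sym_eqI) (auto simp: coeff_simps)

lemma degree_le_homog: "homog (int n) f \<Longrightarrow> n \<le> N \<Longrightarrow> degree_le N f"
  unfolding homog_def degree_le_def by (metis of_nat_eq_iff)

lemma degree_le_0 [simp]: "degree_le N 0"
  by (simp add: degree_le_def coeff_simps)

lemma degree_le_1 [simp]: "degree_le N 1"
  by (simp add: degree_le_def coeff_simps)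

lemma degree_le_add: "degree_le N f \<Longrightarrow> degree_le N g \<Longrightarrow> degree_le N (f + g)"
  unfolding degree_le_def by (auto simp: coeff_simps) (metis add.right_neutral)

lemma degree_le_scale: "degree_le N f \<Longrightarrow> degree_le N (c *\<^sub>Q f)"
  unfolding degree_le_def by (auto simp: coeff_simps)

lemma degree_le_sum: "(\<And>i. i \<in> A \<Longrightarrow> degree_le N (f i)) \<Longrightarrow> degree_le N (sum f A)"
  by (induction A rule: infinite_finite_induct) (auto intro: degree_le_add)

lemma degree_le_mult: "degree_le M f \<Longrightarrow> degree_le N g \<Longrightarrow> degree_le (M + N) (f * g)"
  unfolding degree_le_def by (auto elim!: coeff_times_nonzeroE) (metis add_mono)

lemma degree_le_mono: "degree_le M f \<Longrightarrow> M \<le> N \<Longrightarrow> degree_le N f"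
  unfolding degree_le_def by (meson order_trans)

lemma ex_degree_le: "\<exists>N. degree_le N f"
proof -
  have "bounded_degree (coeff_mono f)" using coeff_mono by blast
  thus ?thesis unfolding bounded_degree_def degree_le_def by (meson not_le_imp_less)
qed

section \<open>The power sum basis\<close>

text \<open>
  The multiset of exponents of a monomial. Two monomials lie in the same orbit of the permutations
  of the variables exactly if they have the same profile, so a symmetric function is determined by
  its coefficients at one monomial for each profile.
\<close>

definition profile :: "nat multiset \<Rightarrow> nat multiset" where
  "profile m = image_mset (count m) (mset_set (set_mset m))"

lemma size_profile: "size (profile m) = card (set_mset m)"
  by (simp add: profile_def)

lemma profile_pos: "0 \<notin># profile m"
  by (auto simp: profile_def count_eq_zero_iff)

lemma sum_mset_profile: "sum_mset (profile m) = size m"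
  unfolding profile_def size_multiset_overloaded_eq
  by (simp add: sum_unfold_sum_mset)

lemma profile_add:
  assumes "i \<notin># m" "n > 0"
  shows "profile (m + replicate_mset n i) = add_mset n (profile m)"
proof -
  have "set_mset (m + replicate_mset n i) = insert i (set_mset m)" using assms by auto
  moreover have "count (m + replicate_mset n i) i = n"
    using assms by (simp add: count_eq_zero_iff)
  moreover have "image_mset (count (m + replicate_mset n i)) (mset_set (set_mset m))
      = image_mset (count m) (mset_set (set_mset m))"
    by (rule image_mset_cong) (use assms in auto)
  ultimately show ?thesis using assms by (simp add: profile_def)
qed

text \<open>
  The supports of the two monomials may differ, so their exponent functions are compared on the union
  of the supports, where both take the value \<open>0\<close> equally often. Equal multisets of values yield a
  permutation of that union carrying one monomial to the other.
\<close>

lemma coeff_profile_cong: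
  assumes "profile m = profile m'"
  shows "coeff_mono f m = coeff_mono f m'"
proof -
  let ?A = "set_mset m \<union> set_mset m'"
  (* Over the union of both supports the values of count k are its profile together with zeros. *)
  have full: "image_mset (count k) (mset_set ?A)
      = profile k + replicate_mset (card ?A - size (profile k)) 0"
    if "set_mset k \<subseteq> ?A" for k
  proof -
    have "mset_set ?A = mset_set (set_mset k) + mset_set (?A - set_mset k)"
      by (metis that Diff_disjoint Diff_partition finite_Diff finite_Un finite_set_mset mset_set_Union)
    moreover have "image_mset (count k) (mset_set (?A - set_mset k)) = image_mset (\<lambda>_. 0) (mset_set (?A - set_mset k))"
      by (rule image_mset_cong) (auto simp: count_eq_zero_iff)
    moreover have "card (?A - set_mset k) = card ?A - card (set_mset k)"
      using that by (simp add: card_Diff_subset)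
    ultimately show ?thesis by (simp add: profile_def image_mset_const_eq)
  qed
  have "image_mset (count m) (mset_set ?A) = image_mset (count m') (mset_set ?A)"
    using full[of m] full[of m'] assms by auto
  from image_mset_eq_implies_permutes[OF _ this] obtain p
    where p: "p permutes ?A" "\<forall>x\<in>?A. count m x = count m' (p x)" by auto
  have "image_mset p m = m'"
  proof (rule multiset_eqI)
    fix y
    obtain x where x: "y = p x" using permutes_surj[OF p(1)] by auto
    have "p -` {p x} = {x}" using permutes_inj[OF p(1)] by (auto dest: injD)
    hence "count (image_mset p m) (p x) = count m x"
      by (cases "x \<in># m") (auto simp: count_image_mset count_eq_zero_iff)
    also have "\<dots> = count m' (p x)"
    proof (cases "x \<in> ?A")
      case False
      hence "p x = x" using p(1) permutes_not_in by metis
      moreover have "count m x = 0" "count m' x = 0" using False by (auto simp: not_in_iff)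
      ultimately show ?thesis using \<open>p x = x\<close> by metis
    next
      case True
      thus ?thesis using p(2) by blast
    qed
    finally show "count (image_mset p m) y = count m' y" using x by simp
  qed
  moreover have "symmetric_series (coeff_mono f)" using coeff_mono by blast
  ultimately show ?thesis using permutes_bij[OF p(1)] unfolding symmetric_series_def by metis
qed

text \<open>
  Products of power sums are indexed by multisets as well as by partitions, because
  multiplication then is the sum of multisets (\<open>p_mon_union\<close>).
\<close>

definition p_mon :: "nat multiset \<Rightarrow> sym" where
  "p_mon M = prod_mset (image_mset power_sum M)"

lemma p_mon_empty [simp]: "p_mon {#} = 1"
  by (simp add: p_mon_def)

lemma p_mon_add_mset [simp]: "p_mon (add_mset n M) = power_sum n * p_mon M"
  by (simp add: p_mon_def)

lemma p_mon_union: "p_mon (A + B) = p_mon A * p_mon B"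
  by (simp add: p_mon_def)

lemma homog_p_mon: "homog (int (sum_mset M)) (p_mon M)"
  by (induction M) (auto intro: homog_mult homog_power_sum)

lemma coeff_power_sum: "coeff_mono (power_sum n) a \<noteq> 0 \<longleftrightarrow> (\<exists>i. a = replicate_mset n i)"
  by (simp add: power_sum.rep_eq)

text \<open>
  A monomial of \<open>p\<^sub>M\<close> arises by choosing one variable for each element of \<open>M\<close>; the number of
  variables is maximal only if all choices are distinct, and then the exponents are the elements
  of \<open>M\<close>. This is the triangularity of the power sum products with respect to the monomial
  symmetric functions, ordered by the number of variables.
\<close>

lemma coeff_p_mon_support:
  assumes "coeff_mono (p_mon M) m \<noteq> 0" "0 \<notin># M"
  shows "card (set_mset m) \<le> size M \<and> (card (set_mset m) = size M \<longrightarrow> profile m = M)"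
  using assms
proof (induction M arbitrary: m)
  case empty
  thus ?case by (auto simp: one_sym.rep_eq profile_def split: if_splits)
next
  case (add n M)
  from add.prems obtain a b where ab: "m = a + b" "coeff_mono (power_sum n) a \<noteq> 0" "coeff_mono (p_mon M) b \<noteq> 0"
    by (auto elim: coeff_times_nonzeroE)
  then obtain i where a: "a = replicate_mset n i" by (auto simp: coeff_power_sum)
  have n: "n > 0" and IH: "card (set_mset b) \<le> size M" "card (set_mset b) = size M \<Longrightarrow> profile b = M"
    using add.IH[OF ab(3)] add.prems by auto
  have s: "set_mset m = insert i (set_mset b)" using ab a n by auto
  show ?case
  proof (cases "i \<in># b")
    case True
    thus ?thesis using s IH by (simp add: insert_absorb)
  next
    case False
    thus ?thesis using s IH n ab a profile_add[OF False n] by (auto simp: add.commute)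
  qed
qed

lemma coeff_p_mon_nonneg: "coeff_mono (p_mon M) m \<ge> 0"
  by (induction M arbitrary: m)
    (auto simp: one_sym.rep_eq coeff_times power_sum.rep_eq intro!: sum_nonneg)

lemma coeff_p_mon_pos: "profile m = M \<Longrightarrow> coeff_mono (p_mon M) m > 0"
proof (induction M arbitrary: m)
  case empty
  hence "m = {#}" using sum_mset_profile[of m] by auto
  thus ?case by (simp add: one_sym.rep_eq)
next
  case (add n M)
  have "n \<in># profile m" using add.prems by simp
  then obtain i where i: "i \<in># m" "count m i = n" by (auto simp: profile_def)
  hence n: "n > 0" by auto
  define b where "b = filter_mset (\<lambda>j. j \<noteq> i) m"
  have m: "m = b + replicate_mset n i"
    unfolding b_def using i by (auto intro!: multiset_eqI)
  have "profile m = add_mset n (profile b)"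
    unfolding m by (rule profile_add) (use n in \<open>auto simp: b_def\<close>)
  hence pos: "coeff_mono (p_mon M) b > 0" using add by simp
  have "0 < coeff_mono (power_sum n) (replicate_mset n i) * coeff_mono (p_mon M) b"
    using pos by (auto simp: power_sum.rep_eq)
  also have "\<dots> \<le> (\<Sum>a | a \<subseteq># m. coeff_mono (power_sum n) a * coeff_mono (p_mon M) (m - a))"
    by (rule order_trans[OF _ member_le_sum[where i = "replicate_mset n i"]])
       (auto simp: m finite_submultisets coeff_p_mon_nonneg power_sum.rep_eq)
  finally show ?case by (simp add: coeff_times)
qed

lemma ex_profile: "0 \<notin># M \<Longrightarrow> \<exists>m. profile m = M"
proof (induction M)
  case empty
  show ?case by (rule exI[of _ "{#}"]) (simp add: profile_def)
next
  case (add n M)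
  then obtain m where m: "profile m = M" by auto
  obtain i where "i \<notin># m" using ex_new_if_finite[OF infinite_UNIV_nat finite_set_mset] by blast
  thus ?case using profile_add[of i m n] add.prems m by (metis gr0I union_single_eq_member)
qed

definition part_mset :: "partition \<Rightarrow> nat multiset" where
  "part_mset la = mset (parts la)"

lemma parts_props: "sorted_wrt (\<ge>) (parts la)" "0 \<notin> set (parts la)"
  using parts by auto

lemma part_mset_pos: "0 \<notin># part_mset la"
  using parts_props(2) by (simp add: part_mset_def)

lemma part_mset_inj: "part_mset la = part_mset \<mu> \<Longrightarrow> la = \<mu>"
proof -
  assume "part_mset la = part_mset \<mu>"
  hence "mset (rev (parts la)) = mset (rev (parts \<mu>))" by (simp add: part_mset_def)
  moreover have "sorted (rev (parts k))" for k
    using parts_props(1)[of k] by (simp add: sorted_wrt_rev)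
  ultimately have "rev (parts la) = rev (parts \<mu>)"
    using properties_for_sort by metis
  thus ?thesis by (simp add: parts_inject)
qed

lemma ex_part_mset: "0 \<notin># M \<Longrightarrow> \<exists>la. part_mset la = M"
proof -
  assume M: "0 \<notin># M"
  have "sorted_wrt (\<ge>) (rev (sorted_list_of_multiset M))" 
    by (simp add: sorted_wrt_rev)
  hence "parts (Abs_partition (rev (sorted_list_of_multiset M))) = rev (sorted_list_of_multiset M)"
    using M by (intro Abs_partition_inverse) auto
  hence "part_mset (Abs_partition (rev (sorted_list_of_multiset M))) = M"
    by (simp add: part_mset_def)
  thus ?thesis by blast
qed

lemma psym_eq: "psym la = p_mon (part_mset la)"
  by (simp add: psym_def p_mon_def part_mset_def prod_mset_prod_list flip: mset_map)

lemma psize_eq: "psize la = sum_mset (part_mset la)"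
  by (simp add: psize_def part_mset_def sum_mset_sum_list)

lemma homog_psym: "homog (int (psize la)) (psym la)"
  unfolding psym_eq psize_eq by (rule homog_p_mon)

lemma coeff_psym_support:
  assumes "coeff_mono (psym la) m \<noteq> 0"
  shows "card (set_mset m) \<le> size (part_mset la)" "card (set_mset m) = size (part_mset la) \<Longrightarrow> profile m = part_mset la"
  using coeff_p_mon_support[of "part_mset la" m] assms part_mset_pos by (auto simp: psym_eq)

definition Par :: "nat \<Rightarrow> partition set" where
  "Par N = {la. psize la \<le> N}"

lemma finite_Par [simp]: "finite (Par N)"
proof -
  have "parts ` Par N \<subseteq> {xs. set xs \<subseteq> {..N} \<and> length xs \<le> N}"
  proof (safe)
    fix la x assume la: "la \<in> Par N"
    { assume "x \<in> set (parts la)"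
      thus "x \<le> N" using la member_le_sum_list[of x "parts la"] by (simp add: Par_def psize_def)
    }
    have "length xs \<le> sum_list xs" if "0 \<notin> set xs" for xs :: "nat list"
      using that by (induction xs) auto
    from this[OF parts_props(2), of la] show "length (parts la) \<le> N"
      using la by (simp add: Par_def psize_def)
  qed
  moreover have "finite {xs. set xs \<subseteq> {..N} \<and> length xs \<le> N}"
    by (rule finite_lists_length_le) simp
  ultimately have "finite (parts ` Par N)" by (rule finite_subset)
  thus ?thesis by (rule finite_imageD) (auto simp: inj_on_def parts_inject)
qed

lemma psym_inj: "inj psym"
proof (rule injI)
  have key: "la = \<mu>" if eq: "psym la = psym \<mu>" and le: "size (part_mset \<mu>) \<le> size (part_mset la)" for la \<mu>
  proof -
    obtain m where m: "profile m = part_mset la" using ex_profile part_mset_pos by blast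
    hence "coeff_mono (psym \<mu>) m \<noteq> 0" using coeff_p_mon_pos[OF m] eq by (simp add: psym_eq)
    from coeff_psym_support[OF this] have "profile m = part_mset \<mu>"
      using m le size_profile[of m] by auto
    thus ?thesis using m part_mset_inj by simp
  qed
  fix la \<mu> assume "psym la = psym \<mu>"
  thus "la = \<mu>" using key[of la \<mu>] key[of \<mu> la] by (cases "size (part_mset \<mu>) \<le> size (part_mset la)") auto
qed

text \<open>
  In a vanishing linear combination choose \<open>\<lambda>\<close> with the largest number of parts among those with a
  nonzero coefficient. By triangularity no other term contributes to a monomial of profile \<open>\<lambda>\<close>.
\<close>

lemma psym_independent: "\<not> sym.dependent (range psym)"
  unfolding sym.dependent_explicit
proof (clarify)
  fix T c v assume T: "finite T" "T \<subseteq> range psym" and s: "(\<Sum>v\<in>T. c v *\<^sub>Q v) = 0" and v: "v \<in> T" "c v \<noteq> 0"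
  define T' where "T' = {la. psym la \<in> T \<and> c (psym la) \<noteq> 0}"
  have fin: "finite T'"
    by (rule finite_subset[OF _ finite_vimageI[OF T(1) psym_inj]]) (auto simp: T'_def)
  have ne: "T' \<noteq> {}" using v T(2) by (auto simp: T'_def)
  define L where "L = Max ((\<lambda>la. size (part_mset la)) ` T')"
  have "L \<in> (\<lambda>la. size (part_mset la)) ` T'" unfolding L_def by (rule Max_in) (use fin ne in auto)
  then obtain la where la: "la \<in> T'" "size (part_mset la) = L" by auto
  have max: "size (part_mset \<mu>) \<le> L" if "\<mu> \<in> T'" for \<mu>
    unfolding L_def by (rule Max_ge) (use that fin in auto)
  obtain m where m: "profile m = part_mset la" using ex_profile part_mset_pos by blast
  have z: "coeff_mono (psym \<mu>) m = 0" if "\<mu> \<in> T'" "\<mu> \<noteq> la" for \<mu>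
  proof (rule ccontr)
    assume nz: "coeff_mono (psym \<mu>) m \<noteq> 0"
    have "profile m = part_mset \<mu>"
      using coeff_psym_support[OF nz] max[OF that(1)] m la size_profile[of m] by auto
    thus False using m part_mset_inj that by metis
  qed
  have "0 = coeff_mono (\<Sum>v\<in>T. c v *\<^sub>Q v) m" by (simp add: s coeff_simps)
  also have "(\<Sum>v\<in>T. c v *\<^sub>Q v) = (\<Sum>v\<in>psym ` T'. c v *\<^sub>Q v)"
    by (rule sum.mono_neutral_right) (use T in \<open>auto simp: T'_def\<close>)
  also have "\<dots> = (\<Sum>la\<in>T'. c (psym la) *\<^sub>Q psym la)"
    by (rule sum.reindex_cong[of psym]) (use psym_inj in \<open>auto simp: inj_on_def inj_def\<close>)
  also have "coeff_mono \<dots> m = (\<Sum>\<mu>\<in>T'. c (psym \<mu>) * coeff_mono (psym \<mu>) m)"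
    by (simp add: coeff_sum coeff_simps)
  also have "\<dots> = c (psym la) * coeff_mono (psym la) m"
    using z by (subst sum.remove[OF fin la(1)]) (auto intro!: sum.neutral)
  finally show False using la(1) coeff_p_mon_pos[OF m] by (auto simp: T'_def psym_eq)
qed

text \<open>
  Induction on a strict bound for the number of variables in the monomials of \<open>f\<close>. If that number
  is at most \<open>L\<close>, then by triangularity a combination of the \<open>p\<^sub>\<lambda>\<close> with exactly \<open>L\<close> parts cancels all
  monomials with \<open>L\<close> variables and creates none with more.
\<close>

lemma psym_span: "sym.span (range psym) = UNIV"
proof -
  have main: "f \<in> sym.span (range psym)" if "\<And>m. coeff_mono f m \<noteq> 0 \<Longrightarrow> card (set_mset m) < L" for f L
    using that
  proof (induction L arbitrary: f)
    case 0
    hence "f = 0" by (intro sym_eqI) (force simp: coeff_simps)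
    thus ?case by (simp add: sym.span_zero)
  next
    case (Suc L)
    obtain N where N: "degree_le N f" using ex_degree_le by blast
    define T where "T = {la \<in> Par N. size (part_mset la) = L}"
    have fin: "finite T" by (simp add: T_def)
    (* The scalar c la makes p_la times c la agree with f on the monomials of profile la; w la is one of them. *)
    define w where "w la = (SOME m. profile m = part_mset la)" for la
    have w: "profile (w la) = part_mset la" for la
      unfolding w_def using ex_profile[OF part_mset_pos] by (rule someI_ex)
    define c where "c la = coeff_mono f (w la) / coeff_mono (psym la) (w la)" for la
    define g where "g = (\<Sum>la\<in>T. c la *\<^sub>Q psym la)"
    have cg: "coeff_mono g m = (\<Sum>la\<in>T. c la * coeff_mono (psym la) m)" for m
      by (simp add: g_def coeff_sum coeff_simps)
    have "f - g \<in> sym.span (range psym)"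
    proof (rule Suc.IH, rule ccontr)
      fix m assume nz: "coeff_mono (f - g) m \<noteq> 0" and "\<not> card (set_mset m) < L"
      hence ge: "card (set_mset m) \<ge> L" by simp
      show False
      proof (cases "card (set_mset m) = L")
        case False
        hence "coeff_mono f m = 0" using Suc.prems[of m] ge by force
        moreover have "coeff_mono g m = 0" unfolding cg
          using coeff_psym_support(1) False ge by (intro sum.neutral) (force simp: T_def)
        ultimately show False using nz by (simp add: coeff_minus)
      next
        case True
        obtain la where la: "part_mset la = profile m" using ex_part_mset profile_pos by metis
        have z: "coeff_mono (psym \<mu>) m = 0" if "\<mu> \<in> T" "\<mu> \<noteq> la" for \<mu>
          using coeff_psym_support(2)[of \<mu> m] that la True part_mset_inj by (force simp: T_def)
        have "coeff_mono g m = (if la \<in> T then c la * coeff_mono (psym la) m else 0)"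
        proof (cases "la \<in> T")
          case True
          thus ?thesis unfolding cg using z by (subst sum.remove[OF fin True]) (auto intro!: sum.neutral)
        next
          case False
          hence "coeff_mono g m = 0" unfolding cg using z by (intro sum.neutral) (metis mult_zero_right)
          thus ?thesis using False by simp
        qed
        also have "\<dots> = coeff_mono f m"
        proof (cases "la \<in> T")
          case True
          have "coeff_mono k m = coeff_mono k (w la)" for k
            using coeff_profile_cong w la by metis
          moreover have "coeff_mono (psym la) (w la) > 0"
            using coeff_p_mon_pos[OF w] by (simp add: psym_eq)
          ultimately show ?thesis using True by (simp add: c_def)
        next
          case False
          have "size m = psize la" using la by (metis psize_eq sum_mset_profile)
          moreover have "size (part_mset la) = L" using la True size_profile by metis
          ultimately have "size m > N" using False by (auto simp: T_def Par_def)
          hence "coeff_mono f m = 0" using N unfolding degree_le_def by force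
          thus ?thesis using False by simp
        qed
        finally show False using nz by (simp add: coeff_minus)
      qed
    qed
    moreover have "g \<in> sym.span (range psym)"
      unfolding g_def by (intro sym.span_sum sym.span_scale sym.span_base) auto
    ultimately have "f - g + g \<in> sym.span (range psym)" by (rule sym.span_add)
    thus ?case by simp
  qed
  have "f \<in> sym.span (range psym)" for f
  proof -
    obtain N where N: "degree_le N f" using ex_degree_le by blast
    have "card (set_mset m) < Suc N" if "coeff_mono f m \<noteq> 0" for m
    proof -
      have "card (set_mset m) \<le> size m"
        by (metis card_mono finite_set_mset mset_set_set_mset_msubset size_mset_mono size_mset_set)
      thus ?thesis using N that unfolding degree_le_def by force
    qed
    thus ?thesis using main by blast
  qed
  thus ?thesis by blast
qed

lemma psym_coeff_add: "psym_coeff (f + g) la = psym_coeff f la + psym_coeff g la"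
  unfolding psym_coeff_def using psym_span
  by (subst sym.representation_add[OF psym_independent]) auto

lemma psym_coeff_scale: "psym_coeff (c *\<^sub>Q f) la = c * psym_coeff f la"
  unfolding psym_coeff_def using psym_span
  by (subst sym.representation_scale[OF psym_independent]) auto

lemma psym_coeff_psym: "psym_coeff (psym la) \<mu> = (if la = \<mu> then 1 else 0)"
  unfolding psym_coeff_def
  using sym.representation_basis[OF psym_independent, of "psym la"] psym_inj by (auto dest: injD)

lemma finite_psym_coeff [simp]: "finite {la. psym_coeff f la \<noteq> 0}"
proof -
  have "psym ` {la. psym_coeff f la \<noteq> 0} \<subseteq> {v. sym.representation (range psym) f v \<noteq> 0}"
    by (auto simp: psym_coeff_def)
  hence "finite (psym ` {la. psym_coeff f la \<noteq> 0})"
    using sym.finite_representation finite_subset by blast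
  thus ?thesis by (rule finite_imageD) (use psym_inj in \<open>auto simp: inj_on_def inj_def\<close>)
qed

lemma sym_linear_induct [case_names add scale p_mon]:
  assumes add: "\<And>f g. P f \<Longrightarrow> P g \<Longrightarrow> P (f + g)"
    and scale: "\<And>c f. P f \<Longrightarrow> P (c *\<^sub>Q f)"
    and p_mon: "\<And>M. 0 \<notin># M \<Longrightarrow> P (p_mon M)"
  shows "P f"
proof -
  have "f \<in> sym.span (range psym)" using psym_span by simp
  moreover have "sym.subspace {f. P f}"
    unfolding sym.subspace_def using add scale scale[OF p_mon[of "{#}"], of 0] by auto
  moreover have "g \<in> {f. P f}" if "g \<in> range psym" for g
    using that p_mon[OF part_mset_pos] by (auto simp: psym_eq)
  ultimately show ?thesis using sym.span_induct[of f "range psym" P] by blast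
qed

text \<open>
  Since \<open>Sym\<close> is generated as an algebra by the power sums, a linear property need only be
  propagated through multiplication by one \<open>p\<^sub>n\<close>. Most bialgebra laws below are proved this way.
\<close>

lemma sym_mult_induct [case_names add scale one power_sum]:
  assumes add: "\<And>f g. P f \<Longrightarrow> P g \<Longrightarrow> P (f + g)"
    and scale: "\<And>c f. P f \<Longrightarrow> P (c *\<^sub>Q f)"
    and one: "P 1"
    and ps: "\<And>n f. n > 0 \<Longrightarrow> P f \<Longrightarrow> P (power_sum n * f)"
  shows "P f"
proof (induction f rule: sym_linear_induct)
  case (p_mon M)
  thus ?case by (induction M) (auto intro: one ps)
qed (fact add scale)+

definition lin :: "(sym \<Rightarrow> sym) \<Rightarrow> bool" where
  "lin T \<longleftrightarrow> (\<forall>f g. T (f + g) = T f + T g) \<and> (\<forall>c f. T (c *\<^sub>Q f) = c *\<^sub>Q T f)"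

lemma lin_add: "lin T \<Longrightarrow> T (f + g) = T f + T g"
  and lin_scale: "lin T \<Longrightarrow> T (c *\<^sub>Q f) = c *\<^sub>Q T f"
  by (auto simp: lin_def)

lemma lin_0: "lin T \<Longrightarrow> T 0 = 0"
  using lin_scale[of T 0 0] by simp

lemma lin_sum: "lin T \<Longrightarrow> T (sum f A) = (\<Sum>a\<in>A. T (f a))"
  by (induction A rule: infinite_finite_induct) (auto simp: lin_0 lin_add)

lemma lin_uminus: "lin T \<Longrightarrow> T (- f) = - T f"
  using lin_scale[of T "-1" f] by simp

lemma lin_minus: "lin T \<Longrightarrow> T (f - g) = T f - T g"
  using lin_add[of T f "-g"] lin_uminus[of T g] by simp

text \<open>
  The linear extension of a prescription on the power sum basis. Indexing by multisets makes
  the multiplicativity of the algebra homomorphisms below immediate.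
\<close>

definition psym_extend :: "(nat multiset \<Rightarrow> sym) \<Rightarrow> sym \<Rightarrow> sym" where
  "psym_extend F f = (\<Sum>la | psym_coeff f la \<noteq> 0. psym_coeff f la *\<^sub>Q F (part_mset la))"

lemma psym_extend_superset:
  assumes "finite A" "{la. psym_coeff f la \<noteq> 0} \<subseteq> A"
  shows "psym_extend F f = (\<Sum>la\<in>A. psym_coeff f la *\<^sub>Q F (part_mset la))"
  unfolding psym_extend_def by (rule sum.mono_neutral_left) (use assms in auto)

lemma lin_psym_extend: "lin (psym_extend F)"
  unfolding lin_def
proof (intro conjI allI)
  fix f g
  let ?A = "{la. psym_coeff f la \<noteq> 0} \<union> {la. psym_coeff g la \<noteq> 0}"
  have *: "{la. psym_coeff (f + g) la \<noteq> 0} \<subseteq> ?A" by (auto simp: psym_coeff_add)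
  have fin: "finite ?A" by simp
  show "psym_extend F (f + g) = psym_extend F f + psym_extend F g"
    using psym_extend_superset[OF fin *, of F] psym_extend_superset[OF fin, of f F]
      psym_extend_superset[OF fin, of g F]
    by (simp add: psym_coeff_add sym.scale_left_distrib sum.distrib)
next
  fix c f
  have "psym_extend F (c *\<^sub>Q f) = (\<Sum>la | psym_coeff f la \<noteq> 0. psym_coeff (c *\<^sub>Q f) la *\<^sub>Q F (part_mset la))"
    by (rule psym_extend_superset) (auto simp: psym_coeff_scale)
  thus "psym_extend F (c *\<^sub>Q f) = c *\<^sub>Q psym_extend F f"
    by (simp add: psym_extend_def psym_coeff_scale sym.scale_sum_right)
qed

lemma psym_extend_psym: "psym_extend F (psym la) = F (part_mset la)"
  unfolding psym_extend_def
  by (simp add: psym_coeff_psym cong: conj_cong)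

lemma psym_extend_p_mon: "0 \<notin># M \<Longrightarrow> psym_extend F (p_mon M) = F M"
  using ex_part_mset[of M] psym_extend_psym[of F] by (metis psym_eq)

lemma lin_eqI:
  assumes "lin S" "lin T" "\<And>M. 0 \<notin># M \<Longrightarrow> S (p_mon M) = T (p_mon M)"
  shows "S f = T f"
  by (induction f rule: sym_linear_induct) (use assms in \<open>auto simp: lin_add lin_scale\<close>)

lemma psym_expansion: "f = (\<Sum>la | psym_coeff f la \<noteq> 0. psym_coeff f la *\<^sub>Q psym la)"
proof -
  have "lin (\<lambda>f. f)" by (simp add: lin_def)
  from lin_eqI[OF this lin_psym_extend, of p_mon f] have "f = psym_extend p_mon f"
    by (simp add: psym_extend_p_mon)
  thus ?thesis by (simp add: psym_extend_def psym_eq)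
qed

section \<open>The power sum form\<close>

text \<open>
  The Hall inner product, described by the power sum basis. That it agrees with the definition by
  orthonormal Schur functions is \<open>hall_eq_power_form\<close>.
\<close>

definition power_form :: "sym \<Rightarrow> sym \<Rightarrow> rat" where
  "power_form f g = (\<Sum>la | psym_coeff f la \<noteq> 0. psym_coeff f la * psym_coeff g la * zee la)"

lemma power_form_superset:
  assumes "finite A" "{la. psym_coeff f la \<noteq> 0} \<subseteq> A \<or> {la. psym_coeff g la \<noteq> 0} \<subseteq> A"
  shows "power_form f g = (\<Sum>la\<in>A. psym_coeff f la * psym_coeff g la * zee la)"
  unfolding power_form_def by (rule sum.mono_neutral_cong) (use assms in auto)

lemma power_form_commute: "power_form f g = power_form g f"
  unfolding power_form_superset[of "{la. psym_coeff f la \<noteq> 0}" f g, simplified]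
    power_form_superset[of "{la. psym_coeff f la \<noteq> 0}" g f, simplified]
  by (rule sum.cong) auto

lemma power_form_add_right: "power_form f (g + h) = power_form f g + power_form f h"
  by (simp add: power_form_def psym_coeff_add algebra_simps sum.distrib)

lemma power_form_scale_right: "power_form f (c *\<^sub>Q g) = c * power_form f g"
  by (simp add: power_form_def psym_coeff_scale sum_distrib_left mult_ac)

lemma power_form_add_left: "power_form (g + h) f = power_form g f + power_form h f"
  and power_form_scale_left: "power_form (c *\<^sub>Q g) f = c * power_form g f"
  using power_form_add_right power_form_scale_right power_form_commute by metis+

lemma power_form_0_right [simp]: "power_form f 0 = 0"
  using power_form_scale_right[of f 0 0] by simp

lemma power_form_0_left [simp]: "power_form 0 f = 0"
  using power_form_commute power_form_0_right by metis

lemma power_form_sum_right: "power_form f (sum g A) = (\<Sum>a\<in>A. power_form f (g a))"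
  by (induction A rule: infinite_finite_induct) (auto simp: power_form_add_right)

lemma power_form_sum_left: "power_form (sum g A) f = (\<Sum>a\<in>A. power_form (g a) f)"
  by (subst power_form_commute, subst power_form_sum_right) (simp add: power_form_commute)

lemma power_form_uminus_right: "power_form f (- g) = - power_form f g"
  using power_form_scale_right[of f "-1" g] by simp

lemma power_form_minus_right: "power_form f (g - h) = power_form f g - power_form f h"
  using power_form_add_right[of f g "-h"] by (simp add: power_form_uminus_right)

lemma power_form_minus_left: "power_form (g - h) f = power_form g f - power_form h f"
  by (metis power_form_commute power_form_minus_right)

lemma zee_pos: "zee la > 0"
  unfolding zee_def by (rule prod_pos) (use parts_props(2) in \<open>auto intro!: mult_pos_pos gr0I\<close>)

lemma power_form_psym: "power_form f (psym la) = psym_coeff f la * zee la"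
  using power_form_superset[of "{la}" f "psym la"] by (auto simp: psym_coeff_psym)

lemma power_form_psym_psym: "power_form (psym la) (psym \<mu>) = (if la = \<mu> then zee la else 0)"
  by (simp add: power_form_psym psym_coeff_psym)

text \<open>
  Positivity of \<open>z\<^sub>\<lambda>\<close> makes the form definite over \<open>\<rat>\<close>. This is used both for uniqueness of
  adjoints and to identify a vector from its norm in \<open>antipode_schur\<close>.
\<close>

lemma power_form_definite: "power_form f f = 0 \<Longrightarrow> f = 0"
proof -
  assume "power_form f f = 0"
  hence "\<forall>la\<in>{la. psym_coeff f la \<noteq> 0}. psym_coeff f la * psym_coeff f la * zee la = 0"
    unfolding power_form_def using zee_pos
    by (subst (asm) sum_nonneg_eq_0_iff) (simp_all add: less_imp_le)
  hence "psym_coeff f la = 0" for la using zee_pos[of la] by auto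
  thus "f = 0" using psym_expansion[of f] by simp
qed

lemma power_form_eqI: "(\<And>g. power_form f g = power_form f' g) \<Longrightarrow> f = f'"
  using power_form_definite[of "f - f'"] by (simp add: power_form_minus_left)

text \<open>
  The number \<open>z\<^sub>\<lambda>\<close> as a function of a multiset, so that its change under adding one part can be
  stated.
\<close>

definition mset_zee :: "nat multiset \<Rightarrow> rat" where
  "mset_zee M = (\<Prod>i\<in>set_mset M. of_nat (i ^ count M i * fact (count M i)))"

lemma zee_eq: "zee la = mset_zee (part_mset la)"
  by (simp add: zee_def mset_zee_def part_mset_def flip: count_mset)

lemma power_form_p_mon_p_mon:
  assumes "0 \<notin># M" "0 \<notin># N"
  shows "power_form (p_mon M) (p_mon N) = (if M = N then mset_zee M else 0)"
proof -
  obtain la \<mu> where "part_mset la = M" "part_mset \<mu> = N" using assms ex_part_mset by metis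
  thus ?thesis using power_form_psym_psym[of la \<mu>] part_mset_inj by (auto simp: psym_eq zee_eq)
qed

lemma mset_zee_add:
  assumes "n > 0"
  shows "mset_zee (add_mset n M) = of_nat (n * Suc (count M n)) * mset_zee M"
proof -
  let ?g = "\<lambda>i. of_nat (i ^ count M i * fact (count M i)) :: rat"
  have rest: "(\<Prod>i\<in>set_mset M - {n}. of_nat (i ^ count (add_mset n M) i * fact (count (add_mset n M) i)))
     = (\<Prod>i\<in>set_mset M - {n}. ?g i)"
    by (rule prod.cong) auto
  have "mset_zee (add_mset n M) = of_nat (n ^ Suc (count M n) * fact (Suc (count M n)))
     * (\<Prod>i\<in>set_mset M - {n}. ?g i)"
    unfolding mset_zee_def set_mset_add_mset_insert prod.insert_remove[OF finite_set_mset] rest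
    by (simp only: count_add_mset simp_thms if_True)
  also have "\<dots> = of_nat (n * Suc (count M n)) * (?g n * (\<Prod>i\<in>set_mset M - {n}. ?g i))"
    by (simp only: power_Suc fact_Suc of_nat_mult of_nat_id mult_ac)
  also have "?g n * (\<Prod>i\<in>set_mset M - {n}. ?g i) = mset_zee M"
  proof (cases "n \<in># M")
    case True
    thus ?thesis unfolding mset_zee_def by (subst prod.remove[of _ n]) auto
  next
    case False
    thus ?thesis unfolding mset_zee_def by (simp add: not_in_iff)
  qed
  finally show ?thesis .
qed

text \<open>
  The terms of other degrees in the power sum expansion of \<open>f\<close> sum to zero, since \<open>f\<close> has no
  monomials of those degrees; uniqueness of coordinates does the rest.
\<close>

lemma psym_coeff_homog:
  assumes "homog d f" "int (psize la) \<noteq> d"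
  shows "psym_coeff f la = 0"
proof -
  let ?A = "{la. psym_coeff f la \<noteq> 0}"
  let ?t = "\<lambda>la. psym_coeff f la *\<^sub>Q psym la"
  define g where "g = (\<Sum>la\<in>{la\<in>?A. int (psize la) \<noteq> d}. ?t la)"
  define k where "k = (\<Sum>la\<in>{la\<in>?A. int (psize la) = d}. ?t la)"
  have "f = k + g"
    unfolding g_def k_def
    by (subst psym_expansion[of f], subst sum.union_disjoint[symmetric]) (auto intro!: sum.cong)
  have homk: "homog d k" unfolding k_def
    using homog_psym by (intro homog_sum homog_scale) auto
  have g0: "g = 0"
  proof (rule sym_eqI)
    fix m
    show "coeff_mono g m = coeff_mono 0 m"
    proof (cases "int (size m) = d")
      case True
      have "coeff_mono (psym la) m = 0" if "int (psize la) \<noteq> d" for la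
        using homog_psym[of la] that True unfolding homog_def by fastforce
      thus ?thesis unfolding g_def coeff_sum by (auto simp: coeff_simps intro!: sum.neutral)
    next
      case False
      hence "coeff_mono f m = 0" "coeff_mono k m = 0" using assms(1) homk unfolding homog_def by blast+
      thus ?thesis using \<open>f = k + g\<close> by (simp add: coeff_simps)
    qed
  qed
  have fk: "f = k" using g0 \<open>f = k + g\<close> by simp
  have "psym_coeff k la = (\<Sum>\<mu>\<in>{\<mu>\<in>?A. int (psize \<mu>) = d}. psym_coeff f \<mu> * psym_coeff (psym \<mu>) la)"
  proof -
    have "psym_coeff (sum h B) la = (\<Sum>b\<in>B. psym_coeff (h b) la)" for h and B :: "partition set"
      using psym_coeff_scale[of 0 0 la] 
      by (induction B rule: infinite_finite_induct) (auto simp: psym_coeff_add)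
    thus ?thesis unfolding k_def by (simp add: psym_coeff_scale)
  qed
  also have "\<dots> = 0" using assms(2) by (intro sum.neutral) (auto simp: psym_coeff_psym)
  finally show ?thesis using fk by simp
qed

lemma power_form_homog:
  assumes "homog d f" "homog e g" "d \<noteq> e"
  shows "power_form f g = 0"
  unfolding power_form_def using psym_coeff_homog[OF assms(1)] psym_coeff_homog[OF assms(2)] assms(3)
  by (intro sum.neutral) (metis mult_eq_0_iff)

lemma homog_hom_component: "homog (int n) (hom_component n f)"
  by (simp add: homog_def coeff_simps)

lemma hom_component_homog: "homog d f \<Longrightarrow> hom_component n f = (if d = int n then f else 0)"
  by (rule sym_eqI) (auto simp: homog_def coeff_simps)

lemma hom_component_sum:
  assumes "degree_le N f" shows "f = (\<Sum>n\<le>N. hom_component n f)"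
  by (rule sym_eqI) (use assms in \<open>auto simp: degree_le_def coeff_sum coeff_simps\<close>)

lemma psym_coeff_degree_le:
  assumes "degree_le N f" "psize la > N"
  shows "psym_coeff f la = 0"
proof -
  have "power_form f (psym la) = (\<Sum>n\<le>N. power_form (hom_component n f) (psym la))"
    by (subst hom_component_sum[OF assms(1)]) (rule power_form_sum_left)
  also have "\<dots> = 0"
    using assms(2) power_form_homog[OF homog_hom_component homog_psym] by (intro sum.neutral) auto
  finally show ?thesis using zee_pos[of la] by (simp add: power_form_psym)
qed

section \<open>The Kronecker product\<close>

lemma kronecker_superset:
  assumes "finite A" "{la. psym_coeff f la \<noteq> 0} \<subseteq> A \<or> {la. psym_coeff g la \<noteq> 0} \<subseteq> A"
  shows "kronecker f g = (\<Sum>la\<in>A. (psym_coeff f la * psym_coeff g la * zee la) *\<^sub>Q psym la)"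
  unfolding kronecker_def by (rule Sum_any.expand_superset) (use assms in auto)

lemma kronecker_commute: "kronecker f g = kronecker g f"
  by (simp add: kronecker_def mult.commute)

lemma lin_kronecker: "lin (kronecker f)"
proof -
  let ?A = "{la. psym_coeff f la \<noteq> 0}"
  have "kronecker f g = (\<Sum>la\<in>?A. (psym_coeff f la * psym_coeff g la * zee la) *\<^sub>Q psym la)" for g
    by (rule kronecker_superset) auto
  thus ?thesis
    by (simp add: lin_def psym_coeff_add psym_coeff_scale algebra_simps sum.distrib
        sym.scale_left_distrib sym.scale_sum_right)
qed

lemma lin_kronecker_left: "lin (\<lambda>f. kronecker f g)"
  using lin_kronecker[of g] by (simp add: lin_def kronecker_commute[of _ g])

lemma kronecker_psym: "kronecker f (psym la) = power_form f (psym la) *\<^sub>Q psym la"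
  using kronecker_superset[of "{la}" f "psym la"] by (auto simp: power_form_psym psym_coeff_psym)

text \<open>
  The products of power sums diagonalize every Kronecker multiplication, with eigenvalue the
  inner product.
\<close>

lemma kronecker_p_mon: "0 \<notin># M \<Longrightarrow> kronecker f (p_mon M) = power_form f (p_mon M) *\<^sub>Q p_mon M"
  using ex_part_mset[of M] kronecker_psym[of f] by (metis psym_eq)

section \<open>Derivations and Newton's identity\<close>

text \<open>
  The derivation \<open>n \<partial>/\<partial>p\<^sub>n\<close>.
\<close>

definition p_deriv :: "nat \<Rightarrow> sym \<Rightarrow> sym" where
  "p_deriv n = psym_extend (\<lambda>M. of_nat (n * count M n) *\<^sub>Q p_mon (M - {#n#}))"

lemma lin_p_deriv: "lin (p_deriv n)"
  by (simp add: p_deriv_def lin_psym_extend)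

lemma p_deriv_p_mon: "0 \<notin># M \<Longrightarrow> p_deriv n (p_mon M) = of_nat (n * count M n) *\<^sub>Q p_mon (M - {#n#})"
  by (simp add: p_deriv_def psym_extend_p_mon)

lemma lin_mult_left: "lin T \<Longrightarrow> lin (\<lambda>f. T f * g)"
  and lin_mult_right: "lin T \<Longrightarrow> lin (\<lambda>f. g * T f)"
  and lin_plus: "lin T \<Longrightarrow> lin S \<Longrightarrow> lin (\<lambda>f. T f + S f)"
  by (auto simp: lin_def algebra_simps scale_mult_left scale_mult_right)

lemma lin_comp: "lin T \<Longrightarrow> lin S \<Longrightarrow> lin (\<lambda>f. T (S f))"
  by (simp add: lin_def)

lemma lin_id: "lin (\<lambda>f. f)"
  by (simp add: lin_def)

lemma p_deriv_mult: "p_deriv n (f * g) = p_deriv n f * g + f * p_deriv n g"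
proof -
  have 1: "p_deriv n (p_mon M * p_mon K) = p_deriv n (p_mon M) * p_mon K + p_mon M * p_deriv n (p_mon K)"
    if M: "0 \<notin># M" and K: "0 \<notin># K" for M K
  proof -
    have a: "of_nat (n * count M n) *\<^sub>Q p_mon (M + K - {#n#}) = p_deriv n (p_mon M) * p_mon K"
      using M by (cases "n \<in># M") (auto simp: p_deriv_p_mon scale_mult_left not_in_iff simp flip: p_mon_union)
    have b: "of_nat (n * count K n) *\<^sub>Q p_mon (M + K - {#n#}) = p_mon M * p_deriv n (p_mon K)"
      using K by (cases "n \<in># K") (auto simp: p_deriv_p_mon scale_mult_right not_in_iff simp flip: p_mon_union)
    have "p_deriv n (p_mon M * p_mon K) = of_nat (n * count M n + n * count K n) *\<^sub>Q p_mon (M + K - {#n#})"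
      using p_deriv_p_mon[of "M + K" n] M K by (simp add: p_mon_union algebra_simps)
    thus ?thesis using a b by (simp add: sym.scale_left_distrib)
  qed
  have 2: "p_deriv n (p_mon M * g) = p_deriv n (p_mon M) * g + p_mon M * p_deriv n g" if M: "0 \<notin># M" for M g
    by (rule lin_eqI[where S = "\<lambda>g. p_deriv n (p_mon M * g)"])
       (auto intro!: lin_comp[OF lin_p_deriv] lin_plus lin_mult_right lin_p_deriv lin_id simp: 1 M)
  show ?thesis
    by (rule lin_eqI[where S = "\<lambda>f. p_deriv n (f * g)"])
       (auto intro!: lin_comp[OF lin_p_deriv] lin_plus lin_mult_left lin_p_deriv lin_id simp: 2)
qed

lemma p_deriv_1: "p_deriv n 1 = 0"
  using p_deriv_p_mon[of "{#}" n] by simp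

lemma p_deriv_power_sum: "m > 0 \<Longrightarrow> p_deriv n (power_sum m) = (if m = n then of_nat n *\<^sub>Q 1 else 0)"
  using p_deriv_p_mon[of "{#m#}" n] by auto

text \<open>
  On products of power sums both sides are a multiple of the same Kronecker delta, and the
  factors agree because adding a part \<open>n\<close> to \<open>M\<close> multiplies \<open>z\<^sub>M\<close> by \<open>n (m\<^sub>n(M) + 1)\<close>.
\<close>

lemma p_deriv_adjoint:
  assumes n: "n > 0"
  shows "power_form (power_sum n * f) g = power_form f (p_deriv n g)"
proof -
  have 1: "power_form (power_sum n * p_mon M) (p_mon K) = power_form (p_mon M) (p_deriv n (p_mon K))"
    if M: "0 \<notin># M" and K: "0 \<notin># K" for M K
  proof -
    have M': "0 \<notin># add_mset n M" and K': "0 \<notin># K - {#n#}" using M K n by (auto dest: in_diffD)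
    have lhs: "power_form (power_sum n * p_mon M) (p_mon K) = (if add_mset n M = K then mset_zee K else 0)"
      using power_form_p_mon_p_mon[OF M' K] by simp
    show ?thesis
    proof (cases "n \<in># K")
      case True
      have "add_mset n M = K \<longleftrightarrow> M = K - {#n#}" using True by auto
      thus ?thesis using lhs power_form_p_mon_p_mon[OF M K'] mset_zee_add[OF n, of M] True K
        by (auto simp: p_deriv_p_mon power_form_scale_right algebra_simps)
    next
      case False
      thus ?thesis using lhs K by (auto simp: p_deriv_p_mon power_form_scale_right not_in_iff)
    qed
  qed
  have 2: "power_form (power_sum n * p_mon M) g = power_form (p_mon M) (p_deriv n g)" if "0 \<notin># M" for M g
    by (induction g rule: sym_linear_induct)
       (use 1 that in \<open>auto simp: power_form_add_right power_form_scale_right lin_add[OF lin_p_deriv] lin_scale[OF lin_p_deriv]\<close>)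
  show ?thesis
    by (induction f rule: sym_linear_induct)
       (use 2 in \<open>auto simp: power_form_add_left power_form_scale_left distrib_left scale_mult_right\<close>)
qed

text \<open>
  At a monomial of degree \<open>m\<close> the term \<open>p\<^sub>k h\<^sub>m\<^sub>-\<^sub>k\<close> counts the variables with exponent at least
  \<open>k\<close>; summing over \<open>k\<close> adds up the exponents.
\<close>

lemma newton: "of_nat m *\<^sub>Q hsym (int m) = (\<Sum>k=1..m. power_sum k * hsym (int m - int k))"
proof (rule sym_eqI)
  fix M
  show "coeff_mono (of_nat m *\<^sub>Q hsym (int m)) M
      = coeff_mono (\<Sum>k=1..m. power_sum k * hsym (int m - int k)) M"
  proof (cases "size M = m")
    case False
    have "homog (int m) (of_nat m *\<^sub>Q hsym (int m))" by (intro homog_scale homog_hsym)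
    moreover have "homog (int k + (int m - int k)) (power_sum k * hsym (int m - int k))" for k
      by (intro homog_mult homog_power_sum homog_hsym)
    hence "homog (int m) (\<Sum>k=1..m. power_sum k * hsym (int m - int k))"
      by (intro homog_sum) simp
    ultimately show ?thesis using False unfolding homog_def by (metis of_nat_eq_iff)
  next
    case True
    have *: "coeff_mono (power_sum k * hsym (int m - int k)) M = (\<Sum>i\<in>set_mset M. if k \<le> count M i then 1 else 0)"
      if k: "k \<in> {1..m}" for k
    proof -
      let ?I = "{i \<in> set_mset M. k \<le> count M i}"
      have inj: "inj_on (replicate_mset k) ?I"
        using k by (auto simp: inj_on_def)
           (metis One_nat_def Suc_le_eq in_replicate_mset less_not_refl2 linorder_not_le not_one_le_zero)
      have "coeff_mono (power_sum k * hsym (int m - int k)) M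
          = (\<Sum>a | a \<subseteq># M. coeff_mono (power_sum k) a * coeff_mono (hsym (int m - int k)) (M - a))"
        by (rule coeff_times)
      also have "\<dots> = (\<Sum>a\<in>replicate_mset k ` ?I. 1)"
      proof (rule sum.mono_neutral_cong_right)
        show "replicate_mset k ` ?I \<subseteq> {a. a \<subseteq># M}"
          by (auto simp: count_le_replicate_mset_subset_eq)
        show "\<forall>a\<in>{a. a \<subseteq># M} - replicate_mset k ` ?I.
            coeff_mono (power_sum k) a * coeff_mono (hsym (int m - int k)) (M - a) = 0"
        proof
          fix a assume a: "a \<in> {a. a \<subseteq># M} - replicate_mset k ` ?I"
          have "\<nexists>i. a = replicate_mset k i"
          proof
            assume "\<exists>i. a = replicate_mset k i"
            then obtain i where i: "a = replicate_mset k i" ..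
            hence "k \<le> count M i" using a by (simp add: count_le_replicate_mset_subset_eq)
            moreover from this have "i \<in># M" using k by (metis atLeastAtMost_iff count_inI le_zero_eq not_one_le_zero)
            ultimately show False using a i by auto
          qed
          thus "coeff_mono (power_sum k) a * coeff_mono (hsym (int m - int k)) (M - a) = 0"
            by (simp add: power_sum.rep_eq)
        qed
        fix a assume "a \<in> replicate_mset k ` ?I"
        then obtain i where "a = replicate_mset k i" "k \<le> count M i" by auto
        thus "coeff_mono (power_sum k) a * coeff_mono (hsym (int m - int k)) (M - a) = 1"
          using True k by (auto simp: power_sum.rep_eq hsym.rep_eq size_Diff_submset
              count_le_replicate_mset_subset_eq of_nat_diff)
      qed (simp add: finite_submultisets)
      also have "\<dots> = of_nat (card ?I)" by (simp add: card_image[OF inj])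
      also have "\<dots> = (\<Sum>i\<in>set_mset M. if k \<le> count M i then 1 else 0)"
        by (simp add: sum.If_cases Int_def)
      finally show ?thesis .
    qed
    have "coeff_mono (\<Sum>k=1..m. power_sum k * hsym (int m - int k)) M
        = (\<Sum>k=1..m. \<Sum>i\<in>set_mset M. if k \<le> count M i then 1 else 0)"
      unfolding coeff_sum by (rule sum.cong) (use * in auto)
    also have "\<dots> = (\<Sum>i\<in>set_mset M. \<Sum>k=1..m. if k \<le> count M i then 1 else 0)"
      by (rule sum.swap)
    also have "\<dots> = (\<Sum>i\<in>set_mset M. of_nat (count M i))"
    proof (rule sum.cong)
      fix i
      have "count M i \<le> m" using True count_le_size by metis
      hence "{1..m} \<inter> {k. k \<le> count M i} = {1..count M i}" by auto
      thus "(\<Sum>k=1..m. if k \<le> count M i then 1 else 0) = (of_nat (count M i) :: rat)"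
        by (simp add: sum.If_cases)
    qed simp
    also have "\<dots> = of_nat m" using True by (simp add: size_multiset_overloaded_eq flip: of_nat_sum)
    finally show ?thesis using True by (simp add: coeff_simps)
  qed
qed

lemma scale_cancel: "c \<noteq> 0 \<Longrightarrow> c *\<^sub>Q f = c *\<^sub>Q g \<Longrightarrow> f = g"
  by (simp add: sym.scale_left_imp_eq)

text \<open>
  Newton's identity determines the \<open>h\<^sub>m\<close> recursively from the power sums. Applying the derivation to
  it gives \<open>m D(h\<^sub>m) = n h\<^sub>m\<^sub>-\<^sub>n + (m - n) h\<^sub>m\<^sub>-\<^sub>n\<close> by induction.
\<close>

lemma p_deriv_hsym:
  assumes n: "n > 0"
  shows "p_deriv n (hsym z) = hsym (z - int n)"
proof -
  have "p_deriv n (hsym (int m)) = hsym (int m - int n)" for m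
  proof (induction m rule: less_induct)
    case (less m)
    show ?case
    proof (cases "m = 0")
      case True
      thus ?thesis using n by (simp add: hsym_0 p_deriv_1 hsym_neg)
    next
      case False
      have "of_nat m *\<^sub>Q p_deriv n (hsym (int m)) = (\<Sum>k=1..m. p_deriv n (power_sum k * hsym (int m - int k)))"
        unfolding lin_sum[OF lin_p_deriv, symmetric] newton[symmetric] by (rule lin_scale[OF lin_p_deriv, symmetric])
      also have "\<dots> = (\<Sum>k=1..m. (if k = n then of_nat n *\<^sub>Q hsym (int m - int k) else 0)
          + power_sum k * hsym (int m - int n - int k))"
      proof (rule sum.cong)
        fix k assume k: "k \<in> {1..m}"
        have e: "int m - int k = int (m - k)" using k by simp
        have "p_deriv n (hsym (int m - int k)) = hsym (int m - int k - int n)"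
          unfolding e by (rule less) (use k in auto)
        thus "p_deriv n (power_sum k * hsym (int m - int k)) = (if k = n then of_nat n *\<^sub>Q hsym (int m - int k) else 0)
          + power_sum k * hsym (int m - int n - int k)"
          using k by (simp add: p_deriv_mult p_deriv_power_sum scale_mult_left algebra_simps)
      qed simp
      also have "\<dots> = (if n \<le> m then of_nat n *\<^sub>Q hsym (int m - int n) else 0)
          + (\<Sum>k=1..m. power_sum k * hsym (int m - int n - int k))"
        using n by (auto simp: sum.distrib sum.delta)
      also have "\<dots> = of_nat m *\<^sub>Q hsym (int m - int n)"
      proof (cases "n \<le> m")
        case True
        have "(\<Sum>k=1..m. power_sum k * hsym (int m - int n - int k))
            = (\<Sum>k=1..m-n. power_sum k * hsym (int (m - n) - int k))"
          by (rule sum.mono_neutral_cong_right) (use True in \<open>auto simp: hsym_neg of_nat_diff\<close>)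
        also have "\<dots> = of_nat (m - n) *\<^sub>Q hsym (int m - int n)"
          using newton[of "m - n"] True by (simp add: of_nat_diff)
        finally have "?thesis \<longleftrightarrow> of_nat n *\<^sub>Q hsym (int m - int n) + of_nat (m - n) *\<^sub>Q hsym (int m - int n)
            = of_nat m *\<^sub>Q hsym (int m - int n)" using True by simp
        moreover have "of_nat n + of_nat (m - n) = (of_nat m :: rat)"
          using True by (simp flip: of_nat_add)
        ultimately show ?thesis using sym.scale_left_distrib by metis
      next
        case False
        thus ?thesis by (auto simp: hsym_neg intro!: sum.neutral)
      qed
      finally show ?thesis by (rule scale_cancel[rotated]) (use False in simp)
    qed
  qed
  from this[of "nat z"] show ?thesis
    using n by (cases "z \<ge> 0") (auto simp: hsym_neg lin_0[OF lin_p_deriv])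
qed

section \<open>Algebra endomorphisms given on power sums\<close>

definition alg_hom :: "(sym \<Rightarrow> sym) \<Rightarrow> bool" where
  "alg_hom T \<longleftrightarrow> lin T \<and> T 1 = 1 \<and> (\<forall>f g. T (f * g) = T f * T g)"

definition p_hom :: "(nat \<Rightarrow> sym) \<Rightarrow> sym \<Rightarrow> sym" where
  "p_hom c = psym_extend (\<lambda>M. prod_mset (image_mset c M))"

lemma p_hom_p_mon: "0 \<notin># M \<Longrightarrow> p_hom c (p_mon M) = prod_mset (image_mset c M)"
  by (simp add: p_hom_def psym_extend_p_mon)

lemma p_hom_power_sum: "n > 0 \<Longrightarrow> p_hom c (power_sum n) = c n"
  using p_hom_p_mon[of "{#n#}" c] by simp

lemma alg_hom_p_hom: "alg_hom (p_hom c)"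
proof -
  have l: "lin (p_hom c)" by (simp add: p_hom_def lin_psym_extend)
  have 2: "p_hom c (p_mon M * g) = p_hom c (p_mon M) * p_hom c g" if M: "0 \<notin># M" for M g
    by (rule lin_eqI[where S = "\<lambda>g. p_hom c (p_mon M * g)"])
       (use M in \<open>auto intro!: lin_comp[OF l] lin_mult_right l lin_id
         simp: p_hom_p_mon simp flip: p_mon_union\<close>)
  have "p_hom c (f * g) = p_hom c f * p_hom c g" for f g
    by (rule lin_eqI[where S = "\<lambda>f. p_hom c (f * g)"])
       (auto intro!: lin_comp[OF l] lin_mult_left l lin_id simp: 2)
  moreover have "p_hom c 1 = 1" using p_hom_p_mon[of "{#}" c] by simp
  ultimately show ?thesis using l by (simp add: alg_hom_def)
qed

lemma alg_hom_lin: "alg_hom T \<Longrightarrow> lin T"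
  and alg_hom_1: "alg_hom T \<Longrightarrow> T 1 = 1"
  and alg_hom_mult: "alg_hom T \<Longrightarrow> T (f * g) = T f * T g"
  by (auto simp: alg_hom_def)

lemma alg_hom_eqI:
  assumes S: "alg_hom S" and T: "alg_hom T" and eq: "\<And>n. n > 0 \<Longrightarrow> S (power_sum n) = T (power_sum n)"
  shows "S f = T f"
  by (induction f rule: sym_mult_induct)
     (simp_all add: alg_hom_1[OF S] alg_hom_1[OF T] alg_hom_mult[OF S] alg_hom_mult[OF T] eq
      lin_add[OF alg_hom_lin[OF S]] lin_add[OF alg_hom_lin[OF T]]
      lin_scale[OF alg_hom_lin[OF S]] lin_scale[OF alg_hom_lin[OF T]])

lemma alg_hom_comp: "alg_hom S \<Longrightarrow> alg_hom T \<Longrightarrow> alg_hom (\<lambda>f. S (T f))"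
  by (simp add: alg_hom_def lin_comp)

lemma alg_hom_id: "alg_hom (\<lambda>f. f)"
  by (simp add: alg_hom_def lin_id)

text \<open>
  The substitution that adjoins one further variable with value \<open>1\<close> (on power sums,
  \<open>p\<^sub>n\<close> acquires the summand \<open>1\<^sup>n\<close>).
\<close>

definition adjoin_one :: "sym \<Rightarrow> sym" where
  "adjoin_one = p_hom (\<lambda>n. power_sum n + 1)"

text \<open>
  The inverse substitution. It equals \<open>\<Sum>\<^sub>j (-1)\<^sup>j D(e\<^sub>j)\<close> for the elementary functions \<open>e\<^sub>j\<close>, a fact that
  appears here in the form of \<open>remove_one_schur_seq\<close>.
\<close>

definition remove_one :: "sym \<Rightarrow> sym" where
  "remove_one = p_hom (\<lambda>n. power_sum n - 1)"

text \<open>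
  The antipode of the Hopf algebra \<open>Sym\<close>, which is the involution \<open>\<omega>\<close> up to the sign
  \<open>(-1)\<^sup>n\<close> in degree \<open>n\<close>.
\<close>

definition antipode :: "sym \<Rightarrow> sym" where
  "antipode = p_hom (\<lambda>n. - power_sum n)"

lemma alg_hom_adjoin_one: "alg_hom adjoin_one" and alg_hom_remove_one: "alg_hom remove_one" and alg_hom_antipode: "alg_hom antipode"
  by (simp_all add: adjoin_one_def remove_one_def antipode_def alg_hom_p_hom)

lemma adjoin_one_power_sum: "n > 0 \<Longrightarrow> adjoin_one (power_sum n) = power_sum n + 1"
  and remove_one_power_sum: "n > 0 \<Longrightarrow> remove_one (power_sum n) = power_sum n - 1"
  and antipode_power_sum: "n > 0 \<Longrightarrow> antipode (power_sum n) = - power_sum n"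
  by (simp_all add: adjoin_one_def remove_one_def antipode_def p_hom_power_sum)

lemmas alg_hom_simps = lin_add[OF alg_hom_lin] lin_scale[OF alg_hom_lin] lin_0[OF alg_hom_lin]
  lin_uminus[OF alg_hom_lin] lin_minus[OF alg_hom_lin] alg_hom_1 alg_hom_mult

lemmas hom_simps = alg_hom_simps[OF alg_hom_adjoin_one] alg_hom_simps[OF alg_hom_remove_one]
  alg_hom_simps[OF alg_hom_antipode] adjoin_one_power_sum remove_one_power_sum antipode_power_sum

lemma remove_one_adjoin_one: "remove_one (adjoin_one f) = f"
  by (rule alg_hom_eqI[OF alg_hom_comp[OF alg_hom_remove_one alg_hom_adjoin_one] alg_hom_id]) (simp add: hom_simps)

text \<open>
  Both composites send \<open>p\<^sub>n\<close> to \<open>- p\<^sub>n - 1\<close>. Through this relation the row expansion of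
  Schur functions yields information on columns.
\<close>

lemma adjoin_one_antipode: "adjoin_one (antipode f) = antipode (remove_one f)"
  by (rule alg_hom_eqI[OF alg_hom_comp[OF alg_hom_adjoin_one alg_hom_antipode] alg_hom_comp[OF alg_hom_antipode alg_hom_remove_one]])
     (simp add: hom_simps)

lemma antipode_antipode: "antipode (antipode f) = f"
  by (rule alg_hom_eqI[OF alg_hom_comp[OF alg_hom_antipode alg_hom_antipode] alg_hom_id]) (simp add: hom_simps)

lemma antipode_p_mon: "0 \<notin># M \<Longrightarrow> antipode (p_mon M) = (-1) ^ size M *\<^sub>Q p_mon M"
proof -
  assume "0 \<notin># M"
  hence "antipode (p_mon M) = (\<Prod>n\<in>#M. - power_sum n)" by (simp add: antipode_def p_hom_p_mon)
  also have "\<dots> = (-1) ^ size M *\<^sub>Q p_mon M"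
    by (induction M) (simp_all add: scale_mult_right)
  finally show ?thesis .
qed

lemma power_form_antipode: "power_form (antipode f) (antipode g) = power_form f g"
proof -
  note l = alg_hom_simps[OF alg_hom_antipode]
  have 1: "power_form (antipode (p_mon M)) (antipode (p_mon K)) = power_form (p_mon M) (p_mon K)" if "0 \<notin># M" "0 \<notin># K" for M K
    using that by (auto simp: antipode_p_mon power_form_scale_left power_form_scale_right power_form_p_mon_p_mon simp flip: power_mult_distrib)
  have 2: "power_form (antipode (p_mon M)) (antipode g) = power_form (p_mon M) g" if "0 \<notin># M" for M
    by (induction g rule: sym_linear_induct) (use 1 that in \<open>auto simp: l power_form_add_right power_form_scale_right\<close>)
  show ?thesis
    by (induction f rule: sym_linear_induct) (use 2 in \<open>auto simp: l power_form_add_left power_form_scale_left\<close>)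
qed

lemma homog_psym_extend:
  assumes "homog d f" "\<And>M. homog (int (sum_mset M)) (F M)"
  shows "homog d (psym_extend F f)"
  unfolding psym_extend_def
proof (intro homog_sum homog_scale)
  fix la assume "la \<in> {la. psym_coeff f la \<noteq> 0}"
  hence "int (psize la) = d" using psym_coeff_homog[OF assms(1)] by blast
  thus "homog d (F (part_mset la))" using assms(2)[of "part_mset la"] by (simp add: psize_eq)
qed

lemma homog_antipode: "homog d f \<Longrightarrow> homog d (antipode f)"
  unfolding antipode_def p_hom_def
proof (erule homog_psym_extend)
  fix M :: "nat multiset"
  show "homog (int (sum_mset M)) (\<Prod>n\<in>#M. - power_sum n)"
    using homog_mult[OF homog_uminus[OF homog_power_sum]] by (induction M) auto
qed

text \<open>
  The partial sums \<open>A\<^sub>m = h\<^sub>0 + \<dots> + h\<^sub>m\<close> satisfy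
  \<open>m A\<^sub>m = \<Sum>\<^sub>k (p\<^sub>k + 1) A\<^sub>m\<^sub>-\<^sub>k\<close>, which is the image of Newton's identity under the substitution.
\<close>

lemma adjoin_one_hsym: "adjoin_one (hsym z) = sum hsym {0..z}"
proof -
  define A where "A z = sum hsym {0..z}" for z
  have A_step: "A (z + 1) = A z + hsym (z + 1)" for z
  proof (cases "z + 1 \<ge> 0")
    case True
    hence "{0..z+1} = insert (z+1) {0..z}" by auto
    thus ?thesis by (simp add: A_def)
  next
    case False
    thus ?thesis by (simp add: A_def hsym_neg)
  qed
  have A_neg: "A z = 0" if "z < 0" for z using that by (simp add: A_def)
  have A0: "(\<Sum>k=1..m+1. hsym (int m + 1 - int k)) = A (int m)" for m
    unfolding A_def
    by (rule sum.reindex_bij_witness[of _ "\<lambda>z. nat (int m + 1 - z)" "\<lambda>k. int m + 1 - int k"]) auto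
  (* Passing from m to m + 1 adds Newton's identity for h_(m+1) and the sum of all h_l with l at most m. *)
  have R: "(\<Sum>k=1..m. (power_sum k + 1) * A (int m - int k)) = of_nat m *\<^sub>Q A (int m)" for m
  proof (induction m)
    case (Suc m)
    have "(\<Sum>k=1..Suc m. (power_sum k + 1) * A (int (Suc m) - int k))
       = (\<Sum>k=1..Suc m. (power_sum k + 1) * A (int m - int k) + power_sum k * hsym (int m + 1 - int k)
            + hsym (int m + 1 - int k))"
      using A_step[of "int m - int k" for k] by (intro sum.cong) (auto simp: algebra_simps)
    also have "\<dots> = (\<Sum>k=1..Suc m. (power_sum k + 1) * A (int m - int k))
        + (\<Sum>k=1..Suc m. power_sum k * hsym (int (Suc m) - int k)) + A (int m)"
      using A0[of m] by (simp add: sum.distrib algebra_simps)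
    also have "(\<Sum>k=1..Suc m. (power_sum k + 1) * A (int m - int k)) = of_nat m *\<^sub>Q A (int m)"
      using Suc by (simp add: A_neg)
    also have "(\<Sum>k=1..Suc m. power_sum k * hsym (int (Suc m) - int k)) = of_nat (Suc m) *\<^sub>Q hsym (int (Suc m))"
      by (rule newton[symmetric])
    finally show ?case using A_step[of "int m"]
      by (simp add: sym.scale_left_distrib sym.scale_right_distrib algebra_simps)
  qed simp
  have "adjoin_one (hsym (int m)) = A (int m)" for m
  proof (induction m rule: less_induct)
    case (less m)
    show ?case
    proof (cases "m = 0")
      case True
      thus ?thesis using alg_hom_1[OF alg_hom_adjoin_one] by (simp add: A_def hsym_0)
    next
      case False
      note l = alg_hom_lin[OF alg_hom_adjoin_one]
      have "of_nat m *\<^sub>Q adjoin_one (hsym (int m)) = (\<Sum>k=1..m. adjoin_one (power_sum k * hsym (int m - int k)))"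
        unfolding lin_sum[OF l, symmetric] newton[symmetric] by (rule lin_scale[OF l, symmetric])
      also have "\<dots> = (\<Sum>k=1..m. (power_sum k + 1) * A (int m - int k))"
      proof (rule sum.cong)
        fix k assume k: "k \<in> {1..m}"
        have e: "int m - int k = int (m - k)" using k by simp
        have "adjoin_one (hsym (int m - int k)) = A (int m - int k)"
          unfolding e by (rule less) (use k in auto)
        moreover have "adjoin_one (power_sum k) = power_sum k + 1" using k by (simp add: adjoin_one_def p_hom_power_sum)
        ultimately show "adjoin_one (power_sum k * hsym (int m - int k)) = (power_sum k + 1) * A (int m - int k)"
          by (simp add: alg_hom_mult[OF alg_hom_adjoin_one])
      qed simp
      also have "\<dots> = of_nat m *\<^sub>Q A (int m)" by (rule R)
      finally show ?thesis by (rule scale_cancel[rotated]) (use False in simp)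
    qed
  qed
  from this[of "nat z"] show ?thesis
    by (cases "z \<ge> 0") (auto simp: hsym_neg lin_0[OF alg_hom_lin[OF alg_hom_adjoin_one]] A_def)
qed

lemma adjoin_one_hsym_diff: "adjoin_one (hsym z) - adjoin_one (hsym (z - 1)) = hsym z"
proof (cases "z \<ge> 0")
  case True
  hence "{0..z} = insert z {0..z-1}" by auto
  thus ?thesis by (simp add: adjoin_one_hsym)
qed (simp add: adjoin_one_hsym hsym_neg)

lemma remove_one_hsym: "remove_one (hsym z) = hsym z - hsym (z - 1)"
  using arg_cong[OF adjoin_one_hsym_diff[of z], of remove_one] remove_one_adjoin_one lin_minus[OF alg_hom_lin[OF alg_hom_remove_one]] by metis

lemma p_deriv_remove_one: "n > 0 \<Longrightarrow> p_deriv n (remove_one f) = remove_one (p_deriv n f)"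
proof (induction f rule: sym_mult_induct)
  case (power_sum k f)
  have "p_deriv n (remove_one (power_sum k)) = remove_one (p_deriv n (power_sum k))"
    using power_sum by (simp add: hom_simps lin_minus[OF lin_p_deriv] p_deriv_1 p_deriv_power_sum)
  thus ?case using power_sum by (simp add: alg_hom_simps[OF alg_hom_remove_one] p_deriv_mult)
qed (simp_all add: lin_add[OF lin_p_deriv] lin_scale[OF lin_p_deriv] hom_simps p_deriv_1)

text \<open>
  The counit: pairing with \<open>1\<close> extracts the constant term.
\<close>

lemma power_form_1: "power_form f 1 = coeff_mono f {#}"
proof (induction f rule: sym_linear_induct)
  case (p_mon M)
  have "coeff_mono (p_mon M) {#} = (if M = {#} then 1 else 0)"
  proof (cases "M = {#}")
    case False
    then obtain n where "n \<in># M" by blast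
    hence "int (sum_mset M) \<noteq> 0" using p_mon by (metis of_nat_eq_0_iff sum_mset_0_iff)
    thus ?thesis using homog_p_mon[of M] False unfolding homog_def by fastforce
  qed (simp add: one_sym.rep_eq)
  thus ?case using power_form_p_mon_p_mon[OF p_mon, of "{#}"] by (auto simp: mset_zee_def)
qed (simp_all add: power_form_add_left power_form_scale_left coeff_simps)

text \<open>
  A truncation of the formal series \<open>h\<^sub>0 + h\<^sub>1 + h\<^sub>2 + \<dots>\<close>, which itself has unbounded degree.
  Against functions of degree at most \<open>N\<close> the truncation at \<open>N\<close> acts like the series.
\<close>

definition h_sum :: "nat \<Rightarrow> sym" where
  "h_sum N = (\<Sum>m\<le>N. hsym (int m))"

lemma p_deriv_h_sum: "n > 0 \<Longrightarrow> n \<le> N \<Longrightarrow> p_deriv n (h_sum N) = h_sum (N - n)"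
proof -
  assume n: "n > 0" "n \<le> N"
  have "p_deriv n (h_sum N) = (\<Sum>m\<in>{n..N}. hsym (int m - int n))"
    unfolding h_sum_def lin_sum[OF lin_p_deriv]
    by (rule sum.mono_neutral_cong_right) (use n in \<open>auto simp: p_deriv_hsym hsym_neg\<close>)
  also have "\<dots> = h_sum (N - n)"
    unfolding h_sum_def
    by (rule sum.reindex_bij_witness[of _ "\<lambda>m. m + n" "\<lambda>m. m - n"]) (use n in \<open>auto simp: of_nat_diff\<close>)
  finally show ?thesis .
qed

lemma degree_le_expansion:
  assumes "degree_le N f"
  shows "f = (\<Sum>la\<in>Par N. psym_coeff f la *\<^sub>Q psym la)"
proof -
  have "{la. psym_coeff f la \<noteq> 0} \<subseteq> Par N"
    unfolding Par_def using psym_coeff_degree_le[OF assms] not_le by blast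
  thus ?thesis
    by (subst psym_expansion[of f]) (auto intro!: sum.mono_neutral_left)
qed

text \<open>
  Let \<open>H\<close> be the series. It is group-like, in the sense that \<open>D(p\<^sub>n) H = H\<close>; hence
  \<open>\<langle>H f, p\<^sub>n g\<rangle> = \<langle>H f, g\<rangle> + \<langle>H D(p\<^sub>n) f, g\<rangle>\<close>, and induction over the factors of \<open>g\<close>
  replaces each \<open>p\<^sub>n\<close> by \<open>p\<^sub>n + 1\<close>.
\<close>

lemma adjoin_one_adjoint:
  assumes "degree_le N g"
  shows "power_form (h_sum N * f) g = power_form f (adjoin_one g)"
proof -
  note l = alg_hom_lin[OF alg_hom_adjoin_one]
  have 1: "power_form (h_sum N * f) (p_mon M) = power_form f (adjoin_one (p_mon M))" if "0 \<notin># M" "sum_mset M \<le> N" for M N f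
    using that
  proof (induction M arbitrary: N f)
    case empty
    have "coeff_mono (h_sum N) {#} = 1" by (simp add: h_sum_def coeff_sum hsym.rep_eq)
    moreover have "{a. a = ({#} :: nat multiset)} = {{#}}" by auto
    ultimately have "coeff_mono (h_sum N * f) {#} = coeff_mono f {#}"
      by (simp add: coeff_times)
    thus ?case by (simp add: alg_hom_1[OF alg_hom_adjoin_one] power_form_1)
  next
    case (add n M)
    hence n: "n > 0" "n \<le> N" by auto
    have "power_form (h_sum N * f) (p_mon (add_mset n M)) = power_form (p_deriv n (h_sum N * f)) (p_mon M)"
      using p_deriv_adjoint[OF n(1), of "p_mon M" "h_sum N * f"] by (simp add: power_form_commute)
    also have "\<dots> = power_form (h_sum (N - n) * f) (p_mon M) + power_form (h_sum N * p_deriv n f) (p_mon M)"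
      by (simp add: p_deriv_mult p_deriv_h_sum n power_form_add_left)
    also have "\<dots> = power_form f (adjoin_one (p_mon M)) + power_form (p_deriv n f) (adjoin_one (p_mon M))"
      using add.prems add.IH[of "N - n" f] add.IH[of N "p_deriv n f"] by simp
    also have "power_form (p_deriv n f) (adjoin_one (p_mon M)) = power_form f (power_sum n * adjoin_one (p_mon M))"
      using p_deriv_adjoint[OF n(1), of "adjoin_one (p_mon M)" f] by (simp add: power_form_commute)
    also have "power_form f (adjoin_one (p_mon M)) + \<dots> = power_form f (adjoin_one (power_sum n) * adjoin_one (p_mon M))"
      using n by (simp add: adjoin_one_def p_hom_power_sum distrib_right power_form_add_right)
    finally show ?case by (simp add: alg_hom_mult[OF alg_hom_adjoin_one])
  qed
  have "power_form (h_sum N * f) g = (\<Sum>la\<in>Par N. psym_coeff g la * power_form (h_sum N * f) (psym la))"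
    by (subst degree_le_expansion[OF assms]) (simp add: power_form_sum_right power_form_scale_right)
  also have "\<dots> = (\<Sum>la\<in>Par N. psym_coeff g la * power_form f (adjoin_one (psym la)))"
    using 1[OF part_mset_pos] by (intro sum.cong) (auto simp: Par_def psym_eq psize_eq)
  also have "\<dots> = power_form f (adjoin_one g)"
    by (subst (2) degree_le_expansion[OF assms]) (simp add: lin_sum[OF l] lin_scale[OF l] power_form_sum_right power_form_scale_right)
  finally show ?thesis .
qed

lemma degree_le_p_mon: "degree_le (sum_mset M) (p_mon M)"
  using degree_le_homog[OF homog_p_mon] by blast

lemma degree_le_power_form:
  assumes "degree_le N f" "homog d g" "d > int N"
  shows "power_form f g = 0"
proof -
  have "power_form f g = (\<Sum>n\<le>N. power_form (hom_component n f) g)"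
    by (subst hom_component_sum[OF assms(1)]) (rule power_form_sum_left)
  thus ?thesis using assms(3) power_form_homog[OF homog_hom_component assms(2)] by (auto intro!: sum.neutral)
qed

text \<open>
  For homogeneous arguments only one term of the series has the right degree. The integer index
  covers the case in which the degree of \<open>f\<close> exceeds that of \<open>g\<close>: then both sides vanish.
\<close>

lemma power_form_hsym_mult:
  assumes f: "homog d f" and g: "homog (int n) g"
  shows "power_form (hsym (int n - d) * f) g = power_form f (adjoin_one g)"
proof -
  have g': "degree_le n g" using degree_le_homog[OF g] by simp
  have "power_form f (adjoin_one g) = (\<Sum>m\<le>n. power_form (hsym (int m) * f) g)"
    by (simp add: adjoin_one_adjoint[OF g', symmetric] h_sum_def sum_distrib_right power_form_sum_left)
  also have "\<dots> = power_form (hsym (int n - d) * f) g"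
  proof (cases "d < 0")
    case True
    hence "f = 0" using homog_neg f by blast
    thus ?thesis by simp
  next
    case d: False
    have z: "power_form (hsym (int m) * f) g = 0" if "int m \<noteq> int n - d" for m
      using power_form_homog[OF homog_mult[OF homog_hsym f] g] that by auto
    show ?thesis
    proof (cases "d \<le> int n")
      case True
      hence m: "int (nat (int n - d)) = int n - d" "nat (int n - d) \<in> {..n}" using d by auto
      have "power_form (hsym (int k) * f) g = 0" if "k \<noteq> nat (int n - d)" for k
        using that z[of k] m(1) by (metis of_nat_eq_iff)
      thus ?thesis using m(1)
        by (subst sum.remove[OF _ m(2)]) (auto intro!: sum.neutral)
    qed (use z in \<open>auto simp: hsym_neg intro!: sum.neutral\<close>)
  qed
  finally show ?thesis by simp
qed

section \<open>Jacobi--Trudi determinants\<close>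

text \<open>
  Every term of the Leibniz formula uses each row and each column once.
\<close>

lemma homog_det:
  assumes A: "A \<in> carrier_mat n n"
    and h: "\<And>i j. i < n \<Longrightarrow> j < n \<Longrightarrow> homog (r i + s j) (A $$ (i, j))"
  shows "homog ((\<Sum>i<n. r i) + (\<Sum>j<n. s j)) (det A)"
  unfolding det_def'[OF A]
proof (rule homog_sum)
  fix p assume "p \<in> {p. p permutes {0..<n}}"
  hence p: "p permutes {0..<n}" by simp
  have "homog (\<Sum>i = 0..<n. r i + s (p i)) (\<Prod>i = 0..<n. A $$ (i, p i))"
    using permutes_in_image[OF p] by (intro homog_prod h) auto
  moreover have "(\<Sum>i = 0..<n. r i + s (p i)) = (\<Sum>i<n. r i) + (\<Sum>j<n. s j)"
    using sum.permute[OF p, of s] by (simp add: sum.distrib o_def atLeast0LessThan)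
  ultimately have "homog ((\<Sum>i<n. r i) + (\<Sum>j<n. s j)) (\<Prod>i = 0..<n. A $$ (i, p i))" by simp
  thus "homog ((\<Sum>i<n. r i) + (\<Sum>j<n. s j)) (signof p * (\<Prod>i = 0..<n. A $$ (i, p i)))"
    by (auto simp: sign_def intro: homog_uminus)
qed

lemma det_first_row:
  fixes A :: "'a :: comm_ring_1 mat"
  assumes A: "A \<in> carrier_mat (Suc n) (Suc n)"
  shows "det A = (\<Sum>j\<le>n. A $$ (0, j) * ((-1) ^ j * det (mat n n (\<lambda>(i, c). A $$ (Suc i, insert_index j c)))))"
proof -
  have "mat_delete A 0 j = mat n n (\<lambda>(i, c). A $$ (Suc i, insert_index j c))" if "j \<le> n" for j
    by (rule eq_matI) (use A that mat_delete_index[OF A, of 0 j] mat_delete_carrier[OF A, of 0 j] in auto)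
  thus ?thesis
    by (subst laplace_expansion_row[OF A, of 0]) (auto simp: cofactor_def lessThan_Suc_atMost)
qed

lemma det_first_column:
  fixes A :: "'a :: comm_ring_1 mat"
  assumes A: "A \<in> carrier_mat (Suc n) (Suc n)"
  shows "det A = (\<Sum>i\<le>n. A $$ (i, 0) * ((-1) ^ i * det (mat n n (\<lambda>(r, c). A $$ (insert_index i r, Suc c)))))"
proof -
  have "mat_delete A i 0 = mat n n (\<lambda>(r, c). A $$ (insert_index i r, Suc c))" if "i \<le> n" for i
    by (rule eq_matI) (use A that mat_delete_index[OF A, of i 0] mat_delete_carrier[OF A, of i 0] in auto)
  thus ?thesis
    by (subst laplace_expansion_column[OF A, of 0]) (auto simp: cofactor_def lessThan_Suc_atMost)
qed

text \<open>
  Multiplication on the right by the unitriangular matrix with \<open>-1\<close> above the diagonal.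
\<close>

lemma det_column_differences:
  fixes A :: "'a :: comm_ring_1 mat"
  assumes A: "A \<in> carrier_mat n n"
  shows "det (mat n n (\<lambda>(i, j). if j = 0 then A $$ (i, j) else A $$ (i, j) - A $$ (i, j - 1))) = det A"
proof -
  let ?B = "mat n n (\<lambda>(i, j). if j = 0 then A $$ (i, j) else A $$ (i, j) - A $$ (i, j - 1))"
  define T :: "'a mat" where "T = mat n n (\<lambda>(i, j). if i = j then 1 else if Suc i = j then - 1 else 0)"
  have T: "T \<in> carrier_mat n n" by (simp add: T_def)
  have "A * T = ?B"
  proof (rule eq_matI)
    fix i j assume "i < dim_row ?B" "j < dim_col ?B"
    hence ij: "i < n" "j < n" by auto
    have "(A * T) $$ (i, j) = (\<Sum>k = 0..<n. A $$ (i, k) * T $$ (k, j))"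
      using ij A T by (simp add: scalar_prod_def)
    also have "\<dots> = (\<Sum>k\<in>{k. k < n \<and> (k = j \<or> Suc k = j)}. A $$ (i, k) * T $$ (k, j))"
      by (rule sum.mono_neutral_right) (use ij in \<open>auto simp: T_def\<close>)
    also have "\<dots> = ?B $$ (i, j)"
    proof (cases j)
      case 0
      hence "{k. k < n \<and> (k = j \<or> Suc k = j)} = {j}" using ij by auto
      thus ?thesis using 0 ij by (simp add: T_def)
    next
      case (Suc j')
      hence "{k. k < n \<and> (k = j \<or> Suc k = j)} = {j, j'}" using ij by auto
      thus ?thesis using Suc ij by (simp add: T_def)
    qed
    finally show "(A * T) $$ (i, j) = ?B $$ (i, j)" .
  qed (use A T in auto)
  moreover have "det T = 1"
  proof -
    have "det T = prod_list (diag_mat T)"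
      by (rule det_upper_triangular[OF _ T]) (auto simp: T_def)
    also have "diag_mat T = replicate n 1"
      by (rule nth_equalityI) (auto simp: diag_mat_def T_def)
    finally show ?thesis by simp
  qed
  ultimately show ?thesis using det_mult[OF A T] by simp
qed

lemma alg_hom_det:
  assumes T: "alg_hom T"
  shows "T (det A) = det (map_mat T A)"
proof -
  interpret comm_ring_hom T
    by unfold_locales (auto simp: alg_hom_mult[OF T] alg_hom_1[OF T] lin_add[OF alg_hom_lin[OF T]] lin_0[OF alg_hom_lin[OF T]])
  show ?thesis by (rule hom_det[symmetric])
qed

definition jt_mat :: "int list \<Rightarrow> sym mat" where
  "jt_mat xs = mat (length xs) (length xs) (\<lambda>(i, j). hsym (xs ! i + int j - int i))"

lemma jt_mat_carrier [simp]: "jt_mat xs \<in> carrier_mat (length xs) (length xs)"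
  by (simp add: jt_mat_def)

lemma schur_seq_jt_mat: "schur_seq xs = det (jt_mat xs)"
  by (simp add: schur_seq_def jt_mat_def)

lemma schur_seq_Nil [simp]: "schur_seq [] = 1"
  by (simp add: schur_seq_def)

lemma sum_insert_index: "j \<le> n \<Longrightarrow> (\<Sum>c<n. int (insert_index j c)) = (\<Sum>c\<le>n. int c) - int j"
proof -
  assume j: "j \<le> n"
  have "(\<Sum>c<n. int (insert_index j c)) = (\<Sum>c\<in>insert_index j ` {0..<n}. int c)"
    by (simp add: sum.reindex insert_index_inj_on atLeast0LessThan)
  also have "insert_index j ` {0..<n} = {..n} - {j}"
    using insert_index_image[of j n] j by auto
  also have "(\<Sum>c\<in>{..n} - {j}. int c) = (\<Sum>c\<le>n. int c) - int j"
    using j by (simp add: sum_diff1)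
  finally show ?thesis .
qed

lemma homog_schur_seq: "homog (sum_list xs) (schur_seq xs)"
proof -
  have "homog ((\<Sum>i<length xs. xs ! i - int i) + (\<Sum>j<length xs. int j)) (det (jt_mat xs))"
    by (rule homog_det) (auto simp: jt_mat_def intro: homog_hsym[THEN back_subst[of "\<lambda>d. homog d _"]])
  thus ?thesis by (simp add: schur_seq_jt_mat sum_subtractf sum_list_sum_nth atLeast0LessThan)
qed

text \<open>
  The cofactors for the first row of a Jacobi--Trudi matrix whose remaining rows belong to \<open>xs\<close>.
  They do not depend on the first row, so the same cofactors serve for every first part. The
  insertion \<open>insert_index j\<close> skips column \<open>j\<close>.
\<close>

definition row_cofactor :: "int list \<Rightarrow> nat \<Rightarrow> sym" where
  "row_cofactor xs j = (-1) ^ j *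
     det (mat (length xs) (length xs) (\<lambda>(i, c). hsym (xs ! i + int (insert_index j c) - int (Suc i))))"

lemma homog_sign: "homog d f \<Longrightarrow> homog d ((-1) ^ (j :: nat) * f)"
  using homog_uminus by (cases "even j") auto

lemma homog_row_cofactor: "j \<le> length xs \<Longrightarrow> homog (sum_list xs - int j) (row_cofactor xs j)"
proof -
  assume j: "j \<le> length xs"
  let ?n = "length xs"
  have "homog ((\<Sum>i<?n. xs ! i - int (Suc i)) + (\<Sum>c<?n. int (insert_index j c)))
    (det (mat ?n ?n (\<lambda>(i, c). hsym (xs ! i + int (insert_index j c) - int (Suc i)))))"
    by (rule homog_det) (auto intro: homog_hsym[THEN back_subst[of "\<lambda>d. homog d _"]])
  moreover have "(\<Sum>i<?n. xs ! i - int (Suc i)) + (\<Sum>c<?n. int (insert_index j c)) = sum_list xs - int j"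
    unfolding sum_insert_index[OF j]
    by (simp only: sum_subtractf lessThan_Suc_atMost[symmetric] sum.lessThan_Suc_shift)
       (simp add: sum_list_sum_nth atLeast0LessThan)
  ultimately show ?thesis unfolding row_cofactor_def by (auto intro: homog_sign)
qed

lemma row_cofactor_0: "row_cofactor xs 0 = schur_seq xs"
  by (simp add: row_cofactor_def schur_seq_def add_diff_eq)

text \<open>
  Deleting the last column shifts the remaining columns relative to \<open>row_cofactor_0\<close>, which
  removes one box from every row.
\<close>

lemma row_cofactor_length: "row_cofactor xs (length xs) = (-1) ^ length xs * schur_seq (map (\<lambda>x. x - 1) xs)"
  unfolding row_cofactor_def schur_seq_def
  by (rule arg_cong[where f = "\<lambda>A. (-1) ^ length xs * det A"])
     (auto intro!: eq_matI simp: algebra_simps)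

lemma schur_seq_Cons: "schur_seq (a # xs) = (\<Sum>j\<le>length xs. hsym (a + int j) * row_cofactor xs j)"
proof -
  have c: "jt_mat (a # xs) \<in> carrier_mat (Suc (length xs)) (Suc (length xs))" 
    using jt_mat_carrier[of "a # xs"] by simp
  have "mat (length xs) (length xs) (\<lambda>(i, c). jt_mat (a # xs) $$ (Suc i, insert_index j c))
     = mat (length xs) (length xs) (\<lambda>(i, c). hsym (xs ! i + int (insert_index j c) - int (Suc i)))" for j
    by (rule eq_matI) (auto simp: jt_mat_def insert_index_def)
  thus ?thesis unfolding schur_seq_jt_mat det_first_row[OF c] row_cofactor_def
    by (intro sum.cong) (auto simp: jt_mat_def)
qed

text \<open>
  The sum of all cofactors is the determinant with a first row of ones. Column differences turn that
  row into \<open>(1, 0, \<dots>, 0)\<close> and the other entries into \<open>h\<^sub>m - h\<^sub>m\<^sub>-\<^sub>1 = \<psi>(h\<^sub>m)\<close>. Together with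
  \<open>homog_row_cofactor\<close> this identifies the cofactors as the homogeneous components of \<open>\<psi>(s)\<close>.
\<close>

lemma remove_one_schur_seq: "remove_one (schur_seq xs) = (\<Sum>j\<le>length xs. row_cofactor xs j)"
proof -
  let ?n = "length xs"
  (* The matrix with cofactors as in row_cofactor and with a first row of ones. *)
  define A where "A = mat (Suc ?n) (Suc ?n) (\<lambda>(i, j). if i = 0 then 1 else hsym (xs ! (i - 1) + int j - int i))"
  have A: "A \<in> carrier_mat (Suc ?n) (Suc ?n)" by (simp add: A_def)
  define B where "B = mat (Suc ?n) (Suc ?n) (\<lambda>(i, j). if j = 0 then A $$ (i, j) else A $$ (i, j) - A $$ (i, j - 1))"
  have B: "B \<in> carrier_mat (Suc ?n) (Suc ?n)" by (simp add: B_def)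
  have "mat ?n ?n (\<lambda>(i, c). A $$ (Suc i, insert_index j c))
     = mat ?n ?n (\<lambda>(i, c). hsym (xs ! i + int (insert_index j c) - int (Suc i)))" for j
    by (rule eq_matI) (auto simp: A_def insert_index_def)
  hence "(\<Sum>j\<le>?n. row_cofactor xs j) = det A"
    unfolding det_first_row[OF A] row_cofactor_def
    by (intro sum.cong) (auto simp: A_def)
  also have "\<dots> = det B" unfolding B_def by (rule det_column_differences[OF A, symmetric])
  also have "\<dots> = (\<Sum>j\<in>{0}. B $$ (0, j) * ((-1) ^ j * det (mat ?n ?n (\<lambda>(i, c). B $$ (Suc i, insert_index j c)))))"
    unfolding det_first_row[OF B] by (rule sum.mono_neutral_right) (auto simp: B_def A_def)
  also have "\<dots> = det (mat ?n ?n (\<lambda>(i, c). B $$ (Suc i, Suc c)))"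
    by (simp add: B_def A_def)
  also have "mat ?n ?n (\<lambda>(i, c). B $$ (Suc i, Suc c)) = map_mat remove_one (jt_mat xs)"
    by (rule eq_matI) (auto simp: B_def A_def jt_mat_def remove_one_hsym algebra_simps)
  finally show ?thesis by (simp add: schur_seq_jt_mat alg_hom_det[OF alg_hom_remove_one])
qed

text \<open>
  Column differences restore the entries \<open>h\<^sub>m\<close> of the Jacobi--Trudi matrix in all columns but the
  first. In an expansion along the first column the component of degree \<open>d\<close> has the factors
  \<open>h\<close> of index \<open>y\<^sub>i - i - k\<close>, for \<open>y\<close> the list \<open>a # xs\<close>; for \<open>k \<ge> a\<close> these indices are negative, except for
  \<open>i = 0\<close> and \<open>k = a\<close>.
\<close>

lemma power_form_adjoin_one_schur_seq:
  assumes X: "homog d X" and dk: "d + k = a + sum_list xs" and k: "k \<ge> a" and a0: "a \<ge> 0"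
    and le: "\<And>x. x \<in> set xs \<Longrightarrow> x \<le> a"
  shows "power_form X (adjoin_one (schur_seq (a # xs))) = (if k = a then power_form X (schur_seq xs) else 0)"
proof -
  let ?n = "length xs" and ?ys = "a # xs"
  define E where "E i = (-1) ^ i * det (mat ?n ?n (\<lambda>(r, c).
      hsym (?ys ! insert_index i r + int (Suc c) - int (insert_index i r))))" for i
  define A where "A = map_mat adjoin_one (jt_mat ?ys)"
  have A: "A \<in> carrier_mat (Suc ?n) (Suc ?n)"
    using jt_mat_carrier[of ?ys] by (simp add: A_def)
  define B where "B = mat (Suc ?n) (Suc ?n) (\<lambda>(i, j). if j = 0 then A $$ (i, j) else A $$ (i, j) - A $$ (i, j - 1))"
  have B: "B \<in> carrier_mat (Suc ?n) (Suc ?n)" by (simp add: B_def)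
  have B0: "B $$ (i, 0) = adjoin_one (hsym (?ys ! i - int i))" if "i \<le> ?n" for i
    using that by (simp add: B_def A_def jt_mat_def)
  have BS: "B $$ (i, Suc c) = hsym (?ys ! i + int (Suc c) - int i)" if "i \<le> ?n" "c < ?n" for i c
    using that adjoin_one_hsym_diff[of "?ys ! i + int (Suc c) - int i"]
    by (simp add: B_def A_def jt_mat_def algebra_simps)
  have "adjoin_one (schur_seq ?ys) = det A"
    by (simp add: schur_seq_jt_mat alg_hom_det[OF alg_hom_adjoin_one] A_def)
  also have "\<dots> = det B" unfolding B_def by (rule det_column_differences[OF A, symmetric])
  also have "\<dots> = (\<Sum>i\<le>?n. adjoin_one (hsym (?ys ! i - int i)) * E i)"
  proof -
    have "mat ?n ?n (\<lambda>(r, c). B $$ (insert_index i r, Suc c))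
       = mat ?n ?n (\<lambda>(r, c). hsym (?ys ! insert_index i r + int (Suc c) - int (insert_index i r)))"
      if "i \<le> ?n" for i
      by (rule eq_matI) (use that in \<open>auto simp: insert_index_def BS\<close>)
    thus ?thesis unfolding det_first_column[OF B] E_def
      by (intro sum.cong) (auto simp: B0)
  qed
  finally have exp: "adjoin_one (schur_seq ?ys) = (\<Sum>i\<le>?n. adjoin_one (hsym (?ys ! i - int i)) * E i)" .
  have homE: "homog (sum_list ?ys - (?ys ! i - int i)) (E i)" if i: "i \<le> ?n" for i
  proof -
    have "homog ((\<Sum>r<?n. ?ys ! insert_index i r - int (insert_index i r)) + (\<Sum>c<?n. int (Suc c)))
      (det (mat ?n ?n (\<lambda>(r, c). hsym (?ys ! insert_index i r + int (Suc c) - int (insert_index i r)))))"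
      by (rule homog_det) (auto intro: homog_hsym[THEN back_subst[of "\<lambda>d. homog d _"]])
    moreover have "(\<Sum>r<?n. ?ys ! insert_index i r) = sum_list ?ys - ?ys ! i"
    proof -
      have "(\<Sum>r<?n. ?ys ! insert_index i r) = (\<Sum>r\<in>insert_index i ` {0..<?n}. ?ys ! r)"
        by (simp add: sum.reindex insert_index_inj_on atLeast0LessThan)
      also have "insert_index i ` {0..<?n} = {0..<Suc ?n} - {i}"
        using insert_index_image[of i ?n] i by auto
      also have "(\<Sum>r\<in>{0..<Suc ?n} - {i}. ?ys ! r) = (\<Sum>r\<in>{0..<Suc ?n}. ?ys ! r) - ?ys ! i"
        using i by (subst sum_diff1) auto
      finally show ?thesis unfolding sum_list_sum_nth[of ?ys] by simp
    qed
    moreover have "(\<Sum>c<?n. int (Suc c)) = (\<Sum>c\<le>?n. int c)"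
      unfolding lessThan_Suc_atMost[symmetric] sum.lessThan_Suc_shift by simp
    ultimately have "homog (sum_list ?ys - (?ys ! i - int i))
      (det (mat ?n ?n (\<lambda>(r, c). hsym (?ys ! insert_index i r + int (Suc c) - int (insert_index i r)))))"
      using sum_insert_index[OF i] by (simp add: sum_subtractf algebra_simps del: sum_list.Cons)
    thus ?thesis unfolding E_def by (rule homog_sign)
  qed
  have ys_le: "?ys ! i \<le> a" if "i \<le> ?n" for i
    using that le by (cases i) auto
  (* The degrees do not match: homogeneity would force a negative index l. *)
  have zero: "power_form X (adjoin_one (hsym (?ys ! i - int i)) * E i) = 0" if i: "i \<le> ?n" and ne: "i > 0 \<or> k > a" for i
    unfolding adjoin_one_hsym sum_distrib_right power_form_sum_right
  proof (rule sum.neutral, rule ballI)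
    fix l assume l: "l \<in> {0..?ys ! i - int i}"
    have "l + (sum_list ?ys - (?ys ! i - int i)) \<noteq> d"
      using l ys_le[OF i] ne dk k by auto
    thus "power_form X (hsym l * E i) = 0"
      using power_form_homog[OF X homog_mult[OF homog_hsym homE[OF i]]] by metis
  qed
  have E0: "E 0 = schur_seq xs"
    unfolding E_def schur_seq_def by (simp add: algebra_simps)
  show ?thesis
  proof (cases "k = a")
    case False
    thus ?thesis unfolding exp power_form_sum_right using k zero by (auto intro!: sum.neutral)
  next
    case True
    have "power_form X (adjoin_one (schur_seq ?ys)) = power_form X (adjoin_one (hsym a) * E 0)"
    proof -
      have "(\<Sum>i\<in>{..?n} - {0}. power_form X (adjoin_one (hsym (?ys ! i - int i)) * E i)) = 0"
        by (intro sum.neutral ballI zero) auto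
      thus ?thesis unfolding exp power_form_sum_right by (subst sum.remove[of _ 0]) auto
    qed
    also have "\<dots> = power_form X (E 0)"
    proof -
      have "homog (sum_list xs) (E 0)" using homE[of 0] by simp
      hence z: "power_form X (hsym l * E 0) = 0" if "l \<noteq> 0" for l
        using power_form_homog[OF X homog_mult[OF homog_hsym]] that dk True by auto
      have "power_form X (adjoin_one (hsym a) * E 0) = (\<Sum>l\<in>{0..a}. power_form X (hsym l * E 0))"
        by (simp add: adjoin_one_hsym sum_distrib_right power_form_sum_right)
      also have "\<dots> = power_form X (hsym 0 * E 0)"
        using a0 z by (subst sum.remove[of _ 0]) (auto intro!: sum.neutral)
      finally show ?thesis by (simp add: hsym_0)
    qed
    finally show ?thesis using True E0 by simp
  qed
qed

section \<open>Schur functions\<close>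

text \<open>
  If the first rows are \<open>b \<ge> a\<close>, expand the first determinant along its first row and move each
  \<open>h\<^sub>b\<^sub>+\<^sub>j\<close> to the other side. There it gives zero unless \<open>j = 0\<close> and \<open>b = a\<close>, in which case the first row
  is removed on both sides.
\<close>

lemma power_form_schur_seq_Cons:
  assumes sum: "b + sum_list zs = a + sum_list xs" and ba: "b \<ge> a" and a0: "a \<ge> 0"
    and n: "a + sum_list xs \<ge> 0" and le: "\<And>x. x \<in> set xs \<Longrightarrow> x \<le> a"
  shows "power_form (schur_seq (b # zs)) (schur_seq (a # xs))
    = (if b = a then power_form (schur_seq zs) (schur_seq xs) else 0)"
proof -
  let ?s = "schur_seq (a # xs)"
  have s: "homog (int (nat (a + sum_list xs))) ?s"
    using homog_schur_seq[of "a # xs"] n by simp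
  have summand: "power_form (hsym (b + int j) * row_cofactor zs j) ?s
     = (if j = 0 \<and> b = a then power_form (row_cofactor zs j) (schur_seq xs) else 0)" if j: "j \<le> length zs" for j
  proof -
    note C = homog_row_cofactor[OF j]
    have "power_form (hsym (b + int j) * row_cofactor zs j) ?s = power_form (row_cofactor zs j) (adjoin_one ?s)"
    proof -
      have "int (nat (a + sum_list xs)) - (sum_list zs - int j) = b + int j" using n sum by simp
      from power_form_hsym_mult[OF C s, unfolded this] show ?thesis .
    qed
    also have "\<dots> = (if b + int j = a then power_form (row_cofactor zs j) (schur_seq xs) else 0)"
      by (rule power_form_adjoin_one_schur_seq[OF C]) (use sum ba a0 le in auto)
    also have "b + int j = a \<longleftrightarrow> j = 0 \<and> b = a" using ba by auto
    finally show ?thesis .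
  qed
  have "power_form (schur_seq (b # zs)) ?s = (\<Sum>j\<le>length zs. if j = 0 then
     (if b = a then power_form (row_cofactor zs j) (schur_seq xs) else 0) else 0)"
    unfolding schur_seq_Cons[of b zs] power_form_sum_left by (rule sum.cong) (use summand in auto)
  thus ?thesis by (simp add: row_cofactor_0)
qed

lemma sum_list_map_int: "sum_list (map int xs) = int (sum_list xs)"
  by (induction xs) auto

text \<open>
  By symmetry of the form the larger first row may be assumed to stand on the left.
\<close>

lemma schur_seq_orthonormal:
  assumes "sorted_wrt (\<ge>) xs" "0 \<notin> set xs" "sorted_wrt (\<ge>) ys" "0 \<notin> set ys"
  shows "power_form (schur_seq (map int xs)) (schur_seq (map int ys)) = (if xs = ys then 1 else 0)"
  using assms
proof (induction xs arbitrary: ys)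
  case Nil
  show ?case
  proof (cases ys)
    case Nil
    thus ?thesis by (simp add: power_form_1 one_sym.rep_eq)
  next
    case (Cons a ys')
    hence "sum_list (map int ys) \<noteq> 0" using Nil.prems by (auto simp: sum_list_map_int)
    thus ?thesis using power_form_homog[OF homog_1 homog_schur_seq[of "map int ys"]] Cons by auto
  qed
next
  case (Cons b zs ys)
  show ?case
  proof (cases "sum_list (b # zs) = sum_list ys")
    case False
    hence "sum_list (map int (b # zs)) \<noteq> sum_list (map int ys)" unfolding sum_list_map_int by linarith
    thus ?thesis using power_form_homog[OF homog_schur_seq homog_schur_seq] False by auto
  next
    case sum: True
    with Cons.prems obtain a xs where ys: "ys = a # xs" by (cases ys) auto
    have sum': "int b + sum_list (map int zs) = int a + sum_list (map int xs)"
      using sum unfolding ys sum_list_map_int by simp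
    have IH: "power_form (schur_seq (map int zs)) (schur_seq (map int xs)) = (if zs = xs then 1 else 0)"
      using Cons ys by auto
    have nn: "sum_list (map int ks) \<ge> 0" for ks by (simp add: sum_list_map_int)
    show ?thesis
    proof (cases "b \<ge> a")
      case True
      have "power_form (schur_seq (int b # map int zs)) (schur_seq (int a # map int xs))
        = (if int b = int a then power_form (schur_seq (map int zs)) (schur_seq (map int xs)) else 0)"
        by (rule power_form_schur_seq_Cons[OF sum']) (use True Cons.prems ys nn in auto)
      thus ?thesis using IH ys by auto
    next
      case False
      have "power_form (schur_seq (int a # map int xs)) (schur_seq (int b # map int zs))
        = (if int a = int b then power_form (schur_seq (map int xs)) (schur_seq (map int zs)) else 0)"
        by (rule power_form_schur_seq_Cons[OF sum'[symmetric]]) (use False Cons.prems ys nn in auto)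
      thus ?thesis using False ys by (simp add: power_form_commute[of "schur_seq (int b # map int zs)"])
    qed
  qed
qed

lemma schur_orthonormal: "power_form (schur la) (schur \<mu>) = (if la = \<mu> then 1 else 0)"
  unfolding schur_def using schur_seq_orthonormal parts_props parts_inject by simp

lemma homog_schur: "homog (int (psize la)) (schur la)"
  using homog_schur_seq[of "map int (parts la)"] by (simp add: schur_def psize_def sum_list_map_int)

lemma schur_inj: "inj schur"
  by (rule injI) (metis schur_orthonormal zero_neq_one)

lemma power_form_scaled_schur: "v \<in> range schur \<Longrightarrow> power_form v (schur la) = (if v = schur la then 1 else 0)"
  using schur_orthonormal schur_inj by (auto dest: injD)

lemma schur_independent: "\<not> sym.dependent (range schur)"
  unfolding sym.dependent_explicit
proof (clarify)
  fix T c v assume T: "finite T" "T \<subseteq> range schur" and s: "(\<Sum>v\<in>T. c v *\<^sub>Q v) = 0" and v: "v \<in> T" "c v \<noteq> 0"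
  obtain la where la: "v = schur la" using T v by auto
  have "0 = power_form (\<Sum>v\<in>T. c v *\<^sub>Q v) (schur la)" by (simp add: s)
  also have "\<dots> = (\<Sum>w\<in>T. c w * (if w = v then 1 else 0))"
    unfolding power_form_sum_left power_form_scale_left by (rule sum.cong) (use T la power_form_scaled_schur in auto)
  also have "\<dots> = c v" using T v by (simp add: if_distrib sum.delta cong: if_cong)
  finally show False using v by simp
qed

text \<open>
  The Schur functions of degree \<open>n\<close> are independent, lie in the span of the power sum products
  of degree \<open>n\<close>, and are equally many; hence they span the same space.
\<close>

lemma schur_span: "sym.span (range schur) = UNIV"
proof -
  have "psym la \<in> sym.span (range schur)" for la
  proof -
    define n where "n = psize la"
    define P where "P = {\<mu>. psize \<mu> = n}"
    have fin: "finite P" by (rule finite_subset[OF _ finite_Par[of n]]) (auto simp: P_def Par_def)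
    have cards: "card (schur ` P) = card P" "card (psym ` P) = card P"
      by (auto intro!: card_image inj_on_subset[OF schur_inj] inj_on_subset[OF psym_inj])
    have sub: "schur ` P \<subseteq> sym.span (psym ` P)"
    proof (clarify)
      fix \<mu> assume in_P: "\<mu> \<in> P"
      have "{ka. psym_coeff (schur \<mu>) ka \<noteq> 0} \<subseteq> P"
        using psym_coeff_homog[OF homog_schur[of \<mu>]] in_P by (auto simp: P_def)
      thus "schur \<mu> \<in> sym.span (psym ` P)"
        by (subst psym_expansion) (intro sym.span_sum sym.span_scale sym.span_base; blast)
    qed
    have "psym la \<in> sym.span (schur ` P)"
    proof (rule ccontr)
      assume nin: "psym la \<notin> sym.span (schur ` P)"
      have ind: "\<not> sym.dependent (schur ` P)"
        using schur_independent sym.dependent_mono[of "schur ` P" "range schur"] by blast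
      have "psym la \<notin> schur ` P" using nin sym.span_base by blast
      hence "\<not> sym.dependent (insert (psym la) (schur ` P))"
        using ind nin by (simp add: sym.independent_insert)
      moreover have "insert (psym la) (schur ` P) \<subseteq> sym.span (psym ` P)"
        using sub by (auto intro: sym.span_base simp: P_def n_def)
      ultimately have "card (insert (psym la) (schur ` P)) \<le> card (psym ` P)"
        using sym.independent_span_bound fin by blast
      thus False using fin cards \<open>psym la \<notin> schur ` P\<close> by simp
    qed
    thus ?thesis using sym.span_mono[of "schur ` P" "range schur"] by blast
  qed
  hence "sym.span (range psym) \<subseteq> sym.span (range schur)"
    by (intro sym.span_minimal sym.subspace_span) auto
  thus ?thesis using psym_span by blast
qed

lemma schur_coeff_eq: "schur_coeff f la = power_form f (schur la)"
proof -
  let ?r = "sym.representation (range schur) f"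
  have fin: "finite {b. ?r b \<noteq> 0}" by (rule sym.finite_representation)
  have "f = (\<Sum>b | ?r b \<noteq> 0. ?r b *\<^sub>Q b)"
    using sym.sum_nonzero_representation_eq[OF schur_independent, of f] schur_span by simp
  hence "power_form f (schur la) = power_form (\<Sum>b | ?r b \<noteq> 0. ?r b *\<^sub>Q b) (schur la)" by simp
  also have "\<dots> = (\<Sum>b | ?r b \<noteq> 0. ?r b * power_form b (schur la))"
    by (simp add: power_form_sum_left power_form_scale_left)
  also have "\<dots> = (\<Sum>b | ?r b \<noteq> 0. if b = schur la then ?r b else 0)"
  proof (rule sum.cong)
    fix b assume "b \<in> {b. ?r b \<noteq> 0}"
    hence "b \<in> range schur" using sym.representation_ne_zero[of "range schur" f b] by blast
    thus "?r b * power_form b (schur la) = (if b = schur la then ?r b else 0)"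
      using power_form_scaled_schur by simp
  qed simp
  also have "\<dots> = ?r (schur la)" using fin by simp
  finally show ?thesis by (simp add: schur_coeff_def)
qed

lemma power_form_schur_high: "degree_le N f \<Longrightarrow> psize la > N \<Longrightarrow> power_form f (schur la) = 0"
  using degree_le_power_form[OF _ homog_schur] by simp

lemma power_form_schur_support: "degree_le N f \<Longrightarrow> {la. power_form f (schur la) \<noteq> 0} \<subseteq> Par N"
  using power_form_schur_high by (auto simp: Par_def not_less[symmetric])

lemma schur_expansion:
  assumes N: "degree_le N f"
  shows "(\<Sum>la\<in>Par N. power_form f (schur la) *\<^sub>Q schur la) = f"
proof -
  define r where "r = f - (\<Sum>la\<in>Par N. power_form f (schur la) *\<^sub>Q schur la)"
  have orth: "power_form (schur \<mu>) r = 0" for \<mu>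
  proof -
    have "power_form (\<Sum>la\<in>Par N. power_form f (schur la) *\<^sub>Q schur la) (schur \<mu>)
        = (\<Sum>la\<in>Par N. if la = \<mu> then power_form f (schur la) else 0)"
      unfolding power_form_sum_left power_form_scale_left schur_orthonormal by (rule sum.cong) auto
    also have "\<dots> = (if \<mu> \<in> Par N then power_form f (schur \<mu>) else 0)" by (simp add: sum.delta)
    also have "\<dots> = power_form f (schur \<mu>)" using power_form_schur_high[OF N, of \<mu>] by (auto simp: Par_def)
    finally have "power_form r (schur \<mu>) = 0" by (simp add: r_def power_form_minus_left)
    thus ?thesis by (simp add: power_form_commute)
  qed
  have "r \<in> sym.span (range schur)" using schur_span by simp
  moreover have "sym.subspace {g. power_form g r = 0}"
    unfolding sym.subspace_def by (auto simp: power_form_add_left power_form_scale_left)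
  ultimately have "power_form r r = 0" using sym.span_induct[of r "range schur" "\<lambda>g. power_form g r = 0"] orth by blast
  thus ?thesis using power_form_definite[of r] by (simp add: r_def)
qed

lemma parseval:
  assumes "degree_le N f \<or> degree_le N g"
  shows "(\<Sum>la\<in>Par N. power_form f (schur la) * power_form g (schur la)) = power_form f g"
proof -
  have *: "(\<Sum>la\<in>Par N. power_form f (schur la) * power_form g (schur la)) = power_form f g" if N: "degree_le N f" for f g
  proof -
    have "power_form f g = power_form (\<Sum>la\<in>Par N. power_form f (schur la) *\<^sub>Q schur la) g"
      by (simp only: schur_expansion[OF N])
    thus ?thesis by (simp add: power_form_sum_left power_form_scale_left power_form_commute[of g])
  qed
  show ?thesis using assms *[of f g] *[of g f] by (auto simp: mult.commute power_form_commute[of g f])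
qed

lemma hall_eq_power_form: "hall f g = power_form f g"
proof -
  obtain N where N: "degree_le N f" using ex_degree_le by blast
  have "hall f g = (\<Sum>la\<in>Par N. power_form f (schur la) * power_form g (schur la))"
    unfolding hall_def schur_coeff_eq
    by (rule Sum_any.expand_superset) (use power_form_schur_support[OF N] in auto)
  thus ?thesis using parseval N by simp
qed

section \<open>Adjoints of multiplication operators\<close>

text \<open>
  The functions whose multiplication operator has an adjoint are closed under linear combinations
  and under multiplication by power sums. This is what makes the definite description in the definition of \<open>D_op\<close> meaningful.
\<close>

lemma ex_adjoint: "\<exists>T. \<forall>g h. power_form (T g) h = power_form g (f * h)"
proof (induction f rule: sym_mult_induct)
  case (add f f')
  then obtain T T' where "\<forall>g h. power_form (T g) h = power_form g (f * h)" "\<forall>g h. power_form (T' g) h = power_form g (f' * h)" by blast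
  hence "\<forall>g h. power_form (T g + T' g) h = power_form g ((f + f') * h)"
    by (simp add: power_form_add_left power_form_add_right distrib_right)
  thus ?case by (rule exI[of _ "\<lambda>g. T g + T' g"])
next
  case (scale c f)
  then obtain T where "\<forall>g h. power_form (T g) h = power_form g (f * h)" by blast
  hence "\<forall>g h. power_form (c *\<^sub>Q T g) h = power_form g ((c *\<^sub>Q f) * h)"
    by (simp add: power_form_scale_left power_form_scale_right scale_mult_left)
  thus ?case by (rule exI[of _ "\<lambda>g. c *\<^sub>Q T g"])
next
  case one
  show ?case by (rule exI[of _ "\<lambda>g. g"]) simp
next
  case (power_sum n f)
  then obtain T where T: "\<forall>g h. power_form (T g) h = power_form g (f * h)" by blast
  have "power_form (T (p_deriv n g)) h = power_form g (power_sum n * f * h)" for g h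
    using T p_deriv_adjoint[OF power_sum(1), of "f * h" g] by (simp add: power_form_commute mult.assoc)
  thus ?case by (intro exI[of _ "\<lambda>g. T (p_deriv n g)"]) simp
qed

lemma D_adjoint: "power_form (D_op f g) h = power_form g (f * h)"
proof -
  obtain T where T: "\<forall>g h. power_form (T g) h = power_form g (f * h)" using ex_adjoint by blast
  have "D_op f = T"
    unfolding D_op_def hall_eq_power_form U_op_def
  proof (rule the_equality)
    show "\<forall>g h. power_form (T g) h = power_form g (f * h)" by (rule T)
    fix T' assume "\<forall>g h. power_form (T' g) h = power_form g (f * h)"
    hence "power_form (T' g) h = power_form (T g) h" for g h using T by simp
    thus "T' = T" using power_form_eqI by blast
  qed
  thus ?thesis using T by simp
qed

lemma D_eqI: "(\<And>h. power_form x h = power_form g (f * h)) \<Longrightarrow> D_op f g = x"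
  using power_form_eqI D_adjoint by metis

lemma lin_D: "lin (D_op f)"
  unfolding lin_def by (auto intro!: D_eqI simp: power_form_add_left power_form_scale_left D_adjoint)

lemma lin_D_left: "lin (\<lambda>f. D_op f g)"
  unfolding lin_def
  by (auto intro!: D_eqI simp: power_form_add_left power_form_scale_left D_adjoint distrib_right power_form_add_right power_form_scale_right scale_mult_left)

lemma D_1: "D_op 1 g = g"
  by (rule D_eqI) simp

lemma D_mult: "D_op (f * f') g = D_op f (D_op f' g)"
  by (rule D_eqI) (simp add: D_adjoint mult.left_commute mult.assoc)

lemma D_power_sum: "n > 0 \<Longrightarrow> D_op (power_sum n) g = p_deriv n g"
  by (rule D_eqI) (metis p_deriv_adjoint power_form_commute)

text \<open>
  Pair \<open>f\<close> with its own components of high degree.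
\<close>

lemma degree_leI_power_form:
  assumes "\<And>d h. homog (int d) h \<Longrightarrow> d > N \<Longrightarrow> power_form f h = 0"
  shows "degree_le N f"
proof -
  obtain M where M: "degree_le M f" using ex_degree_le by blast
  have z: "hom_component n f = 0" if n: "n > N" for n
  proof (cases "n \<le> M")
    case True
    have "0 = power_form f (hom_component n f)" using assms[OF homog_hom_component n] by simp
    also have "\<dots> = (\<Sum>k\<le>M. power_form (hom_component k f) (hom_component n f))"
      by (subst hom_component_sum[OF M]) (rule power_form_sum_left)
    also have "\<dots> = power_form (hom_component n f) (hom_component n f)"
      using True power_form_homog[OF homog_hom_component homog_hom_component]
      by (subst sum.remove[of _ n]) (auto intro!: sum.neutral)
    finally show ?thesis using power_form_definite by simp
  next
    case False
    thus ?thesis using M by (intro sym_eqI) (force simp: coeff_simps degree_le_def)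
  qed
  show ?thesis
    unfolding degree_le_def
  proof (intro allI impI)
    fix m assume nz: "coeff_mono f m \<noteq> 0"
    have "coeff_mono (hom_component (size m) f) m \<noteq> 0" using nz by (simp add: coeff_simps)
    thus "size m \<le> N" using z[of "size m"] by (cases "size m \<le> N") (auto simp: coeff_simps)
  qed
qed

lemma degree_le_D:
  assumes "degree_le N g"
  shows "degree_le N (D_op f g)"
proof (rule degree_leI_power_form)
  fix d h assume h: "homog (int d) h" "d > N"
  obtain M where M: "degree_le M f" using ex_degree_le by blast
  have "power_form (D_op f g) h = (\<Sum>k\<le>M. power_form g (hom_component k f * h))"
    unfolding D_adjoint by (subst hom_component_sum[OF M]) (simp add: sum_distrib_right power_form_sum_right)
  also have "\<dots> = 0"
    using degree_le_power_form[OF assms homog_mult[OF homog_hom_component h(1)]] h(2)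
    by (intro sum.neutral) auto
  finally show "power_form (D_op f g) h = 0" .
qed

lemma D_schur_high:
  assumes "degree_le N g" "psize la > N"
  shows "D_op (schur la) g = 0"
proof -
  have "power_form (D_op (schur la) g) h = 0" for h
  proof -
    obtain M where M: "degree_le M h" using ex_degree_le by blast
    have "power_form (D_op (schur la) g) h = (\<Sum>k\<le>M. power_form g (schur la * hom_component k h))"
      unfolding D_adjoint by (subst hom_component_sum[OF M]) (simp add: sum_distrib_left power_form_sum_right)
    also have "\<dots> = 0"
      using degree_le_power_form[OF assms(1) homog_mult[OF homog_schur homog_hom_component]] assms(2)
      by (intro sum.neutral) auto
    finally show ?thesis .
  qed
  thus ?thesis using power_form_eqI[of _ 0] by simp
qed

text \<open>
  It suffices to commute with the derivations, and \<open>p\<^sub>n - 1\<close> has the same derivatives as \<open>p\<^sub>n\<close>.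
\<close>

lemma remove_one_D: "remove_one (D_op a f) = D_op a (remove_one f)"
proof (induction a arbitrary: f rule: sym_mult_induct)
  case (power_sum n a)
  thus ?case by (simp add: D_mult D_power_sum flip: p_deriv_remove_one)
qed (simp_all add: D_1 lin_add[OF lin_D_left] lin_scale[OF lin_D_left] hom_simps)

section \<open>Conjugate partitions\<close>

text \<open>
  The last row of the matrix is \<open>(0, \<dots>, 0, 1)\<close>.
\<close>

lemma schur_seq_trailing_zero: "schur_seq (xs @ [0]) = schur_seq xs"
proof -
  let ?n = "length xs" and ?A = "jt_mat (xs @ [0])"
  have A: "?A \<in> carrier_mat (Suc ?n) (Suc ?n)" using jt_mat_carrier[of "xs @ [0]"] by simp
  have row: "?A $$ (?n, j) = (if j = ?n then 1 else 0)" if "j < Suc ?n" for j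
    using that by (auto simp: jt_mat_def hsym_0 hsym_neg)
  have del: "mat_delete ?A ?n ?n = jt_mat xs"
    by (rule eq_matI)
       (use mat_delete_index[OF A, of ?n ?n] mat_delete_carrier[OF A, of ?n ?n] in \<open>auto simp: jt_mat_def nth_append\<close>)
  have "det ?A = (\<Sum>j<Suc ?n. ?A $$ (?n, j) * cofactor ?A ?n j)"
    by (rule laplace_expansion_row[OF A]) simp
  also have "\<dots> = cofactor ?A ?n ?n"
    using row by simp
  also have "\<dots> = det (jt_mat xs)" by (simp add: cofactor_def del)
  finally show ?thesis by (simp add: schur_seq_jt_mat)
qed

text \<open>
  The conjugate partition, padded with zeros to length \<open>a\<close>. The padding makes removing the first
  row of a partition correspond to subtracting one from every column length.
\<close>

definition column_lengths :: "nat \<Rightarrow> nat list \<Rightarrow> int list" where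
  "column_lengths a xs = map (\<lambda>i. int (length (filter (\<lambda>x. i < x) xs))) [0..<a]"

lemma schur_seq_column_lengths:
  assumes "b \<le> a" "\<And>x. x \<in> set xs \<Longrightarrow> x \<le> b"
  shows "schur_seq (column_lengths a xs) = schur_seq (column_lengths b xs)"
  using assms(1)
proof (induction a rule: dec_induct)
  case (step a)
  have "filter (\<lambda>x. a < x) xs = []" using assms(2) step(1) by (force simp: filter_empty_conv)
  hence "column_lengths (Suc a) xs = column_lengths a xs @ [0]" by (simp add: column_lengths_def)
  thus ?case using step by (simp add: schur_seq_trailing_zero)
qed simp

lemma sum_list_column_lengths:
  "(\<And>x. x \<in> set xs \<Longrightarrow> x \<le> a) \<Longrightarrow> sum_list (column_lengths a xs) = int (sum_list xs)"
proof (induction xs)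
  case (Cons x xs)
  have "sum_list (column_lengths a (x # xs))
      = (\<Sum>i = 0..<a. (if i < x then 1 else 0) + int (length (filter (\<lambda>x. i < x) xs)))"
    by (auto simp: column_lengths_def interv_sum_list_conv_sum_set_nat intro!: sum.cong)
  also have "\<dots> = (\<Sum>i = 0..<a. if i < x then 1 else 0) + sum_list (column_lengths a xs)"
    by (simp add: column_lengths_def interv_sum_list_conv_sum_set_nat sum.distrib)
  also have "(\<Sum>i = 0..<a. if i < x then 1 else 0) = int x"
  proof -
    have "{0..<a} \<inter> {i. i < x} = {0..<x}" using Cons.prems[of x] by auto
    thus ?thesis by (simp add: sum.If_cases)
  qed
  finally show ?case using Cons by simp
qed (simp add: column_lengths_def)

text \<open>
  Let \<open>s\<close> be the Schur function of a partition and \<open>s'\<close> that of its conjugate. The proof is by induction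
  on the rows. For a first row \<open>b\<close>, expand \<open>s\<close> along that row; the adjoint of multiplication by
  \<open>h\<^sub>b\<^sub>+\<^sub>j\<close> acts on \<open>S(s')\<close> as \<open>S\<close> applied to a component of \<open>\<psi>(s')\<close>, that is, to a row cofactor of \<open>s'\<close>.
  As \<open>s'\<close> has \<open>b\<close> rows, the component needed exists only for \<open>j = 0\<close>; it is then the last cofactor, in
  which every row of \<open>s'\<close> has lost one box.
\<close>

lemma power_form_antipode_column_lengths:
  assumes "sorted_wrt (\<ge>) xs" "\<And>x. x \<in> set xs \<Longrightarrow> x \<le> a"
  shows "power_form (schur_seq (map int xs)) (antipode (schur_seq (column_lengths a xs))) = (-1) ^ sum_list xs"
  using assms
proof (induction xs arbitrary: a)
  case Nil
  have "schur_seq (column_lengths a []) = 1"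
    using schur_seq_column_lengths[of 0 a "[]"] by (simp add: column_lengths_def)
  thus ?case by (simp add: hom_simps power_form_1 one_sym.rep_eq)
next
  case (Cons b xs)
  define ys where "ys = column_lengths b (b # xs)"
  have le: "x \<le> b" if "x \<in> set (b # xs)" for x using that Cons.prems(1) by auto
  have len: "length ys = b" by (simp add: ys_def column_lengths_def)
  have sum: "sum_list ys = int (b + sum_list xs)"
    using sum_list_column_lengths[of "b # xs" b] le by (simp add: ys_def)
  have tail: "map (\<lambda>x. x - 1) ys = column_lengths b xs"
    by (auto simp: ys_def column_lengths_def)
  let ?t = "antipode (schur_seq ys)"
  have t: "homog (int (b + sum_list xs)) ?t"
    using homog_antipode[OF homog_schur_seq[of ys]] sum by simp
  have adjoin_one_t: "adjoin_one ?t = (\<Sum>j\<le>b. antipode (row_cofactor ys j))"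
    by (simp add: adjoin_one_antipode remove_one_schur_seq len lin_sum[OF alg_hom_lin[OF alg_hom_antipode]])
  have summand: "power_form (hsym (int b + int j) * row_cofactor (map int xs) j) ?t
     = (if j = 0 then (-1) ^ (b + sum_list xs) else 0)" if j: "j \<le> length xs" for j
  proof -
    have C: "homog (int (sum_list xs) - int j) (row_cofactor (map int xs) j)"
      using homog_row_cofactor[of j "map int xs"] j by (simp add: sum_list_map_int)
    have e: "int (b + sum_list xs) - (int (sum_list xs) - int j) = int b + int j" by simp
    have "power_form (hsym (int b + int j) * row_cofactor (map int xs) j) ?t
        = power_form (row_cofactor (map int xs) j) (adjoin_one ?t)"
      using power_form_hsym_mult[OF C t] unfolding e .
    also have "\<dots> = (\<Sum>i\<le>b. power_form (row_cofactor (map int xs) j) (antipode (row_cofactor ys i)))"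
      by (simp add: adjoin_one_t power_form_sum_right)
    also have "\<dots> = (\<Sum>i\<le>b. if i = b \<and> j = 0 then power_form (row_cofactor (map int xs) 0) (antipode (row_cofactor ys b)) else 0)"
    proof (rule sum.cong)
      fix i assume i: "i \<in> {..b}"
      have "homog (sum_list ys - int i) (antipode (row_cofactor ys i))"
        using homog_antipode[OF homog_row_cofactor[of i ys]] i len by simp
      from power_form_homog[OF C this] show "power_form (row_cofactor (map int xs) j) (antipode (row_cofactor ys i))
         = (if i = b \<and> j = 0 then power_form (row_cofactor (map int xs) 0) (antipode (row_cofactor ys b)) else 0)"
        using i sum by auto
    qed simp
    also have "\<dots> = (if j = 0 then power_form (row_cofactor (map int xs) 0) (antipode (row_cofactor ys b)) else 0)"
      by simp
    also have "power_form (row_cofactor (map int xs) 0) (antipode (row_cofactor ys b))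
       = (-1) ^ b * power_form (schur_seq (map int xs)) (antipode (schur_seq (column_lengths b xs)))"
    proof -
      have "row_cofactor ys b = (-1) ^ b * schur_seq (column_lengths b xs)"
        using row_cofactor_length[of ys] len tail by simp
      hence "antipode (row_cofactor ys b) = (if even b then antipode (schur_seq (column_lengths b xs))
          else - antipode (schur_seq (column_lengths b xs)))"
        by (simp add: hom_simps)
      thus ?thesis by (simp add: row_cofactor_0 power_form_uminus_right)
    qed
    also have "power_form (schur_seq (map int xs)) (antipode (schur_seq (column_lengths b xs))) = (-1) ^ sum_list xs"
      by (rule Cons.IH) (use Cons.prems le in auto)
    finally show ?thesis by (simp add: power_add)
  qed
  have "power_form (schur_seq (map int (b # xs))) ?t = (\<Sum>j\<le>length xs. if j = 0 then (-1) ^ (b + sum_list xs) else 0)"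
    unfolding list.map schur_seq_Cons power_form_sum_left by (rule sum.cong) (use summand in auto)
  hence "power_form (schur_seq (map int (b # xs))) ?t = (-1) ^ sum_list (b # xs)" by simp
  moreover have "schur_seq (column_lengths a (b # xs)) = schur_seq ys"
    unfolding ys_def by (rule schur_seq_column_lengths) (use Cons.prems le in auto)
  ultimately show ?case by simp
qed

text \<open>
  The vectors \<open>s\<^sub>\<lambda>\<close> and \<open>t = (-1)\<^bsup>|\<lambda>|\<^esup> S(s\<^sub>\<lambda>\<^sub>')\<close> have norm one, since \<open>S\<close> is an isometry, and their inner
  product is one; so their difference has norm zero.
\<close>

lemma antipode_schur: "antipode (schur la) = (-1) ^ psize la *\<^sub>Q schur (conj_partition la)"
proof -
  let ?s = "schur la" and ?c = "schur (conj_partition la)"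
  define e :: rat where "e = (-1) ^ psize la"
  have e2: "e * e = 1" by (simp add: e_def flip: power_mult_distrib)
  have "map int (parts (conj_partition la)) = column_lengths (Max (set (0 # parts la))) (parts la)"
    by (simp add: conj_partition.rep_eq column_lengths_def)
  hence c: "?c = schur_seq (column_lengths (Max (set (0 # parts la))) (parts la))"
    by (simp add: schur_def)
  have st: "power_form ?s (antipode ?c) = e"
    unfolding c e_def psize_def unfolding schur_def
    by (rule power_form_antipode_column_lengths) (use parts_props in auto)
  define t where "t = e *\<^sub>Q antipode ?c"
  have "power_form (?s - t) (?s - t) = 0"
    using st e2 by (simp add: t_def power_form_minus_left power_form_minus_right power_form_scale_left power_form_scale_right
      power_form_antipode schur_orthonormal power_form_commute[of "antipode ?c" ?s])
  hence "?s = e *\<^sub>Q antipode ?c" using power_form_definite[of "?s - t"] by (simp add: t_def)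
  hence "antipode ?s = e *\<^sub>Q ?c" by (metis antipode_antipode alg_hom_lin alg_hom_antipode lin_scale)
  thus ?thesis by (simp add: e_def)
qed

section \<open>Comultiplication\<close>

definition bilin :: "(sym \<Rightarrow> sym \<Rightarrow> sym) \<Rightarrow> bool" where
  "bilin B \<longleftrightarrow> (\<forall>y. lin (\<lambda>x. B x y)) \<and> (\<forall>x. lin (B x))"

text \<open>
  The image of the coproduct of \<open>f\<close> under the linear map on \<open>Sym \<otimes> Sym\<close> given by a bilinear map
  \<open>B\<close>. Applying a bilinear map at once avoids forming the tensor product.
\<close>

definition coproduct :: "(sym \<Rightarrow> sym \<Rightarrow> sym) \<Rightarrow> sym \<Rightarrow> sym" where
  "coproduct B f = Sum_any (\<lambda>(l, n). power_form f (schur l * schur n) *\<^sub>Q B (schur l) (schur n))"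

lemma power_form_schur_mult_support:
  assumes "degree_le N f" "power_form f (schur l * schur n) \<noteq> 0"
  shows "l \<in> Par N \<and> n \<in> Par N"
  using degree_le_power_form[OF assms(1) homog_mult[OF homog_schur[of l] homog_schur[of n]]] assms(2)
  by (force simp: Par_def)

lemma coproduct_eq:
  assumes "degree_le N f"
  shows "coproduct B f = (\<Sum>l\<in>Par N. \<Sum>n\<in>Par N. power_form f (schur l * schur n) *\<^sub>Q B (schur l) (schur n))"
proof -
  have "coproduct B f = (\<Sum>(l, n)\<in>Par N \<times> Par N. power_form f (schur l * schur n) *\<^sub>Q B (schur l) (schur n))"
    unfolding coproduct_def
    by (rule Sum_any.expand_superset) (use power_form_schur_mult_support[OF assms] in auto)
  thus ?thesis by (simp add: sum.cartesian_product)
qed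

lemma lin_coproduct: "lin (coproduct B)"
proof -
  have "coproduct B (f + g) = coproduct B f + coproduct B g" for f g
  proof -
    obtain M K where MK: "degree_le M f" "degree_le K g" using ex_degree_le by blast
    have N: "degree_le (max M K) f" "degree_le (max M K) g"
      using MK by (auto intro: degree_le_mono)
    show ?thesis unfolding coproduct_eq[OF N(1)] coproduct_eq[OF N(2)] coproduct_eq[OF degree_le_add[OF N]]
      by (simp add: power_form_add_left sym.scale_left_distrib sum.distrib)
  qed
  moreover have "coproduct B (c *\<^sub>Q f) = c *\<^sub>Q coproduct B f" for c f
  proof -
    obtain N where N: "degree_le N f" using ex_degree_le by blast
    show ?thesis unfolding coproduct_eq[OF N] coproduct_eq[OF degree_le_scale[OF N]]
      by (simp add: power_form_scale_left sym.scale_sum_right)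
  qed
  ultimately show ?thesis by (simp add: lin_def)
qed

lemma lin_sum_fun: "(\<And>i. i \<in> A \<Longrightarrow> lin (F i)) \<Longrightarrow> lin (\<lambda>f. \<Sum>i\<in>A. F i f)"
  by (simp add: lin_def sum.distrib sym.scale_sum_right)

lemma lin_scaled: "lin T \<Longrightarrow> lin (\<lambda>f. c *\<^sub>Q T f)"
  by (simp add: lin_def sym.scale_right_distrib mult.commute)

lemma lin_coproduct_param:
  assumes "\<And>x y. lin (\<lambda>a. B a x y)"
  shows "lin (\<lambda>a. coproduct (B a) f)"
proof -
  obtain N where N: "degree_le N f" using ex_degree_le by blast
  show ?thesis unfolding coproduct_eq[OF N] by (intro lin_sum_fun lin_scaled assms)
qed

lemma coproduct_add: "coproduct B f + coproduct B' f = coproduct (\<lambda>x y. B x y + B' x y) f"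
proof -
  obtain N where N: "degree_le N f" using ex_degree_le by blast
  show ?thesis unfolding coproduct_eq[OF N] by (simp add: sym.scale_right_distrib sum.distrib)
qed

lemma lin_expansion:
  assumes L: "lin L" and N: "degree_le N f"
  shows "(\<Sum>l\<in>Par N. power_form f (schur l) *\<^sub>Q L (schur l)) = L f"
proof -
  have "L f = L (\<Sum>l\<in>Par N. power_form f (schur l) *\<^sub>Q schur l)" by (simp only: schur_expansion[OF N])
  thus ?thesis by (simp add: lin_sum[OF L] lin_scale[OF L])
qed

lemma bilin_expansion:
  assumes B: "bilin B" and X: "degree_le M f" and Y: "degree_le N g"
  shows "(\<Sum>n\<in>Par N. \<Sum>m\<in>Par M. (power_form f (schur m) * power_form g (schur n)) *\<^sub>Q B (schur m) (schur n)) = B f g"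
proof -
  have l: "lin (\<lambda>x. B x y)" "lin (B x)" for x y using B by (auto simp: bilin_def)
  have "(\<Sum>n\<in>Par N. \<Sum>m\<in>Par M. (power_form f (schur m) * power_form g (schur n)) *\<^sub>Q B (schur m) (schur n))
      = (\<Sum>n\<in>Par N. power_form g (schur n) *\<^sub>Q (\<Sum>m\<in>Par M. power_form f (schur m) *\<^sub>Q B (schur m) (schur n)))"
    by (simp add: sym.scale_sum_right mult.commute)
  thus ?thesis by (simp add: lin_expansion[OF l(1) X] lin_expansion[OF l(2) Y])
qed

text \<open>
  The sum over the second tensor factor collapses by orthonormality.
\<close>

lemma coproduct_right:
  assumes "\<And>x. lin (B x)" and N: "degree_le N f"
  shows "coproduct B f = (\<Sum>l\<in>Par N. B (schur l) (D_op (schur l) f))"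
  unfolding coproduct_eq[OF N] D_adjoint[symmetric]
  by (rule sum.cong) (use assms lin_expansion degree_le_D[OF N] in auto)

lemma coproduct_left:
  assumes l: "\<And>y. lin (\<lambda>x. B x y)" and N: "degree_le N f"
  shows "coproduct B f = (\<Sum>n\<in>Par N. B (D_op (schur n) f) (schur n))"
proof -
  have "coproduct B f = (\<Sum>n\<in>Par N. \<Sum>l\<in>Par N. power_form (D_op (schur n) f) (schur l) *\<^sub>Q B (schur l) (schur n))"
    unfolding coproduct_eq[OF N] D_adjoint by (subst sum.swap) (simp add: mult.commute)
  thus ?thesis by (simp add: lin_expansion[OF l degree_le_D[OF N]])
qed

lemma coproduct_1: "bilin B \<Longrightarrow> coproduct B 1 = B 1 1"
proof -
  assume B: "bilin B"
  have "coeff_mono (f * g) {#} = coeff_mono f {#} * coeff_mono g {#}" for f g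
  proof -
    have "{a. a = ({#} :: nat multiset)} = {{#}}" by auto
    thus ?thesis by (simp add: coeff_times)
  qed
  hence m: "power_form 1 (f * g) = power_form 1 f * power_form 1 g" for f g
    by (simp add: power_form_commute[of 1] power_form_1)
  show ?thesis unfolding coproduct_eq[OF degree_le_1[of 0]] m
    by (subst sum.swap) (rule bilin_expansion[OF B degree_le_1 degree_le_1])
qed

text \<open>
  The power sums are primitive: \<open>\<Delta>(p\<^sub>n f) = (p\<^sub>n \<otimes> 1 + 1 \<otimes> p\<^sub>n) \<Delta> f\<close>. This is dual to the Leibniz
  rule for the adjoint of multiplication by \<open>p\<^sub>n\<close>.
\<close>

lemma coproduct_power_sum:
  assumes n: "n > 0" and B: "bilin B"
  shows "coproduct B (power_sum n * f) = coproduct (\<lambda>x y. B (power_sum n * x) y) f + coproduct (\<lambda>x y. B x (power_sum n * y)) f"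
proof -
  have l: "lin (\<lambda>x. B x y)" "lin (B x)" for x y using B by (auto simp: bilin_def)
  have l1: "lin (\<lambda>x. B (power_sum n * x) y)" for y
    by (rule lin_comp[OF l(1)]) (rule lin_mult_right[OF lin_id])
  have l2: "lin (\<lambda>y. B x (power_sum n * y))" for x
    by (rule lin_comp[OF l(2)]) (rule lin_mult_right[OF lin_id])
  obtain M where M: "degree_le M f" using ex_degree_le by blast
  define N where "N = n + M"
  have p: "degree_le N (power_sum n * g)" if "degree_le M g" for g
    unfolding N_def using degree_le_homog[OF homog_power_sum] that by (intro degree_le_mult) auto
  have Nf: "degree_le N f" using M by (auto simp: N_def intro: degree_le_mono)
  have e1: "(\<Sum>k\<in>Par N. power_form (power_sum n * D_op (schur m) f) (schur k) *\<^sub>Q B (schur k) (schur m))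
      = B (power_sum n * D_op (schur m) f) (schur m)" for m
    by (rule lin_expansion[OF l(1) p[OF degree_le_D[OF M]]])
  have e2: "(\<Sum>m\<in>Par N. power_form (power_sum n * D_op (schur k) f) (schur m) *\<^sub>Q B (schur k) (schur m))
      = B (schur k) (power_sum n * D_op (schur k) f)" for k
    by (rule lin_expansion[OF l(2) p[OF degree_le_D[OF M]]])
  have i1: "power_form f (p_deriv n x * y) = power_form (power_sum n * D_op y f) x" for x y
    by (simp add: p_deriv_adjoint[OF n] D_adjoint mult.commute)
  have "power_form (power_sum n * f) (x * y) = power_form (power_sum n * D_op y f) x + power_form (power_sum n * D_op x f) y" for x y
    unfolding i1[of x y, symmetric] i1[of y x, symmetric] p_deriv_adjoint[OF n, of f "x * y"] p_deriv_mult power_form_add_right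
    by (simp only: mult.commute[of x "p_deriv n y"])
  hence "coproduct B (power_sum n * f)
    = (\<Sum>k\<in>Par N. \<Sum>m\<in>Par N. power_form (power_sum n * D_op (schur m) f) (schur k) *\<^sub>Q B (schur k) (schur m))
    + (\<Sum>k\<in>Par N. \<Sum>m\<in>Par N. power_form (power_sum n * D_op (schur k) f) (schur m) *\<^sub>Q B (schur k) (schur m))"
    unfolding coproduct_eq[OF p[OF M]] by (simp add: sym.scale_left_distrib sum.distrib)
  also have "\<dots> = (\<Sum>m\<in>Par N. B (power_sum n * D_op (schur m) f) (schur m))
     + (\<Sum>k\<in>Par N. B (schur k) (power_sum n * D_op (schur k) f))"
    by (subst sum.swap) (simp only: e1 e2)
  finally show ?thesis unfolding coproduct_left[OF l1 Nf] coproduct_right[OF l2 Nf] .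
qed

lemma lin_mult1: "lin (\<lambda>f. f * g)" and lin_mult2: "lin (\<lambda>g. f * g)"
  by (rule lin_mult_left[OF lin_id], rule lin_mult_right[OF lin_id])

lemma D_power_sum_mult: "n > 0 \<Longrightarrow> D_op (power_sum n * x) a = D_op x (p_deriv n a)"
  by (subst mult.commute) (simp add: D_mult D_power_sum)

lemma bilin_D_D: "bilin (\<lambda>x y. D_op x a * D_op y g)"
  by (simp add: bilin_def lin_mult_left[OF lin_D_left] lin_mult_right[OF lin_D_left])

text \<open>
  The Leibniz rule for \<open>D(p\<^sub>n)\<close>, propagated to all of \<open>Sym\<close> by primitivity of \<open>p\<^sub>n\<close>.
\<close>

lemma D_product: "D_op f (a * g) = coproduct (\<lambda>x y. D_op x a * D_op y g) f"
proof (induction f arbitrary: a g rule: sym_mult_induct)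
  case one
  show ?case by (simp add: coproduct_1[OF bilin_D_D] D_1)
next
  case (power_sum n f)
  thus ?case by (simp add: coproduct_power_sum[OF _ bilin_D_D] D_power_sum_mult p_deriv_mult lin_add[OF lin_D])
qed (simp_all add: lin_add[OF lin_D_left] lin_scale[OF lin_D_left] lin_add[OF lin_coproduct] lin_scale[OF lin_coproduct])

text \<open>
  For \<open>p\<^sub>n f\<close> the two terms from primitivity of \<open>p\<^sub>n\<close> cancel because \<open>S(p\<^sub>n) = - p\<^sub>n\<close>.
\<close>

lemma antipode_convolution: "coproduct (\<lambda>x y. x * antipode y) f = power_form f 1 *\<^sub>Q 1"
proof -
  have B: "bilin (\<lambda>x y. x * antipode y)"
    by (simp add: bilin_def lin_mult1 lin_mult_right[OF alg_hom_lin[OF alg_hom_antipode]])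
  show ?thesis
  proof (induction f rule: sym_mult_induct)
    case one
    show ?case by (simp add: coproduct_1[OF B] hom_simps power_form_1 one_sym.rep_eq)
  next
    case (power_sum n f)
    have "coproduct (\<lambda>x y. x * antipode y) (power_sum n * f)
        = coproduct (\<lambda>x y. power_sum n * x * antipode y + x * antipode (power_sum n * y)) f"
      by (simp add: coproduct_power_sum[OF power_sum(1) B] coproduct_add)
    also have "(\<lambda>x y. power_sum n * x * antipode y + x * antipode (power_sum n * y)) = (\<lambda>x y. 0)"
      using power_sum(1) by (simp add: hom_simps fun_eq_iff algebra_simps)
    also have "coproduct (\<lambda>x y. 0) f = 0" by (simp add: coproduct_def)
    finally show ?case using p_deriv_adjoint[OF power_sum(1), of f 1] by (simp add: p_deriv_1)
  qed (simp_all add: lin_add[OF lin_coproduct] lin_scale[OF lin_coproduct] power_form_add_left power_form_scale_left sym.scale_left_distrib)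
qed

text \<open>
  The coproduct is dual to the product.
\<close>

lemma double_parseval:
  assumes N: "degree_le N f"
  shows "(\<Sum>l\<in>Par N. \<Sum>n\<in>Par N. power_form f (schur l * schur n) * (power_form (schur l) x * power_form (schur n) y)) = power_form f (x * y)"
proof -
  have "(\<Sum>l\<in>Par N. \<Sum>n\<in>Par N. power_form f (schur l * schur n) * (power_form (schur l) x * power_form (schur n) y))
      = (\<Sum>l\<in>Par N. power_form (schur l) x * (\<Sum>n\<in>Par N. power_form (D_op (schur l) f) (schur n) * power_form y (schur n)))"
    by (simp add: D_adjoint sum_distrib_left mult_ac power_form_commute[of y])
  also have "\<dots> = (\<Sum>l\<in>Par N. power_form (D_op y f) (schur l) * power_form x (schur l))"
    using parseval[OF disjI1[OF degree_le_D[OF N]]]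
    by (simp add: D_adjoint mult.commute power_form_commute[of x])
  also have "\<dots> = power_form (D_op y f) x"
    by (rule parseval[OF disjI1[OF degree_le_D[OF N]]])
  finally show ?thesis by (simp add: D_adjoint mult.commute)
qed

lemma bilin_lin_eqI:
  assumes "\<And>g. lin (\<lambda>a. S a g)" "\<And>a. lin (S a)" "\<And>g. lin (\<lambda>a. T a g)" "\<And>a. lin (T a)"
    and "\<And>M K. 0 \<notin># M \<Longrightarrow> 0 \<notin># K \<Longrightarrow> S (p_mon M) (p_mon K) = T (p_mon M) (p_mon K)"
  shows "S a g = T a g"
proof -
  have "S (p_mon M) g = T (p_mon M) g" if "0 \<notin># M" for M
    by (rule lin_eqI) (use assms that in auto)
  thus ?thesis using lin_eqI[OF assms(1) assms(3)] by blast
qed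

text \<open>
  If \<open>a\<close> and \<open>g\<close> are products of power sums, all Kronecker products are scalar multiples of \<open>a\<close>, \<open>g\<close>
  and \<open>a g\<close>, and the claim is the duality of product and coproduct.
\<close>

lemma kronecker_product: "kronecker f (a * g) = coproduct (\<lambda>x y. kronecker x a * kronecker y g) f"
proof (rule bilin_lin_eqI[where S = "\<lambda>a g. kronecker f (a * g)" and T = "\<lambda>a g. coproduct (\<lambda>x y. kronecker x a * kronecker y g) f"])
  show "lin (\<lambda>a. coproduct (\<lambda>x y. kronecker x a * kronecker y g) f)" for g
    by (rule lin_coproduct_param) (rule lin_mult_left[OF lin_kronecker])
  show "lin (\<lambda>g. coproduct (\<lambda>x y. kronecker x a * kronecker y g) f)" for a
    by (rule lin_coproduct_param) (rule lin_mult_right[OF lin_kronecker])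
  show "lin (\<lambda>a. kronecker f (a * g))" for g
    by (rule lin_comp[OF lin_kronecker lin_mult1])
  show "lin (\<lambda>g. kronecker f (a * g))" for a
    by (rule lin_comp[OF lin_kronecker lin_mult2])
  fix M K :: "nat multiset" assume MK: "0 \<notin># M" "0 \<notin># K"
  obtain N where N: "degree_le N f" using ex_degree_le by blast
  have "coproduct (\<lambda>x y. kronecker x (p_mon M) * kronecker y (p_mon K)) f
      = (\<Sum>l\<in>Par N. \<Sum>n\<in>Par N. power_form f (schur l * schur n) *
          (power_form (schur l) (p_mon M) * power_form (schur n) (p_mon K))) *\<^sub>Q (p_mon M * p_mon K)"
    unfolding coproduct_eq[OF N] 
    by (simp add: kronecker_p_mon MK scale_mult_left scale_mult_right sym.scale_sum_left mult_ac)
  also have "\<dots> = kronecker f (p_mon M * p_mon K)"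
    using kronecker_p_mon[of "M + K" f] MK by (simp add: double_parseval[OF N] p_mon_union)
  finally show "kronecker f (p_mon M * p_mon K) = coproduct (\<lambda>x y. kronecker x (p_mon M) * kronecker y (p_mon K)) f" ..
qed

text \<open>
  An operator that is diagonal in an orthogonal basis is self-adjoint.
\<close>

lemma power_form_diagonal:
  assumes T: "lin T" and diag: "\<And>M. 0 \<notin># M \<Longrightarrow> T (p_mon M) = c M *\<^sub>Q p_mon M"
  shows "power_form (T g) h = power_form g (T h)"
proof -
  have 1: "power_form (T (p_mon M)) (p_mon K) = power_form (p_mon M) (T (p_mon K))" if "0 \<notin># M" "0 \<notin># K" for M K
    using that by (simp add: diag power_form_scale_left power_form_scale_right power_form_p_mon_p_mon)
  have 2: "power_form (T (p_mon M)) h = power_form (p_mon M) (T h)" if "0 \<notin># M" for M h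
    by (induction h rule: sym_linear_induct)
       (use 1 that in \<open>auto simp: lin_add[OF T] lin_scale[OF T] power_form_add_right power_form_scale_right\<close>)
  show ?thesis
    by (induction g rule: sym_linear_induct)
       (use 2 in \<open>auto simp: lin_add[OF T] lin_scale[OF T] power_form_add_left power_form_scale_left\<close>)
qed

lemma kronecker_adjoint: "power_form (kronecker f g) h = power_form g (kronecker f h)"
  by (rule power_form_diagonal[OF lin_kronecker]) (rule kronecker_p_mon)

lemma degree_le_kronecker: "degree_le N f \<Longrightarrow> degree_le N (kronecker f g)"
proof -
  assume N: "degree_le N f"
  have "{la. psym_coeff f la \<noteq> 0} \<subseteq> Par N"
    using psym_coeff_degree_le[OF N] by (auto simp: Par_def not_less[symmetric])
  hence "kronecker f g = (\<Sum>la\<in>Par N. (psym_coeff f la * psym_coeff g la * zee la) *\<^sub>Q psym la)"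
    by (intro kronecker_superset) auto
  moreover have "degree_le N (psym la)" if "la \<in> Par N" for la
    using that degree_le_homog[OF homog_psym] by (auto simp: Par_def)
  ultimately show ?thesis by (auto intro!: degree_le_sum degree_le_scale)
qed

section \<open>The operators \<open>Kbar\<close>\<close>

lemma Kbar_eq:
  assumes "degree_le N g"
  shows "Kbar la g = (\<Sum>n\<le>N. kronecker (schur_seq ((int n - int (psize la)) # map int (parts la))) (hom_component n g))"
  unfolding Kbar_def
proof (rule Sum_any.expand_superset)
  have "hom_component n g = 0" if "n > N" for n
    using assms that by (intro sym_eqI) (force simp: coeff_simps degree_le_def)
  thus "{n. kronecker (schur_seq ((int n - int (psize la)) # map int (parts la))) (hom_component n g) \<noteq> 0} \<subseteq> {..N}"
    using lin_0[OF lin_kronecker] by (auto simp: not_less[symmetric])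
qed simp

lemma lin_hom_component: "lin (hom_component n)"
  unfolding lin_def by (auto intro!: sym_eqI simp: coeff_simps)

lemma lin_Kbar: "lin (Kbar la)"
proof -
  have "Kbar la (f + g) = Kbar la f + Kbar la g" for f g
  proof -
    obtain M K where MK: "degree_le M f" "degree_le K g" using ex_degree_le by blast
    have N: "degree_le (max M K) f" "degree_le (max M K) g"
      using MK by (auto intro: degree_le_mono)
    show ?thesis unfolding Kbar_eq[OF N(1)] Kbar_eq[OF N(2)] Kbar_eq[OF degree_le_add[OF N]]
      by (simp add: lin_add[OF lin_hom_component] lin_add[OF lin_kronecker] sum.distrib)
  qed
  moreover have "Kbar la (c *\<^sub>Q f) = c *\<^sub>Q Kbar la f" for c f
  proof -
    obtain N where N: "degree_le N f" using ex_degree_le by blast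
    show ?thesis unfolding Kbar_eq[OF N] Kbar_eq[OF degree_le_scale[OF N]]
      by (simp add: lin_scale[OF lin_hom_component] lin_scale[OF lin_kronecker] sym.scale_sum_right)
  qed
  ultimately show ?thesis by (simp add: lin_def)
qed

text \<open>
  Expanding the Jacobi--Trudi determinant of \<open>(n - |\<lambda>|, \<lambda>)\<close> along its first row shows that it
  pairs with a function of degree \<open>n\<close> like the product of \<open>\<psi>(s\<^sub>\<lambda>)\<close> with the series of all \<open>h\<^sub>m\<close>. The first entry may
  be any integer here.
\<close>

lemma Kbar_p_mon:
  assumes M: "0 \<notin># M"
  shows "Kbar la (p_mon M) = power_form (remove_one (schur la)) (adjoin_one (p_mon M)) *\<^sub>Q p_mon M"
proof -
  let ?n = "sum_mset M" and ?xs = "map int (parts la)"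
  let ?w = "\<lambda>n. schur_seq ((int n - int (psize la)) # ?xs)"
  have h: "homog (int ?n) (p_mon M)" by (rule homog_p_mon)
  have hc: "hom_component n (p_mon M) = (if n = ?n then p_mon M else 0)" for n
    unfolding hom_component_homog[OF h] of_nat_eq_iff by auto
  have "Kbar la (p_mon M) = (\<Sum>n\<le>?n. if n = ?n then kronecker (?w n) (p_mon M) else 0)"
    unfolding Kbar_eq[OF degree_le_p_mon]
    by (rule sum.cong) (auto simp: hc lin_0[OF lin_kronecker])
  also have "\<dots> = power_form (?w ?n) (p_mon M) *\<^sub>Q p_mon M" by (simp add: kronecker_p_mon[OF M])
  also have "power_form (?w ?n) (p_mon M) = (\<Sum>j\<le>length ?xs. power_form (row_cofactor ?xs j) (adjoin_one (p_mon M)))"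
    unfolding schur_seq_Cons power_form_sum_left
  proof (rule sum.cong)
    fix j assume "j \<in> {..length ?xs}"
    hence C: "homog (sum_list ?xs - int j) (row_cofactor ?xs j)" by (intro homog_row_cofactor) simp
    have "int ?n - (sum_list ?xs - int j) = int ?n - int (psize la) + int j"
      by (simp add: sum_list_map_int psize_def)
    from power_form_hsym_mult[OF C h, unfolded this]
    show "power_form (hsym (int ?n - int (psize la) + int j) * row_cofactor ?xs j) (p_mon M)
        = power_form (row_cofactor ?xs j) (adjoin_one (p_mon M))" .
  qed simp
  also have "\<dots> = power_form (remove_one (schur la)) (adjoin_one (p_mon M))"
    by (simp add: schur_def remove_one_schur_seq power_form_sum_left)
  finally show ?thesis .
qed

lemma Kbar_adjoint: "power_form (Kbar la g) h = power_form g (Kbar la h)"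
  by (rule power_form_diagonal[OF lin_Kbar]) (rule Kbar_p_mon)

lemma power_form_1_adjoin_one_p_mon: "0 \<notin># M \<Longrightarrow> power_form 1 (adjoin_one (p_mon M)) = 1"
proof (induction M)
  case (add n M)
  have "power_form 1 (power_sum n * adjoin_one (p_mon M)) = 0"
    using p_deriv_adjoint[of n "adjoin_one (p_mon M)" 1] add.prems by (simp add: p_deriv_1 power_form_commute)
  thus ?case using add by (simp add: hom_simps distrib_right power_form_add_right)
qed (simp add: hom_simps power_form_1 one_sym.rep_eq)

text \<open>
  The series of all \<open>h\<^sub>m\<close> is the unit of the Kronecker product.
\<close>

lemma kronecker_h_sum:
  assumes "degree_le N g"
  shows "kronecker g (h_sum N) = g"
proof -
  have 1: "kronecker (h_sum N) (psym la) = psym la" if "la \<in> Par N" for la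
  proof -
    have d: "degree_le N (psym la)" using that degree_le_homog[OF homog_psym] by (simp add: Par_def)
    have "power_form (h_sum N * 1) (psym la) = 1"
      unfolding adjoin_one_adjoint[OF d] using power_form_1_adjoin_one_p_mon[OF part_mset_pos] by (simp add: psym_eq)
    thus ?thesis by (simp add: kronecker_psym)
  qed
  have "kronecker (h_sum N) g = (\<Sum>la\<in>Par N. psym_coeff g la *\<^sub>Q kronecker (h_sum N) (psym la))"
    by (subst degree_le_expansion[OF assms]) (simp add: lin_sum[OF lin_kronecker] lin_scale[OF lin_kronecker])
  also have "\<dots> = g"
    by (subst (2) degree_le_expansion[OF assms]) (auto simp: 1 intro!: sum.cong)
  finally show ?thesis by (simp add: kronecker_commute)
qed

text \<open>
  The map \<open>a \<mapsto> \<Sum> (f * x) y\<close> over the terms \<open>x \<otimes> y\<close> of \<open>\<Delta> a\<close>. Its matrix entries are the sums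
  over \<open>\<sigma>, \<tau>, \<theta>\<close> in the last two identities.
\<close>

definition kron_induced :: "sym \<Rightarrow> sym \<Rightarrow> sym" where
  "kron_induced f = coproduct (\<lambda>x y. kronecker f x * y)"

lemma lin_kron_induced: "lin (kron_induced f)"
  by (simp add: kron_induced_def lin_coproduct)

text \<open>
  As the series \<open>H\<close> of all \<open>h\<^sub>m\<close> is the unit of the Kronecker product,
  \<open>\<Sum> (f * x) y = \<Sum> (f * x) (H * y) = (f H) * a\<close>, and multiplication by \<open>H\<close> is adjoint to
  \<open>\<phi>\<close>.
\<close>

lemma kron_induced_p_mon:
  assumes M: "0 \<notin># M"
  shows "kron_induced f (p_mon M) = power_form f (adjoin_one (p_mon M)) *\<^sub>Q p_mon M"
proof -
  let ?N = "sum_mset M"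
  have N: "degree_le ?N (p_mon M)" by (rule degree_le_p_mon)
  have "kron_induced f (p_mon M) = coproduct (\<lambda>x y. kronecker x f * kronecker y (h_sum ?N)) (p_mon M)"
    unfolding kron_induced_def coproduct_eq[OF N]
  proof (intro sum.cong refl)
    fix l n assume "n \<in> Par ?N"
    hence "kronecker (schur n) (h_sum ?N) = schur n"
      using degree_le_homog[OF homog_schur] by (intro kronecker_h_sum) (simp add: Par_def)
    thus "power_form (p_mon M) (schur l * schur n) *\<^sub>Q (kronecker f (schur l) * schur n)
      = power_form (p_mon M) (schur l * schur n) *\<^sub>Q (kronecker (schur l) f * kronecker (schur n) (h_sum ?N))"
      by (simp add: kronecker_commute)
  qed
  also have "\<dots> = kronecker (p_mon M) (f * h_sum ?N)" by (rule kronecker_product[symmetric])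
  also have "\<dots> = kronecker (h_sum ?N * f) (p_mon M)" by (simp add: kronecker_commute mult.commute)
  also have "\<dots> = power_form f (adjoin_one (p_mon M)) *\<^sub>Q p_mon M" by (simp add: kronecker_p_mon[OF M] adjoin_one_adjoint[OF N])
  finally show ?thesis .
qed

text \<open>
  Duality of product and coproduct, combined with the fact that \<open>\<psi>\<close> commutes with \<open>D\<^sub>a\<close>.
\<close>

lemma remove_one_double_parseval:
  assumes N: "degree_le N f"
  shows "(\<Sum>n\<in>Par N. \<Sum>l\<in>Par N. power_form f (schur l * schur n) * (power_form (schur l) a * power_form (remove_one (schur n)) g))
    = power_form (remove_one f) (a * g)"
proof -
  note DN = degree_le_D[OF N]
  have "(\<Sum>l\<in>Par N. power_form f (schur l * schur n) * power_form (schur l) a) = power_form (D_op a f) (schur n)" for n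
    using parseval[OF disjI1[OF DN], of "schur n" a]
    by (simp add: D_adjoint power_form_commute[of a] mult.commute)
  hence "(\<Sum>n\<in>Par N. \<Sum>l\<in>Par N. power_form f (schur l * schur n) * (power_form (schur l) a * power_form (remove_one (schur n)) g))
      = (\<Sum>n\<in>Par N. power_form (D_op a f) (schur n) * power_form (remove_one (schur n)) g)"
    by (simp add: mult.assoc[symmetric] sum_distrib_right[symmetric])
  also have "\<dots> = power_form (\<Sum>n\<in>Par N. power_form (D_op a f) (schur n) *\<^sub>Q remove_one (schur n)) g"
    by (simp add: power_form_sum_left power_form_scale_left)
  also have "\<dots> = power_form (remove_one (D_op a f)) g"
    by (simp only: lin_expansion[OF alg_hom_lin[OF alg_hom_remove_one] DN])
  finally show ?thesis by (simp add: remove_one_D D_adjoint)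
qed

text \<open>
  On products of power sums both sides are scalar multiples of \<open>a g\<close>, and the scalars agree because
  \<open>\<phi>(a g) = \<phi>(a) \<phi>(g)\<close>.
\<close>

lemma Kbar_product:
  assumes N: "degree_le N (schur \<beta>)"
  shows "Kbar \<beta> (a * g) = (\<Sum>n\<in>Par N. \<Sum>l\<in>Par N.
     power_form (schur \<beta>) (schur l * schur n) *\<^sub>Q (kron_induced (schur l) a * Kbar n g))"
proof (rule bilin_lin_eqI[where S = "\<lambda>a g. Kbar \<beta> (a * g)" and T = "\<lambda>a g. \<Sum>n\<in>Par N. \<Sum>l\<in>Par N.
     power_form (schur \<beta>) (schur l * schur n) *\<^sub>Q (kron_induced (schur l) a * Kbar n g)"])
  show "lin (\<lambda>a. \<Sum>n\<in>Par N. \<Sum>l\<in>Par N.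
     power_form (schur \<beta>) (schur l * schur n) *\<^sub>Q (kron_induced (schur l) a * Kbar n g))" for g
    by (intro lin_sum_fun lin_scaled lin_mult_left lin_kron_induced)
  show "lin (\<lambda>g. \<Sum>n\<in>Par N. \<Sum>l\<in>Par N.
     power_form (schur \<beta>) (schur l * schur n) *\<^sub>Q (kron_induced (schur l) a * Kbar n g))" for a
    by (intro lin_sum_fun lin_scaled lin_mult_right lin_Kbar)
  show "lin (\<lambda>a. Kbar \<beta> (a * g))" for g
    by (rule lin_comp[OF lin_Kbar lin_mult1])
  show "lin (\<lambda>g. Kbar \<beta> (a * g))" for a
    by (rule lin_comp[OF lin_Kbar lin_mult2])
  fix M K :: "nat multiset" assume MK: "0 \<notin># M" "0 \<notin># K"
  have "(\<Sum>n\<in>Par N. \<Sum>l\<in>Par N. power_form (schur \<beta>) (schur l * schur n) *\<^sub>Q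
        (kron_induced (schur l) (p_mon M) * Kbar n (p_mon K)))
    = (\<Sum>n\<in>Par N. \<Sum>l\<in>Par N. power_form (schur \<beta>) (schur l * schur n) *
        (power_form (schur l) (adjoin_one (p_mon M)) * power_form (remove_one (schur n)) (adjoin_one (p_mon K)))) *\<^sub>Q (p_mon M * p_mon K)"
    by (simp add: kron_induced_p_mon Kbar_p_mon MK scale_mult_left scale_mult_right sym.scale_sum_left mult_ac)
  also have "\<dots> = power_form (remove_one (schur \<beta>)) (adjoin_one (p_mon M * p_mon K)) *\<^sub>Q (p_mon M * p_mon K)"
    by (simp add: remove_one_double_parseval[OF N] hom_simps)
  also have "\<dots> = Kbar \<beta> (p_mon M * p_mon K)"
    using Kbar_p_mon[of "M + K" \<beta>] MK by (simp add: p_mon_union)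
  finally show "Kbar \<beta> (p_mon M * p_mon K) = (\<Sum>n\<in>Par N. \<Sum>l\<in>Par N.
     power_form (schur \<beta>) (schur l * schur n) *\<^sub>Q (kron_induced (schur l) (p_mon M) * Kbar n (p_mon K)))" ..
qed

section \<open>The identities\<close>

lemma LR_eq: "LR \<nu> la \<mu> = power_form (schur \<nu>) (schur la * schur \<mu>)"
  by (simp add: LR_def schur_coeff_eq power_form_commute)

lemma kron_coeff_eq: "kron_coeff la \<mu> \<nu> = power_form (kronecker (schur la) (schur \<mu>)) (schur \<nu>)"
  by (simp add: kron_coeff_def schur_coeff_eq)

lemma degree_le_schur: "psize la \<le> N \<Longrightarrow> degree_le N (schur la)"
  by (rule degree_le_homog[OF homog_schur])

lemma degree_le_schur_Par: "la \<in> Par N \<Longrightarrow> degree_le N (schur la)"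
  by (rule degree_le_schur) (simp add: Par_def)

lemma LR_support: "psize \<nu> \<le> N \<Longrightarrow> LR \<nu> la \<mu> \<noteq> 0 \<Longrightarrow> la \<in> Par N \<and> \<mu> \<in> Par N"
  unfolding LR_eq by (rule power_form_schur_mult_support[OF degree_le_schur])

lemma Sum_any_nonzeroE: "Sum_any f \<noteq> 0 \<Longrightarrow> \<exists>t. f t \<noteq> 0"
  by (rule ccontr) simp

lemma op_sum_eq:
  assumes fin: "finite A" "finite B"
    and supp: "\<And>\<mu> \<nu>. c \<mu> \<nu> \<noteq> 0 \<Longrightarrow> \<mu> \<in> A \<and> \<nu> \<in> B"
  shows "op_sum c T g = (\<Sum>\<nu>\<in>B. \<Sum>\<mu>\<in>A. c \<mu> \<nu> *\<^sub>Q T \<mu> \<nu> g)"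
proof -
  have "op_sum c T g = (\<Sum>(\<mu>, \<nu>)\<in>A \<times> B. c \<mu> \<nu> *\<^sub>Q T \<mu> \<nu> g)"
    unfolding op_sum_def by (rule Sum_any.expand_superset) (use fin supp in auto)
  also have "\<dots> = (\<Sum>\<mu>\<in>A. \<Sum>\<nu>\<in>B. c \<mu> \<nu> *\<^sub>Q T \<mu> \<nu> g)"
    by (simp add: sum.cartesian_product)
  finally show ?thesis by (subst sum.swap)
qed

text \<open>
  Infinite sums over partitions are defined to be zero if their support is infinite, so they are replaced by
  finite sums over explicit sets as soon as the coefficients are known to vanish outside.
\<close>

lemma op_sum_Sum_any_eq:
  assumes fin: "finite A" "finite B" "finite L"
    and supp: "\<And>t \<mu> \<nu>. F t \<mu> \<nu> \<noteq> 0 \<Longrightarrow> t \<in> L \<and> \<mu> \<in> A \<and> \<nu> \<in> B"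
  shows "op_sum (\<lambda>\<mu> \<nu>. Sum_any (\<lambda>t. F t \<mu> \<nu>)) T g
    = (\<Sum>\<nu>\<in>B. \<Sum>t\<in>L. \<Sum>\<mu>\<in>A. F t \<mu> \<nu> *\<^sub>Q T \<mu> \<nu> g)"
proof -
  have s: "Sum_any (\<lambda>t. F t \<mu> \<nu>) = (\<Sum>t\<in>L. F t \<mu> \<nu>)" for \<mu> \<nu>
    by (rule Sum_any.expand_superset) (use fin supp in auto)
  have "op_sum (\<lambda>\<mu> \<nu>. Sum_any (\<lambda>t. F t \<mu> \<nu>)) T g
    = (\<Sum>\<nu>\<in>B. \<Sum>\<mu>\<in>A. Sum_any (\<lambda>t. F t \<mu> \<nu>) *\<^sub>Q T \<mu> \<nu> g)"
    by (rule op_sum_eq) (use fin supp Sum_any_nonzeroE in blast)+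
  also have "\<dots> = (\<Sum>\<nu>\<in>B. \<Sum>\<mu>\<in>A. \<Sum>t\<in>L. F t \<mu> \<nu> *\<^sub>Q T \<mu> \<nu> g)"
    by (simp add: s sym.scale_sum_left)
  also have "\<dots> = (\<Sum>\<nu>\<in>B. \<Sum>t\<in>L. \<Sum>\<mu>\<in>A. F t \<mu> \<nu> *\<^sub>Q T \<mu> \<nu> g)"
    by (rule sum.cong[OF refl]) (rule sum.swap)
  finally show ?thesis .
qed

lemma op_sum_adjoint:
  assumes fin: "finite A" "finite B" "\<And>\<mu> \<nu>. c \<mu> \<nu> \<noteq> 0 \<Longrightarrow> \<mu> \<in> A \<and> \<nu> \<in> B"
    and adj: "\<And>\<mu> \<nu>. power_form (T \<mu> \<nu> g) h = power_form g (T' \<mu> \<nu> h)"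
  shows "power_form (op_sum c T g) h = power_form g (op_sum c T' h)"
proof -
  have "op_sum c S f = (\<Sum>\<nu>\<in>B. \<Sum>\<mu>\<in>A. c \<mu> \<nu> *\<^sub>Q S \<mu> \<nu> f)" for S f
    by (rule op_sum_eq) (use fin in auto)
  thus ?thesis by (simp add: power_form_sum_left power_form_sum_right power_form_scale_left power_form_scale_right adj)
qed

lemma bilin_mult_comp: "lin S \<Longrightarrow> lin T \<Longrightarrow> bilin (\<lambda>x y. S x * T y)"
  by (simp add: bilin_def lin_mult_left lin_mult_right)

lemma D_U: "D \<beta> \<circ> U \<alpha> = op_sum (\<lambda>\<mu> \<nu>. Sum_any (\<lambda>l. LR \<alpha> l \<mu> * LR \<beta> l \<nu>)) (\<lambda>\<mu> \<nu>. U \<mu> \<circ> D \<nu>)"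
proof
  fix g
  define N where "N = psize \<alpha> + psize \<beta>"
  have N: "degree_le N (schur \<alpha>)" "degree_le N (schur \<beta>)"
    by (auto intro!: degree_le_schur simp: N_def)
  have "op_sum (\<lambda>\<mu> \<nu>. Sum_any (\<lambda>l. LR \<alpha> l \<mu> * LR \<beta> l \<nu>)) (\<lambda>\<mu> \<nu>. U \<mu> \<circ> D \<nu>) g
      = (\<Sum>\<nu>\<in>Par N. \<Sum>l\<in>Par N. \<Sum>\<mu>\<in>Par N. (LR \<alpha> l \<mu> * LR \<beta> l \<nu>) *\<^sub>Q (U \<mu> \<circ> D \<nu>) g)"
    by (rule op_sum_Sum_any_eq) (use LR_support[of \<alpha> N] LR_support[of \<beta> N] in \<open>auto simp: N_def\<close>)
  also have "\<dots> = (\<Sum>l\<in>Par N. \<Sum>\<nu>\<in>Par N. \<Sum>\<mu>\<in>Par N.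
      (power_form (D_op (schur l) (schur \<alpha>)) (schur \<mu>) * power_form (D_op (schur l) (schur \<beta>)) (schur \<nu>))
        *\<^sub>Q (schur \<mu> * D_op (schur \<nu>) g))"
    by (subst sum.swap) (simp add: LR_eq D_adjoint U_op_def)
  also have "\<dots> = (\<Sum>l\<in>Par N. D_op (schur l) (schur \<alpha>) * D_op (D_op (schur l) (schur \<beta>)) g)"
    by (rule sum.cong[OF refl], rule bilin_expansion[OF bilin_mult_comp[OF lin_id lin_D_left]])
       (intro degree_le_D N)+
  also have "\<dots> = coproduct (\<lambda>x y. D_op x (schur \<alpha>) * D_op y g) (schur \<beta>)"
    by (rule coproduct_right[symmetric]) (intro lin_mult_right lin_D_left N)+
  also have "\<dots> = (D \<beta> \<circ> U \<alpha>) g"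
    by (simp add: D_product U_op_def)
  finally show "(D \<beta> \<circ> U \<alpha>) g
     = op_sum (\<lambda>\<mu> \<nu>. Sum_any (\<lambda>l. LR \<alpha> l \<mu> * LR \<beta> l \<nu>)) (\<lambda>\<mu> \<nu>. U \<mu> \<circ> D \<nu>) g" ..
qed

text \<open>
  The function \<open>x\<close> may have any degree, since \<open>D\<close> of a Schur function of degree above \<open>N\<close> kills \<open>a\<close>.
\<close>

lemma D_expansion:
  assumes N: "degree_le N a"
  shows "(\<Sum>r\<in>Par N. power_form x (schur r) *\<^sub>Q D_op (schur r) a) = D_op x a"
proof -
  obtain M where M: "degree_le M x" using ex_degree_le by blast
  have M': "degree_le (max M N) x" using M by (auto intro: degree_le_mono)
  have "D_op x a = (\<Sum>r\<in>Par (max M N). power_form x (schur r) *\<^sub>Q D_op (schur r) a)"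
    by (rule lin_expansion[OF lin_D_left M', symmetric])
  also have "\<dots> = (\<Sum>r\<in>Par N. power_form x (schur r) *\<^sub>Q D_op (schur r) a)"
    by (rule sum.mono_neutral_right)
       (use D_schur_high[OF N] finite_Par in \<open>auto simp: Par_def simp del: finite_Par\<close>)
  finally show ?thesis ..
qed

text \<open>
  By \<open>D_product\<close> the right-hand side is the sum of
  \<open>D(s\<^sub>k s\<^sub>l) s\<^sub>\<alpha> \<cdot> D(D(s\<^sub>k S(s\<^sub>l)) s\<^sub>\<beta>) g\<close> over all \<open>k\<close> and \<open>l\<close>. Expanding \<open>s\<^sub>k s\<^sub>l\<close> in Schur functions
  \<open>s\<^sub>r\<close> makes the second factor depend on \<open>\<Sum> x S(y)\<close> over the terms \<open>x \<otimes> y\<close> of \<open>\<Delta> s\<^sub>r\<close>, which vanishes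
  unless \<open>r\<close> is the empty partition.
\<close>

lemma U_D: "U \<alpha> \<circ> D \<beta> =
    op_sum (\<lambda>\<mu> \<nu>. Sum_any (\<lambda>l. (- 1) ^ psize l * LR \<alpha> l \<mu> * LR \<beta> (conj_partition l) \<nu>))
      (\<lambda>\<mu> \<nu>. D \<nu> \<circ> U \<mu>)"
proof
  fix g
  define a b where "a = schur \<alpha>" and "b = schur \<beta>"
  define N where "N = psize \<alpha> + psize \<beta>"
  have N: "degree_le N a" "degree_le N b"
    by (auto intro!: degree_le_schur simp: N_def a_def b_def)
  define M where "M y = D_op (D_op y b) g" for y
  have lM: "lin M" unfolding M_def by (rule lin_comp[OF lin_D_left lin_D_left])
  have "op_sum (\<lambda>\<mu> \<nu>. Sum_any (\<lambda>l. (- 1) ^ psize l * LR \<alpha> l \<mu> * LR \<beta> (conj_partition l) \<nu>))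
      (\<lambda>\<mu> \<nu>. D \<nu> \<circ> U \<mu>) g
    = (\<Sum>\<nu>\<in>Par N. \<Sum>l\<in>Par N. \<Sum>\<mu>\<in>Par N.
        ((- 1) ^ psize l * LR \<alpha> l \<mu> * LR \<beta> (conj_partition l) \<nu>) *\<^sub>Q (D \<nu> \<circ> U \<mu>) g)"
    by (rule op_sum_Sum_any_eq) (use LR_support[of \<alpha> N] LR_support[of \<beta> N] in \<open>auto simp: N_def\<close>)
  also have "\<dots> = (\<Sum>l\<in>Par N. (- 1) ^ psize l *\<^sub>Q (\<Sum>\<nu>\<in>Par N. \<Sum>\<mu>\<in>Par N.
      (power_form (D_op (schur l) a) (schur \<mu>) * power_form (D_op (schur (conj_partition l)) b) (schur \<nu>))
        *\<^sub>Q D_op (schur \<nu>) (schur \<mu> * g)))"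
    by (subst sum.swap) (simp add: LR_eq D_adjoint U_op_def sym.scale_sum_right mult_ac a_def b_def)
  also have "\<dots> = (\<Sum>l\<in>Par N. (- 1) ^ psize l *\<^sub>Q D_op (D_op (schur (conj_partition l)) b) (D_op (schur l) a * g))"
  proof -
    have "bilin (\<lambda>x y. D_op y (x * g))"
      unfolding bilin_def using lin_comp[OF lin_D lin_mult1] lin_D_left by blast
    from bilin_expansion[OF this degree_le_D[OF N(1)] degree_le_D[OF N(2)]] show ?thesis by simp
  qed
  also have "\<dots> = (\<Sum>l\<in>Par N. D_op (D_op (antipode (schur l)) b) (D_op (schur l) a * g))"
    by (simp add: antipode_schur lin_scale[OF lin_D_left])
  also have "\<dots> = (\<Sum>l\<in>Par N. \<Sum>k\<in>Par N.
      D_op (schur k) (D_op (schur l) a) * D_op (D_op (schur k) (D_op (antipode (schur l)) b)) g)"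
    unfolding D_product
    by (rule sum.cong[OF refl], rule coproduct_right) (intro lin_mult_right lin_D_left degree_le_D N)+
  also have "\<dots> = (\<Sum>l\<in>Par N. \<Sum>k\<in>Par N. D_op (schur k * schur l) a * M (schur k * antipode (schur l)))"
    by (simp add: M_def D_mult)
  also have "\<dots> = (\<Sum>l\<in>Par N. \<Sum>k\<in>Par N. \<Sum>r\<in>Par N.
      power_form (schur r) (schur k * schur l) *\<^sub>Q (D_op (schur r) a * M (schur k * antipode (schur l))))"
    by (intro sum.cong refl, subst D_expansion[OF N(1), symmetric])
       (simp add: sum_distrib_right scale_mult_left power_form_commute[of "_ * _"])
  also have "\<dots> = (\<Sum>l\<in>Par N. \<Sum>r\<in>Par N. \<Sum>k\<in>Par N.
      power_form (schur r) (schur k * schur l) *\<^sub>Q (D_op (schur r) a * M (schur k * antipode (schur l))))"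
    by (rule sum.cong[OF refl]) (rule sum.swap)
  also have "\<dots> = (\<Sum>r\<in>Par N. \<Sum>l\<in>Par N. \<Sum>k\<in>Par N.
      power_form (schur r) (schur k * schur l) *\<^sub>Q (D_op (schur r) a * M (schur k * antipode (schur l))))"
    by (rule sum.swap)
  also have "\<dots> = (\<Sum>r\<in>Par N. \<Sum>k\<in>Par N. \<Sum>l\<in>Par N.
      power_form (schur r) (schur k * schur l) *\<^sub>Q (D_op (schur r) a * M (schur k * antipode (schur l))))"
    by (rule sum.cong[OF refl]) (rule sum.swap)
  also have "\<dots> = (\<Sum>r\<in>Par N. D_op (schur r) a * M (\<Sum>k\<in>Par N. \<Sum>l\<in>Par N.
      power_form (schur r) (schur k * schur l) *\<^sub>Q (schur k * antipode (schur l))))"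
    by (simp add: lin_sum[OF lM] lin_scale[OF lM] sum_distrib_left scale_mult_right)
  also have "\<dots> = (\<Sum>r\<in>Par N. D_op (schur r) a * M (power_form (schur r) 1 *\<^sub>Q 1))"
  proof (intro sum.cong refl)
    fix r assume r: "r \<in> Par N"
    show "D_op (schur r) a * M (\<Sum>k\<in>Par N. \<Sum>l\<in>Par N. power_form (schur r) (schur k * schur l) *\<^sub>Q (schur k * antipode (schur l)))
      = D_op (schur r) a * M (power_form (schur r) 1 *\<^sub>Q 1)"
      unfolding antipode_convolution[symmetric] coproduct_eq[OF degree_le_schur_Par[OF r]] ..
  qed
  also have "\<dots> = (\<Sum>r\<in>Par N. power_form 1 (schur r) *\<^sub>Q D_op (schur r) a) * M 1"
    by (simp add: lin_scale[OF lM] scale_mult_left scale_mult_right sum_distrib_right power_form_commute[of 1])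
  also have "\<dots> = (U \<alpha> \<circ> D \<beta>) g"
    using D_expansion[OF N(1), of 1] by (simp add: D_1 M_def U_op_def a_def b_def)
  finally show "(U \<alpha> \<circ> D \<beta>) g = op_sum (\<lambda>\<mu> \<nu>. Sum_any (\<lambda>l.
     (- 1) ^ psize l * LR \<alpha> l \<mu> * LR \<beta> (conj_partition l) \<nu>)) (\<lambda>\<mu> \<nu>. D \<nu> \<circ> U \<mu>) g" ..
qed

lemma kron_coeff_support: "l \<in> Par N \<Longrightarrow> kron_coeff l \<mu> \<nu> \<noteq> 0 \<Longrightarrow> \<nu> \<in> Par N"
  unfolding kron_coeff_eq
  using power_form_schur_high[OF degree_le_kronecker[OF degree_le_schur_Par]] by (force simp: Par_def not_less[symmetric])

lemma kron_LR_support: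
  assumes "kron_coeff \<alpha> l \<mu> * LR \<beta> l \<nu> \<noteq> 0"
  shows "l \<in> Par (psize \<alpha> + psize \<beta>) \<and> \<mu> \<in> Par (psize \<alpha> + psize \<beta>) \<and> \<nu> \<in> Par (psize \<alpha> + psize \<beta>)"
  using assms LR_support[of \<beta> "psize \<alpha> + psize \<beta>" l \<nu>] kron_coeff_support[of \<alpha> "psize \<alpha> + psize \<beta>" l \<mu>]
  by (auto simp: Par_def)

lemma K_U: "K \<beta> \<circ> U \<alpha> = op_sum (\<lambda>\<mu> \<nu>. Sum_any (\<lambda>l. kron_coeff \<alpha> l \<mu> * LR \<beta> l \<nu>)) (\<lambda>\<mu> \<nu>. U \<mu> \<circ> K \<nu>)"
proof
  fix g
  define N where "N = psize \<alpha> + psize \<beta>"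
  have N: "degree_le N (schur \<alpha>)" "degree_le N (schur \<beta>)"
    by (auto intro!: degree_le_schur simp: N_def)
  have "op_sum (\<lambda>\<mu> \<nu>. Sum_any (\<lambda>l. kron_coeff \<alpha> l \<mu> * LR \<beta> l \<nu>)) (\<lambda>\<mu> \<nu>. U \<mu> \<circ> K \<nu>) g
      = (\<Sum>\<nu>\<in>Par N. \<Sum>l\<in>Par N. \<Sum>\<mu>\<in>Par N. (kron_coeff \<alpha> l \<mu> * LR \<beta> l \<nu>) *\<^sub>Q (U \<mu> \<circ> K \<nu>) g)"
    by (rule op_sum_Sum_any_eq) (use kron_LR_support[of \<alpha> _ _ \<beta>] in \<open>auto simp: N_def\<close>)
  also have "\<dots> = (\<Sum>l\<in>Par N. \<Sum>\<nu>\<in>Par N. \<Sum>\<mu>\<in>Par N.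
      (power_form (kronecker (schur \<alpha>) (schur l)) (schur \<mu>) * power_form (D_op (schur l) (schur \<beta>)) (schur \<nu>))
        *\<^sub>Q (schur \<mu> * kronecker (schur \<nu>) g))"
    by (subst sum.swap) (simp add: LR_eq kron_coeff_eq D_adjoint U_op_def K_op_def)
  also have "\<dots> = (\<Sum>l\<in>Par N. kronecker (schur \<alpha>) (schur l) * kronecker (D_op (schur l) (schur \<beta>)) g)"
    by (rule sum.cong[OF refl], rule bilin_expansion[OF bilin_mult_comp[OF lin_id lin_kronecker_left]])
       (intro degree_le_D degree_le_kronecker N)+
  also have "\<dots> = coproduct (\<lambda>x y. kronecker (schur \<alpha>) x * kronecker y g) (schur \<beta>)"
    by (rule coproduct_right[symmetric]) (intro lin_mult_right lin_kronecker_left N)+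
  also have "\<dots> = (K \<beta> \<circ> U \<alpha>) g"
    by (simp add: kronecker_product kronecker_commute[of "schur \<alpha>"] U_op_def K_op_def)
  finally show "(K \<beta> \<circ> U \<alpha>) g
     = op_sum (\<lambda>\<mu> \<nu>. Sum_any (\<lambda>l. kron_coeff \<alpha> l \<mu> * LR \<beta> l \<nu>)) (\<lambda>\<mu> \<nu>. U \<mu> \<circ> K \<nu>) g" ..
qed

lemma D_K: "D \<alpha> \<circ> K \<beta> = op_sum (\<lambda>\<mu> \<nu>. Sum_any (\<lambda>l. kron_coeff \<alpha> l \<mu> * LR \<beta> l \<nu>)) (\<lambda>\<mu> \<nu>. K \<nu> \<circ> D \<mu>)"
  (is "_ = op_sum ?c _")
proof
  fix g
  define N where "N = psize \<alpha> + psize \<beta>"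
  show "(D \<alpha> \<circ> K \<beta>) g = op_sum ?c (\<lambda>\<mu> \<nu>. K \<nu> \<circ> D \<mu>) g"
  proof (rule power_form_eqI)
    fix h
    have "power_form ((D \<alpha> \<circ> K \<beta>) g) h = power_form g ((K \<beta> \<circ> U \<alpha>) h)"
      by (simp add: D_adjoint K_op_def U_op_def kronecker_adjoint)
    also have "\<dots> = power_form g (op_sum ?c (\<lambda>\<mu> \<nu>. U \<mu> \<circ> K \<nu>) h)" by (simp only: K_U)
    also have "\<dots> = power_form (op_sum ?c (\<lambda>\<mu> \<nu>. K \<nu> \<circ> D \<mu>) g) h"
    proof (rule op_sum_adjoint[where A = "Par N" and B = "Par N", symmetric])
      fix \<mu> \<nu> assume "?c \<mu> \<nu> \<noteq> 0"
      from Sum_any_nonzeroE[OF this] show "\<mu> \<in> Par N \<and> \<nu> \<in> Par N"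
        using kron_LR_support by (auto simp: N_def)
    qed (simp_all add: D_adjoint K_op_def U_op_def kronecker_adjoint)
    finally show "power_form ((D \<alpha> \<circ> K \<beta>) g) h = power_form (op_sum ?c (\<lambda>\<mu> \<nu>. K \<nu> \<circ> D \<mu>) g) h" .
  qed
qed

definition kbar_coeff :: "partition \<Rightarrow> partition \<Rightarrow> partition \<times> partition \<times> partition \<times> partition \<Rightarrow> partition \<Rightarrow> partition \<Rightarrow> rat" where
  "kbar_coeff \<alpha> \<beta> t \<mu> \<nu> =
     (case t of (l, \<sigma>, \<tau>, \<theta>) \<Rightarrow> kron_coeff l \<tau> \<theta> * LR \<beta> l \<nu> * LR \<alpha> \<tau> \<sigma> * LR \<mu> \<theta> \<sigma>)"

text \<open>
  The bound \<open>N + N\<close> for \<open>\<mu>\<close> comes from the product \<open>s\<^sub>\<theta> s\<^sub>\<sigma>\<close> of two functions of degree at most \<open>N\<close>.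
\<close>

lemma kbar_coeff_support:
  assumes "psize \<alpha> \<le> N" "psize \<beta> \<le> N" "kbar_coeff \<alpha> \<beta> t \<mu> \<nu> \<noteq> 0"
  shows "t \<in> Par N \<times> Par N \<times> Par N \<times> Par N \<and> \<mu> \<in> Par (N + N) \<and> \<nu> \<in> Par N"
proof -
  obtain l \<sigma> \<tau> \<theta> where t: "t = (l, \<sigma>, \<tau>, \<theta>)" by (cases t)
  have nz: "kron_coeff l \<tau> \<theta> \<noteq> 0" "LR \<beta> l \<nu> \<noteq> 0" "LR \<alpha> \<tau> \<sigma> \<noteq> 0" "LR \<mu> \<theta> \<sigma> \<noteq> 0"
    using assms(3) by (auto simp: t kbar_coeff_def)
  have 1: "l \<in> Par N" "\<nu> \<in> Par N" "\<tau> \<in> Par N" "\<sigma> \<in> Par N"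
    using LR_support assms nz by blast+
  have 2: "\<theta> \<in> Par N" using kron_coeff_support[OF 1(1) nz(1)] .
  have "\<mu> \<in> Par (N + N)"
    using power_form_schur_high[OF degree_le_mult[OF degree_le_schur_Par[OF 2] degree_le_schur_Par[OF 1(4)]], of \<mu>] nz(4)
    by (auto simp: LR_eq power_form_commute[of "schur \<mu>"] Par_def not_less[symmetric])
  thus ?thesis using 1 2 t by simp
qed

lemma Kbar_U: "Kbar \<beta> \<circ> U \<alpha> = op_sum (\<lambda>\<mu> \<nu>. Sum_any (\<lambda>t. kbar_coeff \<alpha> \<beta> t \<mu> \<nu>)) (\<lambda>\<mu> \<nu>. U \<mu> \<circ> Kbar \<nu>)"
proof
  fix g
  define N where "N = psize \<alpha> + psize \<beta>"
  have N: "degree_le N (schur \<alpha>)" "degree_le N (schur \<beta>)"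
    by (auto intro!: degree_le_schur simp: N_def)
  let ?P = "Par N"
  have inner: "(\<Sum>\<sigma>\<in>?P. \<Sum>\<tau>\<in>?P. \<Sum>\<theta>\<in>?P. \<Sum>\<mu>\<in>Par (N + N).
       kbar_coeff \<alpha> \<beta> (l, \<sigma>, \<tau>, \<theta>) \<mu> \<nu> *\<^sub>Q (schur \<mu> * z))
     = power_form (schur \<beta>) (schur l * schur \<nu>) *\<^sub>Q (kron_induced (schur l) (schur \<alpha>) * z)"
    if l: "l \<in> ?P" for l \<nu> z
  proof -
    have sum_mu: "(\<Sum>\<mu>\<in>Par (N + N). power_form (schur \<theta> * schur \<sigma>) (schur \<mu>) *\<^sub>Q (schur \<mu> * z)) = schur \<theta> * schur \<sigma> * z"
      if "\<theta> \<in> ?P" "\<sigma> \<in> ?P" for \<theta> \<sigma>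
      by (rule lin_expansion[OF lin_mult1]) (intro degree_le_mult degree_le_schur_Par that)
    have sum_th: "(\<Sum>\<theta>\<in>?P. power_form (kronecker (schur l) (schur \<tau>)) (schur \<theta>) *\<^sub>Q (schur \<theta> * schur \<sigma> * z))
        = kronecker (schur l) (schur \<tau>) * schur \<sigma> * z" for \<tau> \<sigma>
      by (rule lin_expansion) (intro lin_mult_left lin_id degree_le_kronecker degree_le_schur_Par l)+
    have "(\<Sum>\<sigma>\<in>?P. \<Sum>\<tau>\<in>?P. \<Sum>\<theta>\<in>?P. \<Sum>\<mu>\<in>Par (N + N).
         kbar_coeff \<alpha> \<beta> (l, \<sigma>, \<tau>, \<theta>) \<mu> \<nu> *\<^sub>Q (schur \<mu> * z))
      = (\<Sum>\<sigma>\<in>?P. \<Sum>\<tau>\<in>?P. (LR \<beta> l \<nu> * LR \<alpha> \<tau> \<sigma>) *\<^sub>Q (\<Sum>\<theta>\<in>?P. kron_coeff l \<tau> \<theta> *\<^sub>Q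
          (\<Sum>\<mu>\<in>Par (N + N). LR \<mu> \<theta> \<sigma> *\<^sub>Q (schur \<mu> * z))))"
      by (simp add: kbar_coeff_def sym.scale_sum_right mult_ac)
    also have "\<dots> = (\<Sum>\<sigma>\<in>?P. \<Sum>\<tau>\<in>?P. (LR \<beta> l \<nu> * LR \<alpha> \<tau> \<sigma>) *\<^sub>Q (\<Sum>\<theta>\<in>?P. kron_coeff l \<tau> \<theta> *\<^sub>Q
          (schur \<theta> * schur \<sigma> * z)))"
      by (intro sum.cong refl arg_cong2[where f = sym_scale]) (simp add: LR_eq power_form_commute[of "schur _" "_ * _"] sum_mu)
    also have "\<dots> = (\<Sum>\<sigma>\<in>?P. \<Sum>\<tau>\<in>?P. (LR \<beta> l \<nu> * LR \<alpha> \<tau> \<sigma>) *\<^sub>Q (kronecker (schur l) (schur \<tau>) * schur \<sigma> * z))"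
      by (simp add: kron_coeff_eq sum_th)
    also have "\<dots> = LR \<beta> l \<nu> *\<^sub>Q ((\<Sum>\<tau>\<in>?P. \<Sum>\<sigma>\<in>?P. LR \<alpha> \<tau> \<sigma> *\<^sub>Q (kronecker (schur l) (schur \<tau>) * schur \<sigma>)) * z)"
      by (subst sum.swap) (simp add: sym.scale_sum_right sum_distrib_right scale_mult_left)
    finally show ?thesis by (simp add: LR_eq kron_induced_def coproduct_eq[OF N(1)])
  qed
  have "op_sum (\<lambda>\<mu> \<nu>. Sum_any (\<lambda>t. kbar_coeff \<alpha> \<beta> t \<mu> \<nu>)) (\<lambda>\<mu> \<nu>. U \<mu> \<circ> Kbar \<nu>) g
     = (\<Sum>\<nu>\<in>?P. \<Sum>t\<in>?P \<times> ?P \<times> ?P \<times> ?P. \<Sum>\<mu>\<in>Par (N + N). kbar_coeff \<alpha> \<beta> t \<mu> \<nu> *\<^sub>Q (U \<mu> \<circ> Kbar \<nu>) g)"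
    by (rule op_sum_Sum_any_eq) (use kbar_coeff_support[of \<alpha> N \<beta>] in \<open>auto simp: N_def simp del: mem_Sigma_iff\<close>)
  also have "\<dots> = (\<Sum>\<nu>\<in>?P. \<Sum>l\<in>?P. \<Sum>\<sigma>\<in>?P. \<Sum>\<tau>\<in>?P. \<Sum>\<theta>\<in>?P. \<Sum>\<mu>\<in>Par (N + N).
      kbar_coeff \<alpha> \<beta> (l, \<sigma>, \<tau>, \<theta>) \<mu> \<nu> *\<^sub>Q (schur \<mu> * Kbar \<nu> g))"
    by (simp add: sum.cartesian_product' U_op_def)
  also have "\<dots> = (\<Sum>\<nu>\<in>?P. \<Sum>l\<in>?P. power_form (schur \<beta>) (schur l * schur \<nu>) *\<^sub>Q
      (kron_induced (schur l) (schur \<alpha>) * Kbar \<nu> g))"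
    by (intro sum.cong refl inner)
  also have "\<dots> = (Kbar \<beta> \<circ> U \<alpha>) g"
    by (simp add: Kbar_product[OF N(2)] U_op_def)
  finally show "(Kbar \<beta> \<circ> U \<alpha>) g
     = op_sum (\<lambda>\<mu> \<nu>. Sum_any (\<lambda>t. kbar_coeff \<alpha> \<beta> t \<mu> \<nu>)) (\<lambda>\<mu> \<nu>. U \<mu> \<circ> Kbar \<nu>) g" ..
qed

lemma D_Kbar: "D \<alpha> \<circ> Kbar \<beta> = op_sum (\<lambda>\<mu> \<nu>. Sum_any (\<lambda>t. kbar_coeff \<alpha> \<beta> t \<mu> \<nu>)) (\<lambda>\<mu> \<nu>. Kbar \<nu> \<circ> D \<mu>)"
  (is "_ = op_sum ?c _")
proof
  fix g
  define N where "N = psize \<alpha> + psize \<beta>"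
  show "(D \<alpha> \<circ> Kbar \<beta>) g = op_sum ?c (\<lambda>\<mu> \<nu>. Kbar \<nu> \<circ> D \<mu>) g"
  proof (rule power_form_eqI)
    fix h
    have "power_form ((D \<alpha> \<circ> Kbar \<beta>) g) h = power_form g ((Kbar \<beta> \<circ> U \<alpha>) h)"
      by (simp add: D_adjoint U_op_def Kbar_adjoint)
    also have "\<dots> = power_form g (op_sum ?c (\<lambda>\<mu> \<nu>. U \<mu> \<circ> Kbar \<nu>) h)" by (simp only: Kbar_U)
    also have "\<dots> = power_form (op_sum ?c (\<lambda>\<mu> \<nu>. Kbar \<nu> \<circ> D \<mu>) g) h"
    proof (rule op_sum_adjoint[where A = "Par (N + N)" and B = "Par N", symmetric])
      fix \<mu> \<nu> assume "?c \<mu> \<nu> \<noteq> 0"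
      from Sum_any_nonzeroE[OF this] obtain t where "kbar_coeff \<alpha> \<beta> t \<mu> \<nu> \<noteq> 0" by blast
      from kbar_coeff_support[OF _ _ this, of N] show "\<mu> \<in> Par (N + N) \<and> \<nu> \<in> Par N"
        by (simp add: N_def)
    qed (simp_all add: D_adjoint U_op_def Kbar_adjoint)
    finally show "power_form ((D \<alpha> \<circ> Kbar \<beta>) g) h = power_form (op_sum ?c (\<lambda>\<mu> \<nu>. Kbar \<nu> \<circ> D \<mu>) g) h" .
  qed
qed

theorem theorem2p1:
  fixes \<alpha> \<beta> :: partition
  shows
    "D \<beta> \<circ> U \<alpha> =
       op_sum (\<lambda>\<mu> \<nu>. Sum_any (\<lambda>l. LR \<alpha> l \<mu> * LR \<beta> l \<nu>)) (\<lambda>\<mu> \<nu>. U \<mu> \<circ> D \<nu>)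
   \<and> U \<alpha> \<circ> D \<beta> =
       op_sum (\<lambda>\<mu> \<nu>. Sum_any (\<lambda>l. (- 1) ^ psize l * LR \<alpha> l \<mu> * LR \<beta> (conj_partition l) \<nu>))
         (\<lambda>\<mu> \<nu>. D \<nu> \<circ> U \<mu>)
   \<and> K \<beta> \<circ> U \<alpha> =
       op_sum (\<lambda>\<mu> \<nu>. Sum_any (\<lambda>l. kron_coeff \<alpha> l \<mu> * LR \<beta> l \<nu>)) (\<lambda>\<mu> \<nu>. U \<mu> \<circ> K \<nu>)
   \<and> D \<alpha> \<circ> K \<beta> =
       op_sum (\<lambda>\<mu> \<nu>. Sum_any (\<lambda>l. kron_coeff \<alpha> l \<mu> * LR \<beta> l \<nu>)) (\<lambda>\<mu> \<nu>. K \<nu> \<circ> D \<mu>)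
   \<and> Kbar \<beta> \<circ> U \<alpha> =
       op_sum (\<lambda>\<mu> \<nu>. Sum_any (\<lambda>(l, \<sigma>, \<tau>, \<theta>).
           kron_coeff l \<tau> \<theta> * LR \<beta> l \<nu> * LR \<alpha> \<tau> \<sigma> * LR \<mu> \<theta> \<sigma>))
         (\<lambda>\<mu> \<nu>. U \<mu> \<circ> Kbar \<nu>)
   \<and> D \<alpha> \<circ> Kbar \<beta> =
       op_sum (\<lambda>\<mu> \<nu>. Sum_any (\<lambda>(l, \<sigma>, \<tau>, \<theta>).
           kron_coeff l \<tau> \<theta> * LR \<beta> l \<nu> * LR \<alpha> \<tau> \<sigma> * LR \<mu> \<theta> \<sigma>))
         (\<lambda>\<mu> \<nu>. Kbar \<nu> \<circ> D \<mu>)"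
  by (intro conjI D_U U_D K_U D_K Kbar_U[unfolded kbar_coeff_def] D_Kbar[unfolded kbar_coeff_def])

end
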